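(* (a) Let $G(s)$ be an $n\times n$ strictly proper complex symmetric transfer function of McMillan degree $\delta>\binom{n+1}{2}$ (resp. a Hamiltonian transfer function with $\delta>n(n+1)$). Then $G$ is not generically pole assignable by symmetric feedback: the set of closed-loop characteristic polynomials $\{\varphi_F: F\in\mathrm{Sym}(n)\}$ does not contain a nonempty Zariski open subset of the space of monic polynomials of degree $\delta$ (resp. of monic even polynomials of degree $\delta$); this holds for real as well as complex symmetric $F$. (b) If $\delta\le\binom{n+1}{2}$ (resp. $\delta\le n(n+1)$ in the Hamiltonian case), then there is a nonempty Zariski open subset $\mathcal{U}$ of $SRat_{\delta,n}(\mathbb{C})$ (resp. of $Ham_{\delta,n}(\mathbb{C})$) such that every $G\in\mathcal{U}$ is generically pole assignable by complex symmetric feedback: the set $\{\varphi_F:F\in\mathrm{Sym}(n)\}$ contains a nonempty Zariski open subset of the affine space of monic polynomials of degree $\delta$ (resp. of monic even polynomials $\varphi(s)=\varphi(-s)$ of degree $\delta$).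
   Context: A strictly proper rational matrix $G(s)\in\mathbb{C}(s)^{n\times n}$ is symmetric if $G(s)=G(s)^t$ and Hamiltonian if $G(s)=G(-s)^t$. $SRat_{\delta,n}(\mathbb{C})$ and $Ham_{\delta,n}(\mathbb{C})$ denote the sets of strictly proper complex symmetric, resp. Hamiltonian, $n\times n$ transfer functions of McMillan degree $\delta$; they are irreducible quasi-affine varieties, and "generic" means "belonging to a nonempty Zariski open subset". $\mathrm{Sym}(n)$ is the space of complex symmetric $n\times n$ matrices. For $F\in\mathrm{Sym}(n)$ the closed-loop transfer function is $G_F(s)=(I_n-G(s)F)^{-1}G(s)$, and its closed-loop characteristic polynomial is $\varphi_F(s)=\det(sI_\delta-A-BFC)$ where $(A,B,C)$ is any minimal realization of $G$ (independent of the choice); its zeros are the poles of $G_F$. In the Hamiltonian case $\varphi_F$ is always even.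
   Formalization: In the Hamiltonian case of (b) the McMillan degree δ is assumed even; for odd δ there are no Hamiltonian transfer functions of degree δ (e.g. n = δ = 1), so no nonempty open subset of Ham could exist. *)

theory Defs
  imports Complex_Main "Jordan_Normal_Form.Char_Poly"
begin

inductive_set poly_fun :: "nat \<Rightarrow> (complex list \<Rightarrow> complex) set" for N :: nat where
  pf_const: "(\<lambda>xs. c) \<in> poly_fun N"
| pf_var: "i < N \<Longrightarrow> (\<lambda>xs. xs ! i) \<in> poly_fun N"
| pf_add: "p \<in> poly_fun N \<Longrightarrow> q \<in> poly_fun N \<Longrightarrow> (\<lambda>xs. p xs + q xs) \<in> poly_fun N"
| pf_mult: "p \<in> poly_fun N \<Longrightarrow> q \<in> poly_fun N \<Longrightarrow> (\<lambda>xs. p xs * q xs) \<in> poly_fun N"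

definition affine_space :: "nat \<Rightarrow> complex list set" where
  "affine_space N = {xs. length xs = N}"

definition zariski_closed :: "nat \<Rightarrow> complex list set \<Rightarrow> bool" where
  "zariski_closed N Z \<longleftrightarrow>
     (\<exists>P. P \<subseteq> poly_fun N \<and> Z = {xs \<in> affine_space N. \<forall>p\<in>P. p xs = 0})"

definition zariski_open :: "nat \<Rightarrow> complex list set \<Rightarrow> bool" where
  "zariski_open N U \<longleftrightarrow> (\<exists>Z. zariski_closed N Z \<and> U = affine_space N - Z)"

definition monic_of :: "nat \<Rightarrow> complex list \<Rightarrow> complex poly" where
  "monic_of d xs = monom 1 d + (\<Sum>i<d. monom (xs ! i) i)"

definition even_monic_of :: "nat \<Rightarrow> complex list \<Rightarrow> complex poly" where
  "even_monic_of d xs = monom 1 d + (\<Sum>i<d div 2. monom (xs ! i) (2 * i))"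

definition contains_open_monic :: "nat \<Rightarrow> complex poly set \<Rightarrow> bool" where
  "contains_open_monic d S \<longleftrightarrow>
     (\<exists>V. zariski_open d V \<and> V \<noteq> {} \<and> monic_of d ` V \<subseteq> S)"

definition contains_open_even_monic :: "nat \<Rightarrow> complex poly set \<Rightarrow> bool" where
  "contains_open_even_monic d S \<longleftrightarrow>
     (\<exists>V. zariski_open (d div 2) V \<and> V \<noteq> {} \<and> even_monic_of d ` V \<subseteq> S)"

text \<open>A strictly proper n x n transfer function G(s) = sum_k M_k s^(-k-1) is represented by
  its sequence of Markov parameters M :: nat => complex mat.\<close>

definition is_realization ::
  "nat \<Rightarrow> nat \<Rightarrow> (nat \<Rightarrow> complex mat) \<Rightarrow> complex mat \<Rightarrow> complex mat \<Rightarrow> complex mat \<Rightarrow> bool" where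
  "is_realization n d G A B C \<longleftrightarrow>
     A \<in> carrier_mat d d \<and> B \<in> carrier_mat d n \<and> C \<in> carrier_mat n d \<and>
     (\<forall>k. G k = C * (A ^\<^sub>m k) * B)"

definition has_mcmillan_degree :: "nat \<Rightarrow> (nat \<Rightarrow> complex mat) \<Rightarrow> nat \<Rightarrow> bool" where
  "has_mcmillan_degree n G d \<longleftrightarrow>
     (\<exists>A B C. is_realization n d G A B C) \<and>
     (\<forall>d' A B C. is_realization n d' G A B C \<longrightarrow> d \<le> d')"

definition SRat :: "nat \<Rightarrow> nat \<Rightarrow> (nat \<Rightarrow> complex mat) set" where
  "SRat d n = {G. has_mcmillan_degree n G d \<and> (\<forall>k. transpose_mat (G k) = G k)}"

text \<open>G(s) = G(-s)^t means M_k = (-1)^(k+1) M_k^t for all k.\<close>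
definition Ham :: "nat \<Rightarrow> nat \<Rightarrow> (nat \<Rightarrow> complex mat) set" where
  "Ham d n = {G. has_mcmillan_degree n G d \<and>
                 (\<forall>k. G k = (-1) ^ (k + 1) \<cdot>\<^sub>m transpose_mat (G k))}"

text \<open>Embedding of degree-d transfer functions into C^(2 d n^2) via the first 2d Markov
  parameters (injective on transfer functions of McMillan degree d).\<close>
definition markov_coords :: "nat \<Rightarrow> nat \<Rightarrow> (nat \<Rightarrow> complex mat) \<Rightarrow> complex list" where
  "markov_coords d n G =
     concat (map (\<lambda>k. concat (map (\<lambda>i. map (\<lambda>j. G k $$ (i, j)) [0..<n]) [0..<n])) [0..<2 * d])"

definition rat_zariski_open ::
  "nat \<Rightarrow> nat \<Rightarrow> (nat \<Rightarrow> complex mat) set \<Rightarrow> (nat \<Rightarrow> complex mat) set \<Rightarrow> bool" where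
  "rat_zariski_open d n X U \<longleftrightarrow>
     (\<exists>V. zariski_open (2 * d * n * n) V \<and> U = {G \<in> X. markov_coords d n G \<in> V})"

definition Sym :: "nat \<Rightarrow> complex mat set" where
  "Sym n = {F. F \<in> carrier_mat n n \<and> transpose_mat F = F}"

definition real_Sym :: "nat \<Rightarrow> complex mat set" where
  "real_Sym n = {F \<in> Sym n. \<forall>i<n. \<forall>j<n. F $$ (i, j) \<in> \<real>}"

definition closed_loop_polys :: "complex mat \<Rightarrow> complex mat \<Rightarrow> complex mat \<Rightarrow> complex mat set \<Rightarrow> complex poly set" where
  "closed_loop_polys A B C Fs = {char_poly (A + B * F * C) | F. F \<in> Fs}"

end

theory Submission
  imports Defs
begin

text \<open>
  For a fixed system the closed-loop characteristic polynomial is a polynomial map of the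
  \<open>N = (n + 1) choose 2\<close> entries of the symmetric feedback \<open>F\<close>. If there are more coefficients to assign
  than \<open>N\<close>, they satisfy an algebraic relation, so the image contains no nonempty Zariski open set.
  In the Hamiltonian case this count needs the McMillan degree to be even, which holds because the
  state space of a minimal realization carries a nondegenerate skew-symmetric form.

  Conversely, at \<open>F = 0\<close> the differential of the map sends \<open>H\<close> to a unitriangular combination of
  the numbers \<open>tr (H G\<^sub>k)\<close>, where \<open>G\<^sub>0, G\<^sub>1, \<dots>\<close> are the Markov parameters. It is therefore onto as soon
  as \<open>G\<^sub>0, \<dots>, G\<^sub>d\<^sub>-\<^sub>1\<close> (in the Hamiltonian case \<open>G\<^sub>1, G\<^sub>3, \<dots>, G\<^sub>d\<^sub>-\<^sub>1\<close>) are linearly independent, and this is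
  the open condition defining \<open>U\<close>. Surjectivity of the differential makes the image Zariski dense, and a
  dense image contains a nonempty open set because images of polynomial maps are constructible.
\<close>

section \<open>Polynomial functions\<close>

text \<open>Two features of the setting shape the argument. The realization \<open>(A, B, C)\<close>
  is arbitrary, so a Hamiltonian symmetry is visible only in the Markov parameters, and everything
  about evenness has to be recovered from them by Cayley-Hamilton recurrences. Moreover, in the
  Hamiltonian case the differential is used for the even coefficients only: the even-indexed Markov
  parameters are skew-symmetric and pair to zero with a symmetric \<open>H\<close>. That the odd
  coefficients vanish for every feedback is a separate argument. Dimension theory is replaced by two
  elementary devices. A constructible set either lies in the zero set of a nonzero polynomial or
  contains a nonempty principal open set; and algebraic dependence comes from counting monomials
  against grid points. Nonemptiness of \<open>U\<close> needs explicit systems. Distinct simple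
  poles with rank-one residues give them, and the same nonzero minor that puts such a system into
  \<open>U\<close> also certifies its McMillan degree, since a smaller realization would impose a
  linear relation on the Markov parameters.\<close>

lemma poly_fun_sum:
  "(\<And>i. i \<in> I \<Longrightarrow> f i \<in> poly_fun N) \<Longrightarrow> (\<lambda>xs. \<Sum>i\<in>I. f i xs) \<in> poly_fun N"
  by (induction I rule: infinite_finite_induct) (auto intro: poly_fun.intros)

lemma poly_fun_prod:
  "(\<And>i. i \<in> I \<Longrightarrow> f i \<in> poly_fun N) \<Longrightarrow> (\<lambda>xs. \<Prod>i\<in>I. f i xs) \<in> poly_fun N"
  by (induction I rule: infinite_finite_induct) (auto intro: poly_fun.intros)

lemma poly_fun_power: "f \<in> poly_fun N \<Longrightarrow> (\<lambda>xs. f xs ^ k) \<in> poly_fun N"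
  by (induction k) (auto intro: poly_fun.intros)

lemma poly_fun_uminus: "f \<in> poly_fun N \<Longrightarrow> (\<lambda>xs. - f xs) \<in> poly_fun N"
  using pf_mult[OF pf_const[of "-1"], of f N] by simp

lemma poly_fun_diff:
  "f \<in> poly_fun N \<Longrightarrow> g \<in> poly_fun N \<Longrightarrow> (\<lambda>xs. f xs - g xs) \<in> poly_fun N"
  using pf_add[OF _ poly_fun_uminus, of f N g] by simp

lemma poly_fun_if:
  "f \<in> poly_fun N \<Longrightarrow> g \<in> poly_fun N \<Longrightarrow> (\<lambda>xs. if b then f xs else g xs) \<in> poly_fun N"
  by (cases b) auto

lemmas poly_fun_intros = pf_const pf_var pf_add pf_mult poly_fun_sum poly_fun_prod poly_fun_power
  poly_fun_uminus poly_fun_diff poly_fun_if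

section \<open>Univariate polynomials whose coefficients are polynomial in parameters\<close>

definition poly_family :: "nat \<Rightarrow> (complex list \<Rightarrow> complex poly) \<Rightarrow> bool" where
  "poly_family N \<phi> \<longleftrightarrow> (\<forall>i. (\<lambda>xs. coeff (\<phi> xs) i) \<in> poly_fun N)"

lemma poly_family_const: "poly_family N (\<lambda>xs. p)"
  by (auto simp: poly_family_def intro: poly_fun_intros)

lemma poly_family_of_poly_fun: "f \<in> poly_fun N \<Longrightarrow> poly_family N (\<lambda>xs. [:f xs:])"
  unfolding poly_family_def
proof
  fix i assume "f \<in> poly_fun N"
  then show "(\<lambda>xs. coeff [:f xs:] i) \<in> poly_fun N" by (cases i) (auto intro: pf_const)
qed

lemma poly_family_add:
  "poly_family N \<phi> \<Longrightarrow> poly_family N \<psi> \<Longrightarrow> poly_family N (\<lambda>xs. \<phi> xs + \<psi> xs)"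
  by (auto simp: poly_family_def intro: poly_fun_intros)

lemma poly_family_diff:
  "poly_family N \<phi> \<Longrightarrow> poly_family N \<psi> \<Longrightarrow> poly_family N (\<lambda>xs. \<phi> xs - \<psi> xs)"
  by (auto simp: poly_family_def intro: poly_fun_intros)

lemma poly_family_mult:
  "poly_family N \<phi> \<Longrightarrow> poly_family N \<psi> \<Longrightarrow> poly_family N (\<lambda>xs. \<phi> xs * \<psi> xs)"
  by (auto simp: poly_family_def coeff_mult intro!: poly_fun_intros)

lemma poly_family_sum:
  "(\<And>i. i \<in> I \<Longrightarrow> poly_family N (f i)) \<Longrightarrow> poly_family N (\<lambda>xs. \<Sum>i\<in>I. f i xs)"
  by (induction I rule: infinite_finite_induct) (auto intro: poly_family_const poly_family_add)

lemma poly_family_prod: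
  "(\<And>i. i \<in> I \<Longrightarrow> poly_family N (f i)) \<Longrightarrow> poly_family N (\<lambda>xs. \<Prod>i\<in>I. f i xs)"
  by (induction I rule: infinite_finite_induct) (auto intro: poly_family_const poly_family_mult)

lemma poly_family_power: "poly_family N \<phi> \<Longrightarrow> poly_family N (\<lambda>xs. \<phi> xs ^ k)"
  by (induction k) (auto intro: poly_family_const poly_family_mult)

lemma poly_family_coeff: "poly_family N \<phi> \<Longrightarrow> (\<lambda>xs. coeff (\<phi> xs) i) \<in> poly_fun N"
  by (simp add: poly_family_def)

lemmas poly_family_intros = poly_family_const poly_family_of_poly_fun poly_family_add
  poly_family_diff poly_family_mult poly_family_sum poly_family_prod poly_family_power

text \<open>Uniformly bounded degree: the bound counts coefficients, so \<open>E = 0\<close> means the zero family.\<close>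

definition bounded_family :: "nat \<Rightarrow> nat \<Rightarrow> (complex list \<Rightarrow> complex poly) \<Rightarrow> bool" where
  "bounded_family N E \<phi> \<longleftrightarrow> poly_family N \<phi> \<and> (\<forall>xs i. E \<le> i \<longrightarrow> coeff (\<phi> xs) i = 0)"

lemma bounded_family_add:
  assumes "bounded_family N E \<phi>" "bounded_family N E' \<psi>"
  shows "bounded_family N (max E E') (\<lambda>xs. \<phi> xs + \<psi> xs)"
  using assms by (auto simp: bounded_family_def intro: poly_family_add)

lemma bounded_family_mult:
  assumes "bounded_family N E \<phi>" "bounded_family N E' \<psi>"
  shows "bounded_family N (E + E') (\<lambda>xs. \<phi> xs * \<psi> xs)"
proof -
  have "coeff (\<phi> xs * \<psi> xs) i = 0" if "E + E' \<le> i" for xs i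
    unfolding coeff_mult
  proof (rule sum.neutral, rule ballI)
    fix j assume "j \<in> {..i}"
    then have "E \<le> j \<or> E' \<le> i - j" using that by auto
    then show "coeff (\<phi> xs) j * coeff (\<psi> xs) (i - j) = 0"
      using assms by (auto simp: bounded_family_def)
  qed
  then show ?thesis using assms by (auto simp: bounded_family_def intro: poly_family_mult)
qed

lemma bounded_family_power:
  "bounded_family N E \<phi> \<Longrightarrow> \<exists>E'. bounded_family N E' (\<lambda>xs. \<phi> xs ^ k)"
proof (induction k)
  case 0
  have "bounded_family N 1 (\<lambda>xs. 1)" by (auto simp: bounded_family_def poly_family_const)
  then show ?case by auto
next
  case (Suc k)
  then show ?case using bounded_family_mult by (auto, blast)
qed

text \<open>The bound \<open>E\<close> is the same for all \<open>xs\<close>: elimination needs a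
  formal degree that is unaffected when leading coefficients vanish at special parameters.\<close>

lemma poly_fun_last_variable:
  assumes "p \<in> poly_fun (Suc N)"
  shows "\<exists>E \<phi>. bounded_family N E \<phi> \<and> (\<forall>xs t. length xs = N \<longrightarrow> p (xs @ [t]) = poly (\<phi> xs) t)"
  using assms
proof induction
  case (pf_const c)
  have "bounded_family N 1 (\<lambda>xs. [:c:])"
    by (auto simp: bounded_family_def poly_family_const coeff_pCons split: nat.split)
  then show ?case by (intro exI[of _ 1] exI[of _ "\<lambda>xs. [:c:]"]) auto
next
  case (pf_var i)
  show ?case
  proof (cases "i = N")
    case True
    have "bounded_family N 2 (\<lambda>xs. [:0, 1:])"
      by (auto simp: bounded_family_def poly_family_const coeff_pCons split: nat.split)
    with True show ?thesis by (intro exI[of _ 2] exI[of _ "\<lambda>xs. [:0, 1:]"]) auto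
  next
    case False
    with pf_var have "i < N" by simp
    then have "bounded_family N 1 (\<lambda>xs. [:xs ! i:])"
      unfolding bounded_family_def
      by (auto intro!: poly_family_of_poly_fun poly_fun_intros simp: coeff_pCons split: nat.split)
    with \<open>i < N\<close> show ?thesis
      by (intro exI[of _ 1] exI[of _ "\<lambda>xs. [:xs ! i:]"]) (auto simp: nth_append)
  qed
next
  case (pf_add p q)
  then obtain E \<phi> E' \<psi> where
    "bounded_family N E \<phi>" "\<forall>xs t. length xs = N \<longrightarrow> p (xs @ [t]) = poly (\<phi> xs) t"
    "bounded_family N E' \<psi>" "\<forall>xs t. length xs = N \<longrightarrow> q (xs @ [t]) = poly (\<psi> xs) t" by blast
  then show ?case
    by (intro exI[of _ "max E E'"] exI[of _ "\<lambda>xs. \<phi> xs + \<psi> xs"]) (auto intro: bounded_family_add)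
next
  case (pf_mult p q)
  then obtain E \<phi> E' \<psi> where
    "bounded_family N E \<phi>" "\<forall>xs t. length xs = N \<longrightarrow> p (xs @ [t]) = poly (\<phi> xs) t"
    "bounded_family N E' \<psi>" "\<forall>xs t. length xs = N \<longrightarrow> q (xs @ [t]) = poly (\<psi> xs) t" by blast
  then show ?case
    by (intro exI[of _ "E + E'"] exI[of _ "\<lambda>xs. \<phi> xs * \<psi> xs"]) (auto intro: bounded_family_mult)
qed

text \<open>\<open>D\<close> is chosen before the line. It stands in for the total degree, which an
  element of \<open>poly_fun\<close>, being a mere function, does not carry.\<close>

lemma poly_fun_on_line:
  assumes "p \<in> poly_fun N"
  shows "\<exists>D. \<forall>a b. length a = N \<longrightarrow> length b = N \<longrightarrow>
    (\<exists>Q. degree Q \<le> D \<and> (\<forall>t. p (map2 (\<lambda>x y. x + t * y) a b) = poly Q t))"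
  using assms
proof induction
  case (pf_const c)
  show ?case by (rule exI[of _ 0]) (auto intro!: exI[of _ "[:c:]"])
next
  case (pf_var i)
  have "\<exists>Q. degree Q \<le> 1 \<and> (\<forall>t. map2 (\<lambda>x y. x + t * y) a b ! i = poly Q t)"
    if "length a = N" "length b = N" for a b :: "complex list"
    using that pf_var by (intro exI[of _ "[:a ! i, b ! i:]"]) auto
  then show ?case by (intro exI[of _ 1]) auto
next
  case (pf_add p q)
  then obtain D1 D2 where
    D1: "\<And>a b. length a = N \<Longrightarrow> length b = N \<Longrightarrow>
      \<exists>Q. degree Q \<le> D1 \<and> (\<forall>t. p (map2 (\<lambda>x y. x + t * y) a b) = poly Q t)" and
    D2: "\<And>a b. length a = N \<Longrightarrow> length b = N \<Longrightarrow>
      \<exists>Q. degree Q \<le> D2 \<and> (\<forall>t. q (map2 (\<lambda>x y. x + t * y) a b) = poly Q t)" by blast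
  show ?case
  proof (intro exI[of _ "max D1 D2"] allI impI)
    fix a b :: "complex list" assume l: "length a = N" "length b = N"
    from D1[OF l] D2[OF l] obtain Q R where
      "degree Q \<le> D1" "\<And>t. p (map2 (\<lambda>x y. x + t * y) a b) = poly Q t"
      "degree R \<le> D2" "\<And>t. q (map2 (\<lambda>x y. x + t * y) a b) = poly R t" by blast
    then show "\<exists>Q. degree Q \<le> max D1 D2 \<and>
        (\<forall>t. p (map2 (\<lambda>x y. x + t * y) a b) + q (map2 (\<lambda>x y. x + t * y) a b) = poly Q t)"
      by (intro exI[of _ "Q + R"]) (auto intro: degree_add_le)
  qed
next
  case (pf_mult p q)
  then obtain D1 D2 where
    D1: "\<And>a b. length a = N \<Longrightarrow> length b = N \<Longrightarrow>
      \<exists>Q. degree Q \<le> D1 \<and> (\<forall>t. p (map2 (\<lambda>x y. x + t * y) a b) = poly Q t)" and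
    D2: "\<And>a b. length a = N \<Longrightarrow> length b = N \<Longrightarrow>
      \<exists>Q. degree Q \<le> D2 \<and> (\<forall>t. q (map2 (\<lambda>x y. x + t * y) a b) = poly Q t)" by blast
  show ?case
  proof (intro exI[of _ "D1 + D2"] allI impI)
    fix a b :: "complex list" assume l: "length a = N" "length b = N"
    from D1[OF l] D2[OF l] obtain Q R where
      QR: "degree Q \<le> D1" "\<And>t. p (map2 (\<lambda>x y. x + t * y) a b) = poly Q t"
      "degree R \<le> D2" "\<And>t. q (map2 (\<lambda>x y. x + t * y) a b) = poly R t" by blast
    then have "degree (Q * R) \<le> D1 + D2"
      using degree_mult_le[of Q R] by linarith
    with QR show "\<exists>Q. degree Q \<le> D1 + D2 \<and>
        (\<forall>t. p (map2 (\<lambda>x y. x + t * y) a b) * q (map2 (\<lambda>x y. x + t * y) a b) = poly Q t)"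
      by (intro exI[of _ "Q * R"]) auto
  qed
qed

lemma poly_fun_on_curve:
  assumes "p \<in> poly_fun N"
  shows "\<exists>Q. \<forall>t. p (map (\<lambda>j. poly (Y j) t) [0..<N]) = poly Q t"
  using assms
proof induction
  case (pf_const c)
  show ?case by (auto intro!: exI[of _ "[:c:]"])
next
  case (pf_var i)
  then show ?case by (auto intro!: exI[of _ "Y i"])
next
  case (pf_add p q)
  then obtain Q R where "\<forall>t. p (map (\<lambda>j. poly (Y j) t) [0..<N]) = poly Q t"
    "\<forall>t. q (map (\<lambda>j. poly (Y j) t) [0..<N]) = poly R t" by blast
  then show ?case by (intro exI[of _ "Q + R"]) auto
next
  case (pf_mult p q)
  then obtain Q R where "\<forall>t. p (map (\<lambda>j. poly (Y j) t) [0..<N]) = poly Q t"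
    "\<forall>t. q (map (\<lambda>j. poly (Y j) t) [0..<N]) = poly R t" by blast
  then show ?case by (intro exI[of _ "Q * R"]) auto
qed

lemma poly_fun_compose:
  assumes "p \<in> poly_fun d" "\<And>j. j < d \<Longrightarrow> f j \<in> poly_fun N"
  shows "(\<lambda>xs. p (map (\<lambda>j. f j xs) [0..<d])) \<in> poly_fun N"
  using assms(1) by induction (auto intro!: poly_fun_intros assms(2))

section \<open>Nonzero polynomials and principal open sets\<close>

definition nonvanishing :: "nat \<Rightarrow> (complex list \<Rightarrow> complex) \<Rightarrow> bool" where
  "nonvanishing N p \<longleftrightarrow> p \<in> poly_fun N \<and> (\<exists>xs \<in> affine_space N. p xs \<noteq> 0)"

text \<open>Irreducibility of affine space. On the line through a point where \<open>p\<close> is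
  nonzero and one where \<open>q\<close> is, both become nonzero univariate polynomials, and those
  have a nonzero product.\<close>

lemma nonvanishing_mult:
  assumes "nonvanishing N p" "nonvanishing N q"
  shows "nonvanishing N (\<lambda>xs. p xs * q xs)"
proof -
  obtain a b where a: "length a = N" "p a \<noteq> 0" and b: "length b = N" "q b \<noteq> 0"
    and pq: "p \<in> poly_fun N" "q \<in> poly_fun N"
    using assms by (auto simp: nonvanishing_def affine_space_def)
  define c where "c = map2 (\<lambda>x y. y - x) a b"
  let ?l = "\<lambda>t. map2 (\<lambda>x y. x + t * y) a c"
  have c: "length c = N" using a b by (simp add: c_def)
  obtain P where P: "\<And>t. p (?l t) = poly P t" using poly_fun_on_line[OF pq(1)] a(1) c by blast
  obtain Q where Q: "\<And>t. q (?l t) = poly Q t" using poly_fun_on_line[OF pq(2)] a(1) c by blast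
  have "?l 0 = a" using a c by (auto intro: nth_equalityI)
  then have "P \<noteq> 0" using a P[of 0] by auto
  have "?l 1 = b" using a b by (auto intro: nth_equalityI simp: c_def)
  then have "Q \<noteq> 0" using b Q[of 1] by auto
  with \<open>P \<noteq> 0\<close> have "P * Q \<noteq> 0" by simp
  then obtain t where "poly (P * Q) t \<noteq> 0" using poly_all_0_iff_0 by blast
  then have "p (?l t) * q (?l t) \<noteq> 0" using P Q by simp
  moreover have "?l t \<in> affine_space N" using a c by (simp add: affine_space_def)
  ultimately show ?thesis unfolding nonvanishing_def using pq by (auto intro: pf_mult)
qed

lemma nonvanishing_one: "nonvanishing N (\<lambda>xs. 1)"
  by (auto simp: nonvanishing_def affine_space_def intro!: pf_const exI[of _ "replicate N 0"])

lemma zariski_open_nonvanishing: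
  assumes "q \<in> poly_fun N"
  shows "zariski_open N {xs \<in> affine_space N. q xs \<noteq> 0}"
  unfolding zariski_open_def zariski_closed_def
  by (rule exI[of _ "{xs \<in> affine_space N. q xs = 0}"]) (use assms in \<open>auto intro!: exI[of _ "{q}"]\<close>)

lemma zariski_open_contains_nonvanishing:
  assumes "zariski_open N V" "V \<noteq> {}"
  shows "\<exists>q. nonvanishing N q \<and> {xs \<in> affine_space N. q xs \<noteq> 0} \<subseteq> V"
proof -
  obtain P where P: "P \<subseteq> poly_fun N" "V = affine_space N - {xs \<in> affine_space N. \<forall>p\<in>P. p xs = 0}"
    using assms(1) by (auto simp: zariski_open_def zariski_closed_def)
  from assms(2) P obtain x q where "x \<in> affine_space N" "q \<in> P" "q x \<noteq> 0" by auto
  with P show ?thesis by (intro exI[of _ q]) (auto simp: nonvanishing_def)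
qed

text \<open>Positive Boolean combinations of equations and inequations suffice for quantifier elimination.\<close>

inductive constructible :: "nat \<Rightarrow> complex list set \<Rightarrow> bool" for N where
  constructible_eq: "p \<in> poly_fun N \<Longrightarrow> constructible N {xs \<in> affine_space N. p xs = 0}"
| constructible_neq: "p \<in> poly_fun N \<Longrightarrow> constructible N {xs \<in> affine_space N. p xs \<noteq> 0}"
| constructible_Un: "constructible N S \<Longrightarrow> constructible N T \<Longrightarrow> constructible N (S \<union> T)"
| constructible_Int: "constructible N S \<Longrightarrow> constructible N T \<Longrightarrow> constructible N (S \<inter> T)"

lemma constructible_empty: "constructible N {}"
  using constructible_eq[OF pf_const[of 1]] by simp

lemma constructible_UNIV: "constructible N (affine_space N)"
  using constructible_eq[OF pf_const[of 0]] by simp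

lemma constructible_UN:
  "finite I \<Longrightarrow> (\<And>i. i \<in> I \<Longrightarrow> constructible N (S i)) \<Longrightarrow> constructible N (\<Union>i\<in>I. S i)"
  by (induction I rule: finite_induct) (auto intro: constructible_empty constructible_Un)

text \<open>The alternative passes through unions and intersections because two obstructions, or two
  principal open sets, are combined by multiplying their polynomials, and
  \<open>nonvanishing_mult\<close> keeps the product nonzero.\<close>

lemma constructible_dichotomy:
  assumes "constructible N S"
  shows "(\<exists>p. nonvanishing N p \<and> (\<forall>xs\<in>S. p xs = 0)) \<or>
    (\<exists>q. nonvanishing N q \<and> {xs \<in> affine_space N. q xs \<noteq> 0} \<subseteq> S)"
  using assms
proof induction
  case (constructible_eq p)
  show ?case
  proof (cases "nonvanishing N p")
    case True then show ?thesis by auto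
  next
    case False
    with constructible_eq have "\<forall>xs\<in>affine_space N. p xs = 0" by (auto simp: nonvanishing_def)
    then show ?thesis using nonvanishing_one by (intro disjI2 exI[of _ "\<lambda>xs. 1"]) auto
  qed
next
  case (constructible_neq p)
  show ?case
  proof (cases "nonvanishing N p")
    case True then show ?thesis by auto
  next
    case False
    with constructible_neq have "\<forall>xs\<in>affine_space N. p xs = 0" by (auto simp: nonvanishing_def)
    then show ?thesis using nonvanishing_one by (intro disjI1 exI[of _ "\<lambda>xs. 1"]) auto
  qed
next
  case (constructible_Un S T)
  show ?case
  proof (cases "(\<exists>q. nonvanishing N q \<and> {xs \<in> affine_space N. q xs \<noteq> 0} \<subseteq> S) \<or>
      (\<exists>q. nonvanishing N q \<and> {xs \<in> affine_space N. q xs \<noteq> 0} \<subseteq> T)")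
    case True then show ?thesis by blast
  next
    case False
    then obtain p q where "nonvanishing N p" "\<forall>xs\<in>S. p xs = 0" "nonvanishing N q" "\<forall>xs\<in>T. q xs = 0"
      using constructible_Un.IH by blast
    then show ?thesis using nonvanishing_mult[of N p q]
      by (intro disjI1 exI[of _ "\<lambda>xs. p xs * q xs"]) auto
  qed
next
  case (constructible_Int S T)
  show ?case
  proof (cases "(\<exists>p. nonvanishing N p \<and> (\<forall>xs\<in>S. p xs = 0)) \<or>
      (\<exists>p. nonvanishing N p \<and> (\<forall>xs\<in>T. p xs = 0))")
    case True then show ?thesis by blast
  next
    case False
    then obtain p q where "nonvanishing N p" "{xs \<in> affine_space N. p xs \<noteq> 0} \<subseteq> S"
      "nonvanishing N q" "{xs \<in> affine_space N. q xs \<noteq> 0} \<subseteq> T"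
      using constructible_Int.IH by blast
    then show ?thesis using nonvanishing_mult[of N p q]
      by (intro disjI2 exI[of _ "\<lambda>xs. p xs * q xs"]) auto
  qed
qed

section \<open>Quantifier elimination\<close>

lemma family_neq_0_constructible:
  assumes "bounded_family N E \<phi>"
  shows "constructible N {xs \<in> affine_space N. \<phi> xs \<noteq> 0}"
proof -
  have "{xs \<in> affine_space N. \<phi> xs \<noteq> 0} = (\<Union>i<E. {xs \<in> affine_space N. coeff (\<phi> xs) i \<noteq> 0})"
    using assms unfolding bounded_family_def poly_eq_iff
    by (auto simp: Bex_def) (meson not_le_imp_less)
  then show ?thesis using assms
    by (auto intro!: constructible_UN constructible_neq simp: bounded_family_def poly_family_def)
qed

text \<open>Cross-multiplication by the formal leading coefficients cancels the terms of degree
  \<open>E\<close> without dividing, so the result is again polynomial in the parameters.\<close>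

lemma pseudo_division_step:
  assumes \<phi>: "bounded_family N (Suc D) \<phi>" and g: "bounded_family N (Suc E) g" and "D \<le> E"
  shows "bounded_family N E (\<lambda>xs. Polynomial.smult (coeff (\<phi> xs) D) (g xs) -
      monom (coeff (g xs) E) (E - D) * \<phi> xs)"
proof -
  have eq: "Polynomial.smult (coeff (\<phi> xs) D) (g xs) - monom (coeff (g xs) E) (E - D) * \<phi> xs =
      [:coeff (\<phi> xs) D:] * g xs - [:coeff (g xs) E:] * monom 1 (E - D) * \<phi> xs" for xs
    by (simp add: smult_monom)
  have "coeff (Polynomial.smult (coeff (\<phi> xs) D) (g xs) - monom (coeff (g xs) E) (E - D) * \<phi> xs) i = 0"
    if "E \<le> i" for xs i
  proof (cases "i = E")
    case True
    then show ?thesis using \<open>D \<le> E\<close> by (simp add: coeff_monom_mult)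
  next
    case False
    with that have "Suc E \<le> i" "Suc D \<le> i - (E - D)" using \<open>D \<le> E\<close> by auto
    then show ?thesis using \<phi> g by (simp add: bounded_family_def coeff_monom_mult)
  qed
  moreover have "poly_family N (\<lambda>xs. [:coeff (\<phi> xs) D:] * g xs -
      [:coeff (g xs) E:] * monom 1 (E - D) * \<phi> xs)"
    using \<phi> g by (intro poly_family_intros poly_family_coeff) (auto simp: bounded_family_def)
  ultimately show ?thesis unfolding bounded_family_def eq by auto
qed

text \<open>Where the coefficient at \<open>D\<close> is nonzero, a pseudo-division step multiplies
  \<open>g\<close> by a unit and subtracts a multiple of \<open>\<phi>\<close>, which leaves
  divisibility by \<open>\<phi>\<close> unchanged. Once the bound of \<open>g\<close> is at most
  \<open>D\<close>, degrees allow divisibility only for zero.\<close>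

lemma pseudo_remainder:
  assumes \<phi>: "bounded_family N (Suc D) \<phi>"
  shows "bounded_family N E g \<Longrightarrow> \<exists>E' r. bounded_family N E' r \<and>
    (\<forall>xs. coeff (\<phi> xs) D \<noteq> 0 \<longrightarrow> (\<phi> xs dvd g xs \<longleftrightarrow> r xs = 0))"
proof (induction E arbitrary: g)
  case 0
  then have "g xs = 0" for xs by (auto simp: bounded_family_def poly_eq_iff)
  with 0 show ?case by (intro exI[of _ 0] exI[of _ g]) auto
next
  case (Suc E)
  show ?case
  proof (cases "D \<le> E")
    case False
    have "\<phi> xs dvd g xs \<longleftrightarrow> g xs = 0" if "coeff (\<phi> xs) D \<noteq> 0" for xs
    proof
      assume dvd: "\<phi> xs dvd g xs"
      show "g xs = 0"
      proof (rule ccontr)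
        assume "g xs \<noteq> 0"
        have "degree (g xs) \<le> E" using Suc.prems
          by (intro degree_le) (auto simp: bounded_family_def)
        moreover have "D \<le> degree (\<phi> xs)" using that by (rule le_degree)
        ultimately show False using dvd_imp_degree_le[OF dvd \<open>g xs \<noteq> 0\<close>] False by simp
      qed
    qed auto
    then show ?thesis using Suc.prems by blast
  next
    case True
    define g' where "g' = (\<lambda>xs. Polynomial.smult (coeff (\<phi> xs) D) (g xs) -
      monom (coeff (g xs) E) (E - D) * \<phi> xs)"
    have "bounded_family N E g'" unfolding g'_def
      by (rule pseudo_division_step[OF \<phi> Suc.prems True])
    from Suc.IH[OF this] obtain E' r where r: "bounded_family N E' r"
      "\<And>xs. coeff (\<phi> xs) D \<noteq> 0 \<Longrightarrow> (\<phi> xs dvd g' xs \<longleftrightarrow> r xs = 0)" by blast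
    have "\<phi> xs dvd g xs \<longleftrightarrow> \<phi> xs dvd g' xs" if "coeff (\<phi> xs) D \<noteq> 0" for xs
    proof -
      have "\<phi> xs dvd g' xs \<longleftrightarrow> \<phi> xs dvd Polynomial.smult (coeff (\<phi> xs) D) (g xs)"
        unfolding g'_def by (simp add: dvd_diff_left_iff)
      then show ?thesis using that by (simp add: dvd_smult_iff)
    qed
    with r show ?thesis by blast
  qed
qed

lemma bounded_family_drop_leading:
  assumes "bounded_family N (Suc D) \<phi>"
  shows "bounded_family N D (\<lambda>xs. \<phi> xs - monom (coeff (\<phi> xs) D) D)"
proof -
  have eq: "\<phi> xs - monom (coeff (\<phi> xs) D) D = \<phi> xs - [:coeff (\<phi> xs) D:] * monom 1 D" for xs
    by (simp add: smult_monom)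
  have "poly_family N (\<lambda>xs. \<phi> xs - [:coeff (\<phi> xs) D:] * monom 1 D)"
    using assms by (intro poly_family_intros poly_family_coeff) (auto simp: bounded_family_def)
  then show ?thesis using assms by (auto simp: bounded_family_def eq not_less_eq_eq Suc_le_eq)
qed

text \<open>Each equation is paired with its bound on the number of coefficients; these bounds drive
  the termination of the elimination.\<close>

definition common_zero_projection ::
  "nat \<Rightarrow> (nat \<times> (complex list \<Rightarrow> complex poly)) list \<Rightarrow> (complex list \<Rightarrow> complex poly) \<Rightarrow> complex list set"
  where
  "common_zero_projection N \<Phi> \<psi> = {xs \<in> affine_space N. \<exists>t.
     (\<forall>(E, \<phi>) \<in> set \<Phi>. poly (\<phi> xs) t = 0) \<and> poly (\<psi> xs) t \<noteq> 0}"

text \<open>Stratification by the formal leading coefficient: where it vanishes, the truncated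
  polynomial takes the same values, and where it does not, the set \<open>T\<close> supplied by a
  division argument takes over.\<close>

lemma common_zero_projection_split:
  assumes \<phi>: "bounded_family N (Suc D) \<phi>"
    and low: "constructible N
      (common_zero_projection N ((D, \<lambda>xs. \<phi> xs - monom (coeff (\<phi> xs) D) D) # \<Phi>) \<psi>)"
    and T: "constructible N T"
    and high: "\<And>xs. xs \<in> affine_space N \<Longrightarrow> coeff (\<phi> xs) D \<noteq> 0 \<Longrightarrow>
      xs \<in> T \<longleftrightarrow> xs \<in> common_zero_projection N ((Suc D, \<phi>) # \<Phi>) \<psi>"
  shows "constructible N (common_zero_projection N ((Suc D, \<phi>) # \<Phi>) \<psi>)"
proof -
  let ?low = "common_zero_projection N ((D, \<lambda>xs. \<phi> xs - monom (coeff (\<phi> xs) D) D) # \<Phi>) \<psi>"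
  let ?S = "common_zero_projection N ((Suc D, \<phi>) # \<Phi>) \<psi>"
  let ?Z = "{xs \<in> affine_space N. coeff (\<phi> xs) D = 0}"
  let ?O = "{xs \<in> affine_space N. coeff (\<phi> xs) D \<noteq> 0}"
  have "xs \<in> ?S \<longleftrightarrow> xs \<in> (?Z \<inter> ?low) \<union> (?O \<inter> T)" for xs
  proof (cases "xs \<in> affine_space N")
    case True
    then show ?thesis using high[OF True]
      by (cases "coeff (\<phi> xs) D = 0") (auto simp: common_zero_projection_def)
  qed (auto simp: common_zero_projection_def)
  then have "?S = (?Z \<inter> ?low) \<union> (?O \<inter> T)" by blast
  then show ?thesis using \<phi> low T
    by (auto intro!: constructible_Un constructible_Int constructible_eq constructible_neq
        poly_family_coeff simp: bounded_family_def)
qed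

text \<open>Euclid's algorithm carried out uniformly in the parameters. Pseudo-division of one
  equation by another lowers the bounds until at most one equation remains. A single nonzero
  \<open>\<phi>\<close> has a root off the zeros of \<open>\<psi>\<close> exactly if it does not
  divide a high enough power of \<open>\<psi>\<close>; without equations the condition is that
  \<open>\<psi>\<close> is not the zero polynomial.\<close>

lemma constructible_common_zero_projection:
  assumes "\<forall>(E, \<phi>) \<in> set \<Phi>. bounded_family N E \<phi>" "bounded_family N E \<psi>"
  shows "constructible N (common_zero_projection N \<Phi> \<psi>)"
  using assms(1)
\<comment> \<open>\<open>Suc E\<close> instead of \<open>E\<close>, so that discarding an equation
  with bound 0 also lowers the measure.\<close>
proof (induction "\<Sum>(E, \<phi>)\<leftarrow>\<Phi>. Suc E" arbitrary: \<Phi> rule: less_induct)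
  case less
  note \<psi> = assms(2)
  consider "\<Phi> = []" | "\<exists>\<phi> \<Phi>'. \<Phi> = (0, \<phi>) # \<Phi>'" | "\<exists>D \<phi>. \<Phi> = [(Suc D, \<phi>)]"
    | "\<exists>D \<phi> E' \<phi>' \<Phi>'. \<Phi> = (Suc D, \<phi>) # (E', \<phi>') # \<Phi>'"
  proof (cases \<Phi>)
    case (Cons x \<Phi>')
    obtain E1 \<phi>1 where "x = (E1, \<phi>1)" by (cases x)
    with Cons that show ?thesis by (cases E1; cases \<Phi>') auto
  qed
  then show ?case
  proof cases
    case 1
    have "common_zero_projection N \<Phi> \<psi> = {xs \<in> affine_space N. \<psi> xs \<noteq> 0}"
      using 1 poly_all_0_iff_0 by (auto simp: common_zero_projection_def)
    then show ?thesis using family_neq_0_constructible[OF \<psi>] by simp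
  next
    case 2
    then obtain \<phi> \<Phi>' where \<Phi>: "\<Phi> = (0, \<phi>) # \<Phi>'" by blast
    have "\<phi> xs = 0" for xs using less.prems \<Phi> by (auto simp: bounded_family_def poly_eq_iff)
    then have "common_zero_projection N \<Phi> \<psi> = common_zero_projection N \<Phi>' \<psi>"
      by (auto simp: common_zero_projection_def \<Phi>)
    moreover have "constructible N (common_zero_projection N \<Phi>' \<psi>)"
      by (rule less.hyps) (use less.prems \<Phi> in auto)
    ultimately show ?thesis by simp
  next
    case 3
    then obtain D \<phi> where \<Phi>: "\<Phi> = [(Suc D, \<phi>)]" by blast
    have \<phi>: "bounded_family N (Suc D) \<phi>" using less.prems \<Phi> by auto
    \<comment> \<open>Where the coefficient at \<open>D\<close> is nonzero, \<open>\<phi> xs\<close>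
      has degree exactly \<open>D\<close>, so its roots have multiplicity at most \<open>D\<close>,
      and the exponent \<open>D\<close> is the one of the univariate Nullstellensatz.\<close>
    obtain E' where "bounded_family N E' (\<lambda>xs. \<psi> xs ^ D)" using bounded_family_power[OF \<psi>] by blast
    from pseudo_remainder[OF \<phi> this] obtain E'' r where r: "bounded_family N E'' r"
      "\<And>xs. coeff (\<phi> xs) D \<noteq> 0 \<Longrightarrow> (\<phi> xs dvd \<psi> xs ^ D \<longleftrightarrow> r xs = 0)" by blast
    show ?thesis unfolding \<Phi>
    proof (rule common_zero_projection_split[OF \<phi>])
      show "constructible N
         (common_zero_projection N [(D, \<lambda>xs. \<phi> xs - monom (coeff (\<phi> xs) D) D)] \<psi>)"
        by (rule less.hyps) (use \<Phi> bounded_family_drop_leading[OF \<phi>] in auto)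
      show "constructible N {xs \<in> affine_space N. r xs \<noteq> 0}"
        by (rule family_neq_0_constructible[OF r(1)])
    next
      fix xs assume xs: "xs \<in> affine_space N" "coeff (\<phi> xs) D \<noteq> 0"
      have "degree (\<phi> xs) = D"
        using \<phi> xs(2) by (intro antisym degree_le le_degree) (auto simp: bounded_family_def)
      moreover have "\<phi> xs \<noteq> 0" using xs by auto
      ultimately have "(\<forall>x. poly (\<phi> xs) x = 0 \<longrightarrow> poly (\<psi> xs) x = 0) \<longleftrightarrow> \<phi> xs dvd \<psi> xs ^ D"
        using nullstellensatz_univariate[of "\<phi> xs" "\<psi> xs"] by simp
      then show "xs \<in> {xs \<in> affine_space N. r xs \<noteq> 0} \<longleftrightarrow>
          xs \<in> common_zero_projection N [(Suc D, \<phi>)] \<psi>"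
        using r(2)[OF xs(2)] xs(1) by (auto simp: common_zero_projection_def)
    qed
  next
    case 4
    then obtain D0 \<phi>0 E0 \<phi>0' \<Phi>' where \<Phi>0: "\<Phi> = (Suc D0, \<phi>0) # (E0, \<phi>0') # \<Phi>'" by blast
    show ?thesis
    proof (cases E0)
      case 0
      have "\<phi>0' xs = 0" for xs using less.prems \<Phi>0 0 by (auto simp: bounded_family_def poly_eq_iff)
      then have "common_zero_projection N \<Phi> \<psi> = common_zero_projection N ((Suc D0, \<phi>0) # \<Phi>') \<psi>"
        by (auto simp: common_zero_projection_def \<Phi>0)
      moreover have "constructible N (common_zero_projection N ((Suc D0, \<phi>0) # \<Phi>') \<psi>)"
        by (rule less.hyps) (use less.prems \<Phi>0 in auto)
      ultimately show ?thesis by simp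
    next
      case (Suc D0')
      \<comment> \<open>The divisor must not have the larger formal degree; the projection depends
        only on the set of equations, so the two may be interchanged.\<close>
      have "\<exists>D \<phi> D' \<phi>'. D \<le> D' \<and> {(Suc D, \<phi>), (Suc D', \<phi>')} = {(Suc D0, \<phi>0), (Suc D0', \<phi>0')} \<and>
          D + D' = D0 + D0'"
      proof (cases "D0 \<le> D0'")
        case True then show ?thesis by blast
      next
        case False
        then have "D0' \<le> D0 \<and> {(Suc D0', \<phi>0'), (Suc D0, \<phi>0)} = {(Suc D0, \<phi>0), (Suc D0', \<phi>0')} \<and>
          D0' + D0 = D0 + D0'" by auto
        then show ?thesis by blast
      qed
      then obtain D \<phi> D' \<phi>' where le: "D \<le> D'"
        and set: "{(Suc D, \<phi>), (Suc D', \<phi>')} = {(Suc D0, \<phi>0), (Suc D0', \<phi>0')}"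
        and sum: "D + D' = D0 + D0'" by blast
      have "set \<Phi> = {(Suc D0, \<phi>0), (Suc D0', \<phi>0')} \<union> set \<Phi>'" by (auto simp: \<Phi>0 Suc)
      then have set\<Phi>: "set \<Phi> = {(Suc D, \<phi>), (Suc D', \<phi>')} \<union> set \<Phi>'" by (simp only: set)
      then have fam: "bounded_family N (Suc D) \<phi>" "bounded_family N (Suc D') \<phi>'"
        "\<forall>(E, \<phi>) \<in> set \<Phi>'. bounded_family N E \<phi>"
        using less.prems by auto
      have eq: "common_zero_projection N \<Phi> \<psi> =
          common_zero_projection N ((Suc D, \<phi>) # (Suc D', \<phi>') # \<Phi>') \<psi>"
        by (auto simp: common_zero_projection_def set\<Phi>)
      define g where "g = (\<lambda>xs. Polynomial.smult (coeff (\<phi> xs) D) (\<phi>' xs) -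
        monom (coeff (\<phi>' xs) D') (D' - D) * \<phi> xs)"
      have g: "bounded_family N D' g" unfolding g_def
        by (rule pseudo_division_step[OF fam(1,2) le])
      show ?thesis unfolding eq
      proof (rule common_zero_projection_split[OF fam(1)])
        show "constructible N (common_zero_projection N
            ((D, \<lambda>xs. \<phi> xs - monom (coeff (\<phi> xs) D) D) # (Suc D', \<phi>') # \<Phi>') \<psi>)"
          by (rule less.hyps)
            (use \<Phi>0 Suc sum bounded_family_drop_leading[OF fam(1)] fam in auto)
        show "constructible N (common_zero_projection N ((Suc D, \<phi>) # (D', g) # \<Phi>') \<psi>)"
          by (rule less.hyps) (use \<Phi>0 Suc sum fam g in auto)
      next
        fix xs assume "xs \<in> affine_space N" "coeff (\<phi> xs) D \<noteq> 0"
        then show "xs \<in> common_zero_projection N ((Suc D, \<phi>) # (D', g) # \<Phi>') \<psi> \<longleftrightarrow>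
          xs \<in> common_zero_projection N ((Suc D, \<phi>) # (Suc D', \<phi>') # \<Phi>') \<psi>"
          by (auto simp: common_zero_projection_def g_def)
      qed
    qed
  qed
qed

definition basic_set :: "nat \<Rightarrow> (complex list \<Rightarrow> complex) list \<Rightarrow> (complex list \<Rightarrow> complex) \<Rightarrow> complex list set"
  where "basic_set N P q = {xs \<in> affine_space N. (\<forall>p \<in> set P. p xs = 0) \<and> q xs \<noteq> 0}"

text \<open>Disjunctive normal form. Inequations are merged by multiplication, which is why
  \<open>basic_set\<close> has a list \<open>P\<close> of equations but a single
  \<open>q\<close>.\<close>

lemma constructible_normal_form:
  assumes "constructible N S"
  shows "\<exists>B. (\<forall>(P, q) \<in> set B. set P \<subseteq> poly_fun N \<and> q \<in> poly_fun N) \<and>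
    S = (\<Union>(P, q) \<in> set B. basic_set N P q)"
  using assms
proof induction
  case (constructible_eq p)
  then show ?case
    by (intro exI[of _ "[([p], \<lambda>xs. 1)]"]) (auto simp: basic_set_def intro: pf_const)
next
  case (constructible_neq p)
  then show ?case
    by (intro exI[of _ "[([], p)]"]) (auto simp: basic_set_def)
next
  case (constructible_Un S T)
  then obtain B1 B2 where "\<forall>(P, q) \<in> set B1. set P \<subseteq> poly_fun N \<and> q \<in> poly_fun N"
    "S = (\<Union>(P, q) \<in> set B1. basic_set N P q)"
    "\<forall>(P, q) \<in> set B2. set P \<subseteq> poly_fun N \<and> q \<in> poly_fun N"
    "T = (\<Union>(P, q) \<in> set B2. basic_set N P q)" by blast
  then show ?case by (intro exI[of _ "B1 @ B2"]) auto
next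
  case (constructible_Int S T)
  then obtain B1 B2 where B: "\<forall>(P, q) \<in> set B1. set P \<subseteq> poly_fun N \<and> q \<in> poly_fun N"
    "S = (\<Union>(P, q) \<in> set B1. basic_set N P q)"
    "\<forall>(P, q) \<in> set B2. set P \<subseteq> poly_fun N \<and> q \<in> poly_fun N"
    "T = (\<Union>(P, q) \<in> set B2. basic_set N P q)" by blast
  let ?B = "map (\<lambda>((P, q), (P', q')). (P @ P', \<lambda>xs. q xs * q' xs)) (List.product B1 B2)"
  have Int: "basic_set N P q \<inter> basic_set N P' q' = basic_set N (P @ P') (\<lambda>xs. q xs * q' xs)" for P q P' q'
    by (auto simp: basic_set_def)
  have "(\<Union>(P, q) \<in> set ?B. basic_set N P q) =
      (\<Union>x \<in> set B1. \<Union>y \<in> set B2. basic_set N (fst x) (snd x) \<inter> basic_set N (fst y) (snd y))"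
    unfolding Int by (force simp: case_prod_unfold)
  also have "\<dots> = S \<inter> T" unfolding B(2,4) by (auto simp: case_prod_unfold)
  finally have "S \<inter> T = (\<Union>(P, q) \<in> set ?B. basic_set N P q)" ..
  moreover have "\<forall>(P, q) \<in> set ?B. set P \<subseteq> poly_fun N \<and> q \<in> poly_fun N"
    using B(1,3) by (fastforce intro!: pf_mult)
  ultimately show ?case by blast
qed

text \<open>Chevalley's theorem for one coordinate: projection commutes with unions, so the normal
  form reduces it to a single basic set, whose conditions are then read as univariate in the last
  coordinate.\<close>

lemma constructible_projection:
  assumes "constructible (Suc N) S"
  shows "constructible N {xs \<in> affine_space N. \<exists>t. xs @ [t] \<in> S}"
proof -
  obtain B where B: "\<And>P q. (P, q) \<in> set B \<Longrightarrow> set P \<subseteq> poly_fun (Suc N) \<and> q \<in> poly_fun (Suc N)"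
    "S = (\<Union>(P, q) \<in> set B. basic_set (Suc N) P q)" using constructible_normal_form[OF assms] by blast
  have "constructible N {xs \<in> affine_space N. \<exists>t. xs @ [t] \<in> basic_set (Suc N) P q}"
    if Pq: "(P, q) \<in> set B" for P q
  proof -
    define r where "r p = (SOME (E, \<phi>). bounded_family N E \<phi> \<and>
      (\<forall>xs t. length xs = N \<longrightarrow> p (xs @ [t]) = poly (\<phi> xs) t))" for p
    have r: "bounded_family N (fst (r p)) (snd (r p))"
      "length xs = N \<Longrightarrow> p (xs @ [t]) = poly (snd (r p) xs) t"
      if "p \<in> poly_fun (Suc N)" for p xs t
    proof -
      have "\<exists>x. case x of (E, \<phi>) \<Rightarrow> bounded_family N E \<phi> \<and>
        (\<forall>xs t. length xs = N \<longrightarrow> p (xs @ [t]) = poly (\<phi> xs) t)"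
        using poly_fun_last_variable[OF that] by auto
      from someI_ex[OF this] show "bounded_family N (fst (r p)) (snd (r p))"
        "length xs = N \<Longrightarrow> p (xs @ [t]) = poly (snd (r p) xs) t"
        unfolding r_def by (auto simp: case_prod_unfold)
    qed
    have P: "\<And>p. p \<in> set P \<Longrightarrow> p \<in> poly_fun (Suc N)" and q: "q \<in> poly_fun (Suc N)"
      using B(1)[OF Pq] by auto
    have "{xs \<in> affine_space N. \<exists>t. xs @ [t] \<in> basic_set (Suc N) P q} =
        common_zero_projection N (map r P) (snd (r q))"
      unfolding basic_set_def common_zero_projection_def affine_space_def case_prod_unfold
      using r(2)[OF q] r(2)[OF P] by (intro Collect_cong conj_cong refl ex_cong1) auto
    moreover have "constructible N (common_zero_projection N (map r P) (snd (r q)))"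
      using r(1)[OF P] by (intro constructible_common_zero_projection[OF _ r(1)[OF q]])
        (auto simp: case_prod_unfold)
    ultimately show ?thesis by simp
  qed
  then have "constructible N
      (\<Union>x \<in> set B. {xs \<in> affine_space N. \<exists>t. xs @ [t] \<in> basic_set (Suc N) (fst x) (snd x)})"
    by (intro constructible_UN) auto
  also have "\<dots> = {xs \<in> affine_space N. \<exists>t. xs @ [t] \<in> S}"
    unfolding B(2) by (auto simp: case_prod_unfold)
  finally show ?thesis .
qed

lemma constructible_subset: "constructible N S \<Longrightarrow> S \<subseteq> affine_space N"
  by (induction rule: constructible.induct) auto

lemma constructible_projection_many:
  assumes "constructible (d + N) S"
  shows "constructible d {ys \<in> affine_space d. \<exists>xs \<in> affine_space N. ys @ xs \<in> S}"
  using assms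
proof (induction N arbitrary: S)
  case 0
  have "S \<subseteq> affine_space d" using 0 constructible_subset by simp
  then have "{ys \<in> affine_space d. \<exists>xs \<in> affine_space 0. ys @ xs \<in> S} = S"
    by (auto simp: affine_space_def)
  with 0 show ?case by simp
next
  case (Suc N)
  let ?T = "{xs \<in> affine_space (d + N). \<exists>t. xs @ [t] \<in> S}"
  have "constructible (d + N) ?T" using constructible_projection Suc.prems by simp
  from Suc.IH[OF this]
  have "constructible d {ys \<in> affine_space d. \<exists>xs \<in> affine_space N. ys @ xs \<in> ?T}" .
  also have "{ys \<in> affine_space d. \<exists>xs \<in> affine_space N. ys @ xs \<in> ?T} =
      {ys \<in> affine_space d. \<exists>xs \<in> affine_space (Suc N). ys @ xs \<in> S}" (is "?L = ?R")
  proof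
    show "?L \<subseteq> ?R"
    proof
      fix ys assume "ys \<in> ?L"
      then obtain xs t where "ys \<in> affine_space d" "xs \<in> affine_space N" "(ys @ xs) @ [t] \<in> S" by auto
      then show "ys \<in> ?R" by (auto simp: affine_space_def intro!: exI[of _ "xs @ [t]"])
    qed
    show "?R \<subseteq> ?L"
    proof
      fix ys assume "ys \<in> ?R"
      then obtain zs where "ys \<in> affine_space d" and zs: "length zs = Suc N" "ys @ zs \<in> S"
        by (auto simp: affine_space_def)
      moreover obtain xs t where "zs = xs @ [t]" using zs by (cases zs rule: rev_cases) auto
      ultimately show "ys \<in> ?L" by (auto simp: affine_space_def intro!: exI[of _ xs])
    qed
  qed
  finally show ?case .
qed

lemma constructible_common_zeros:
  "finite I \<Longrightarrow> (\<And>i. i \<in> I \<Longrightarrow> p i \<in> poly_fun N) \<Longrightarrow>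
    constructible N {xs \<in> affine_space N. \<forall>i\<in>I. p i xs = 0}"
proof (induction I rule: finite_induct)
  case empty
  then show ?case using constructible_UNIV by simp
next
  case (insert i I)
  have "{xs \<in> affine_space N. \<forall>i\<in>insert i I. p i xs = 0} =
    {xs \<in> affine_space N. p i xs = 0} \<inter> {xs \<in> affine_space N. \<forall>i\<in>I. p i xs = 0}" by auto
  with insert show ?case by (auto intro!: constructible_Int constructible_eq)
qed

text \<open>The image is the projection of the graph. The target coordinates come first, since
  projection removes coordinates from the end of the list.\<close>

lemma constructible_image:
  assumes f: "\<And>j. j < d \<Longrightarrow> f j \<in> poly_fun N"
  shows "constructible d ((\<lambda>xs. map (\<lambda>j. f j xs) [0..<d]) ` affine_space N)"
proof -
  let ?x = "\<lambda>zs :: complex list. map (\<lambda>i. zs ! (d + i)) [0..<N]"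
  define S where "S = {zs \<in> affine_space (d + N). \<forall>j\<in>{..<d}. zs ! j - f j (?x zs) = 0}"
  have "constructible (d + N) S" unfolding S_def
    by (intro constructible_common_zeros poly_fun_diff pf_var poly_fun_compose[OF f]) auto
  from constructible_projection_many[OF this]
  have "constructible d {ys \<in> affine_space d. \<exists>xs \<in> affine_space N. ys @ xs \<in> S}" .
  also have "{ys \<in> affine_space d. \<exists>xs \<in> affine_space N. ys @ xs \<in> S} =
      (\<lambda>xs. map (\<lambda>j. f j xs) [0..<d]) ` affine_space N" (is "?L = ?R")
  proof -
    have x: "?x (ys @ xs) = xs" if "length ys = d" "length xs = N" for ys xs
      using that by (auto intro!: nth_equalityI simp: nth_append)
    have "ys @ xs \<in> S \<longleftrightarrow> ys = map (\<lambda>j. f j xs) [0..<d]"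
      if "length ys = d" "length xs = N" for ys xs
      unfolding S_def mem_Collect_eq x[OF that] using that
      by (auto simp: affine_space_def nth_append list_eq_iff_nth_eq)
    then have S: "ys \<in> ?L \<longleftrightarrow> length ys = d \<and> (\<exists>xs \<in> affine_space N. ys = map (\<lambda>j. f j xs) [0..<d])" for ys
      by (auto simp: affine_space_def)
    show ?thesis by (rule Set.set_eqI) (unfold S image_iff, auto)
  qed
  finally show ?thesis .
qed

section \<open>Images of polynomial maps\<close>

lemma poly_altdef_bound:
  fixes p :: "'a :: comm_semiring_1 poly"
  assumes "\<And>i. E \<le> i \<Longrightarrow> coeff p i = 0"
  shows "poly p t = (\<Sum>i<E. coeff p i * t ^ i)"
proof -
  have "p = (\<Sum>i<E. monom (coeff p i) i)"
    using assms by (intro poly_eqI) (auto simp: coeff_sum not_less)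
  then have "poly p t = poly (\<Sum>i<E. monom (coeff p i) i) t" by (rule arg_cong)
  then show ?thesis by (simp add: poly_sum poly_monom)
qed

text \<open>Taylor expansion at \<open>b\<close>: the coefficient of index \<open>k\<close> in
  \<open>\<phi> ys\<close> is the homogeneous part of degree \<open>k\<close> of \<open>p\<close> at
  \<open>b\<close>, evaluated at \<open>ys\<close>. The scale \<open>t\<close> is made the last
  variable so that it can be split off.\<close>

lemma poly_fun_expand_at:
  assumes p: "p \<in> poly_fun d"
  shows "\<exists>E \<phi>. bounded_family d E \<phi> \<and> (\<forall>ys t. length ys = d \<longrightarrow>
    p (map (\<lambda>j. b j + t * ys ! j) [0..<d]) = poly (\<phi> ys) t)"
proof -
  let ?p = "\<lambda>zs. p (map (\<lambda>j. b j + zs ! d * zs ! j) [0..<d])"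
  have "?p \<in> poly_fun (Suc d)"
    by (rule poly_fun_compose[OF p]) (auto intro!: poly_fun_intros)
  from poly_fun_last_variable[OF this] obtain E \<phi> where \<phi>: "bounded_family d E \<phi>"
    "\<And>xs t. length xs = d \<Longrightarrow> ?p (xs @ [t]) = poly (\<phi> xs) t" by blast
  have "?p (ys @ [t]) = p (map (\<lambda>j. b j + t * ys ! j) [0..<d])" if "length ys = d" for ys t
    using that by (auto intro!: arg_cong[where f = p] simp: nth_append)
  with \<phi> show ?thesis by (intro exI[of _ E] exI[of _ \<phi>]) auto
qed

text \<open>If \<open>p\<close> vanished on the image, so would its lowest-order form at \<open>f(0)\<close> on the image of the
  differential, which is everything.\<close>

lemma not_vanishing_of_surjective_differential:
  assumes curve: "\<And>ys. length ys = d \<Longrightarrow> \<exists>xs Q. length xs = N \<and>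
      (\<forall>j<d. (\<forall>t. f j (map (\<lambda>x. t * x) xs) = poly (Q j) t) \<and> coeff (Q j) 1 = ys ! j)"
    and p: "nonvanishing d p"
  shows "\<exists>xs \<in> affine_space N. p (map (\<lambda>j. f j xs) [0..<d]) \<noteq> 0"
proof (rule ccontr)
  assume "\<not> ?thesis"
  then have vanish: "p (map (\<lambda>j. f j xs) [0..<d]) = 0" if "length xs = N" for xs
    using that by (auto simp: affine_space_def)
  define b where "b j = f j (replicate N 0)" for j
  obtain E \<phi> where \<phi>: "bounded_family d E \<phi>"
    "\<And>ys t. length ys = d \<Longrightarrow> p (map (\<lambda>j. b j + t * ys ! j) [0..<d]) = poly (\<phi> ys) t"
    using poly_fun_expand_at[of p d b] p by (auto simp: nonvanishing_def)
  have ex: "\<exists>k ys. length ys = d \<and> coeff (\<phi> ys) k \<noteq> 0"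
  proof -
    obtain a where a: "length a = d" "p a \<noteq> 0" using p by (auto simp: nonvanishing_def affine_space_def)
    define ys where "ys = map (\<lambda>j. a ! j - b j) [0..<d]"
    have "map (\<lambda>j. b j + 1 * ys ! j) [0..<d] = a" using a by (auto simp: ys_def intro!: nth_equalityI)
    then have "poly (\<phi> ys) 1 \<noteq> 0" using \<phi>(2)[of ys 1] a by (simp add: ys_def)
    then have "\<phi> ys \<noteq> 0" by auto
    then show ?thesis by (auto simp: poly_eq_iff ys_def intro!: exI[of _ ys])
  qed
  \<comment> \<open>\<open>k\<close> is the order of \<open>p\<close> at the base point
    \<open>b\<close>, and \<open>ys\<close> a direction in which its lowest-order form does not
    vanish.\<close>
  define k where "k = (LEAST k. \<exists>ys. length ys = d \<and> coeff (\<phi> ys) k \<noteq> 0)"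
  obtain ys where ys: "length ys = d" "coeff (\<phi> ys) k \<noteq> 0"
    using LeastI_ex[OF ex] by (auto simp: k_def)
  have small: "coeff (\<phi> zs) i = 0" if "i < k" "length zs = d" for i zs
    using not_less_Least[OF that(1)[unfolded k_def]] that(2) by auto
  obtain xs Q where xs: "length xs = N"
    and Q: "\<And>j t. j < d \<Longrightarrow> f j (map (\<lambda>x. t * x) xs) = poly (Q j) t"
      "\<And>j. j < d \<Longrightarrow> coeff (Q j) 1 = ys ! j"
    using curve[OF ys(1)] by blast
  \<comment> \<open>Along the chosen curve \<open>f\<close> equals \<open>b + t * y t\<close>, with
    \<open>y 0\<close> the prescribed tangent \<open>ys\<close>.\<close>
  define Y where "Y j = poly_shift 1 (Q j)" for j
  define y where "y t = map (\<lambda>j. poly (Y j) t) [0..<d]" for t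
  have Q_Y: "poly (Q j) t = b j + t * poly (Y j) t" if "j < d" for j t
  proof -
    have "map (\<lambda>x. 0 * x) xs = replicate N 0" using xs by (auto intro!: nth_equalityI)
    then have "coeff (Q j) 0 = b j" using Q(1)[OF that, of 0] by (simp add: b_def poly_0_coeff_0)
    then have "Q j = pCons (b j) (Y j)"
      by (intro poly_eqI) (auto simp: Y_def coeff_poly_shift coeff_pCons split: nat.split)
    then show ?thesis by simp
  qed
  have y0: "y 0 = ys" using ys(1)
    by (auto simp: y_def Y_def poly_0_coeff_0 coeff_poly_shift Q(2)[simplified] intro!: nth_equalityI)
  obtain R where R: "\<And>i t. coeff (\<phi> (y t)) i = poly (R i) t"
    using poly_fun_on_curve[OF poly_family_coeff, of d \<phi> Y] \<phi>(1)
    unfolding y_def bounded_family_def by metis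
  \<comment> \<open>This polynomial in \<open>t\<close> is \<open>p\<close> along the curve. Its
    coefficient at \<open>t ^ k\<close> is the lowest-order form at \<open>ys\<close>:
    \<open>R i\<close> is zero for \<open>i < k\<close>, and terms with \<open>i > k\<close> carry a
    higher power of \<open>t\<close>.\<close>
  have "(\<Sum>i<E. monom 1 i * R i) = 0"
  proof (rule poly_ext)
    fix t
    have "0 = p (map (\<lambda>j. f j (map (\<lambda>x. t * x) xs)) [0..<d])" using vanish xs by simp
    also have "map (\<lambda>j. f j (map (\<lambda>x. t * x) xs)) [0..<d] = map (\<lambda>j. b j + t * y t ! j) [0..<d]"
      by (auto simp: Q Q_Y y_def)
    also have "p \<dots> = poly (\<phi> (y t)) t" by (rule \<phi>(2)) (simp add: y_def)
    also have "\<dots> = (\<Sum>i<E. coeff (\<phi> (y t)) i * t ^ i)"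
      using \<phi>(1) by (intro poly_altdef_bound) (auto simp: bounded_family_def)
    finally show "poly (\<Sum>i<E. monom 1 i * R i) t = poly 0 t"
      by (simp add: R poly_sum poly_monom mult.commute)
  qed
  then have "0 = coeff (\<Sum>i<E. monom 1 i * R i) k" by simp
  also have "\<dots> = (\<Sum>i<E. if i = k then coeff (R k) 0 else 0)"
    unfolding coeff_sum
  proof (rule sum.cong[OF refl])
    fix i
    have "R i = 0" if "i < k"
      using small[OF that] R by (intro poly_ext) (metis length_map length_upt diff_zero y_def poly_0)
    then show "coeff (monom 1 i * R i) k = (if i = k then coeff (R k) 0 else 0)"
      by (auto simp: coeff_monom_mult)
  qed
  also have "\<dots> = coeff (R k) 0"
    using ys \<phi>(1) by (auto simp: bounded_family_def not_le[symmetric])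
  also have "\<dots> = coeff (\<phi> (y 0)) k" using R[of 0 k] by (simp add: poly_0_coeff_0)
  finally show False using ys y0 by simp
qed

lemma image_contains_open:
  assumes f: "\<And>j. j < d \<Longrightarrow> f j \<in> poly_fun N"
    and curve: "\<And>ys. length ys = d \<Longrightarrow> \<exists>xs Q. length xs = N \<and>
      (\<forall>j<d. (\<forall>t. f j (map (\<lambda>x. t * x) xs) = poly (Q j) t) \<and> coeff (Q j) 1 = ys ! j)"
  shows "\<exists>V. zariski_open d V \<and> V \<noteq> {} \<and> V \<subseteq> (\<lambda>xs. map (\<lambda>j. f j xs) [0..<d]) ` affine_space N"
proof -
  have "\<not> (\<exists>p. nonvanishing d p \<and> (\<forall>ys \<in> (\<lambda>xs. map (\<lambda>j. f j xs) [0..<d]) ` affine_space N. p ys = 0))"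
    using not_vanishing_of_surjective_differential[OF curve] by blast
  with constructible_dichotomy[OF constructible_image, of d f N] f obtain q where q: "nonvanishing d q"
    "{ys \<in> affine_space d. q ys \<noteq> 0} \<subseteq> (\<lambda>xs. map (\<lambda>j. f j xs) [0..<d]) ` affine_space N" by blast
  then show ?thesis using zariski_open_nonvanishing
    by (intro exI[of _ "{ys \<in> affine_space d. q ys \<noteq> 0}"]) (auto simp: nonvanishing_def)
qed

section \<open>Algebraic dependence by counting\<close>

lemma homogeneous_system_nontrivial_solution:
  fixes a :: "'b \<Rightarrow> nat \<Rightarrow> 'a :: idom"
  assumes "finite J" "card J < m"
  shows "\<exists>c. (\<exists>i<m. c i \<noteq> 0) \<and> (\<forall>j\<in>J. (\<Sum>i<m. a j i * c i) = 0)"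
proof -
  obtain h where h: "bij_betw h {0..<card J} J" using ex_bij_betw_nat_finite[OF assms(1)] by blast
  \<comment> \<open>Zero rows pad the system to a square matrix. Since \<open>card J < m\<close>
    there is at least one of them, and it kills every term of the Leibniz formula.\<close>
  define M where "M = mat m m (\<lambda>(r, i). if r < card J then a (h r) i else 0)"
  have M: "M \<in> carrier_mat m m" by (simp add: M_def)
  have "(\<Prod>i = 0..<m. M $$ (i, \<pi> i)) = 0" if "\<pi> permutes {0..<m}" for \<pi>
  proof (rule prod_zero)
    show "\<exists>i\<in>{0..<m}. M $$ (i, \<pi> i) = 0"
      using assms(2) permutes_in_image[OF that] by (intro bexI[of _ "m - 1"]) (auto simp: M_def)
  qed simp
  then have "det M = 0" unfolding det_def'[OF M] by (intro sum.neutral) auto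
  then obtain v where v: "v \<in> carrier_vec m" "v \<noteq> 0\<^sub>v m" "M *\<^sub>v v = 0\<^sub>v m"
    using det_0_iff_vec_prod_zero[OF M] by blast
  have "\<exists>i<m. v $ i \<noteq> 0" using v(1,2) by (auto simp: vec_eq_iff)
  moreover have "(\<Sum>i<m. a j i * v $ i) = 0" if j: "j \<in> J" for j
  proof -
    obtain r where r: "r < card J" "j = h r" using bij_betw_imp_surj_on[OF h] j by force
    then have "r < m" using assms(2) by simp
    have "0 = (M *\<^sub>v v) $ r" using v(3) \<open>r < m\<close> by simp
    also have "\<dots> = (\<Sum>i<m. a j i * v $ i)"
      using v(1) r \<open>r < m\<close> by (auto simp: M_def scalar_prod_def atLeast0LessThan intro!: sum.cong)
    finally show ?thesis by simp
  qed
  ultimately show ?thesis by (intro exI[of _ "\<lambda>i. v $ i"]) auto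
qed

lemma digits_sum:
  fixes k :: nat
  assumes "e < k ^ d"
  shows "(\<Sum>j<d. (e div k ^ j mod k) * k ^ j) = e"
  using assms
proof (induction d arbitrary: e)
  case (Suc d)
  then have "k > 0" by (cases k) auto
  have "e div k < k ^ d" using Suc.prems \<open>k > 0\<close> by (simp add: less_mult_imp_div_less mult.commute)
  have "(\<Sum>j<Suc d. (e div k ^ j mod k) * k ^ j) =
      e mod k + (\<Sum>j<d. (e div k div k ^ j mod k) * k ^ j) * k"
    by (subst sum.lessThan_Suc_shift) (simp add: div_mult2_eq sum_distrib_left mult_ac)
  also have "\<dots> = e" using Suc.IH[OF \<open>e div k < k ^ d\<close>] by simp
  finally show ?case .
qed simp

text \<open>One coordinate at a time: a univariate polynomial of degree at most \<open>E\<close>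
  with the \<open>E + 1\<close> zeros \<open>0, ..., E\<close> is zero. The induction parameter
  \<open>m\<close> counts the leading coordinates already freed from the grid.\<close>

lemma vanishing_on_grid:
  assumes "\<And>a b. length a = N \<Longrightarrow> length b = N \<Longrightarrow>
      \<exists>Q. degree Q \<le> E \<and> (\<forall>t. p (map2 (\<lambda>x y. x + t * y) a b) = poly Q t)"
    and grid: "\<And>xs. length xs = N \<Longrightarrow> set xs \<subseteq> complex_of_nat ` {..E} \<Longrightarrow> p xs = 0"
    and "length xs = N"
  shows "p xs = 0"
proof -
  have "p xs = 0" if "length xs = N" "m \<le> N" "\<forall>i. m \<le> i \<and> i < N \<longrightarrow> xs ! i \<in> complex_of_nat ` {..E}" for xs m
    using that
  proof (induction m arbitrary: xs)
    case 0
    then show ?case by (intro grid) (auto simp: in_set_conv_nth)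
  next
    case (Suc m)
    define b where "b = (replicate N 0)[m := 1 :: complex]"
    let ?l = "\<lambda>t. map2 (\<lambda>x y. x + t * y) (xs[m := 0]) b"
    have l: "?l t = xs[m := t]" for t
      using Suc.prems by (auto intro!: nth_equalityI simp: b_def nth_list_update)
    obtain Q where Q: "degree Q \<le> E" "\<And>t. p (?l t) = poly Q t"
      using assms(1)[of "xs[m := 0]" b] Suc.prems by (auto simp: b_def)
    have "poly Q (of_nat i) = 0" if "i \<le> E" for i
    proof -
      have "p (xs[m := of_nat i]) = 0"
        using Suc.prems that by (intro Suc.IH) (auto simp: nth_list_update)
      then show ?thesis using Q(2) l by metis
    qed
    then have sub: "complex_of_nat ` {..E} \<subseteq> {x. poly Q x = 0}" by auto
    have "Q = 0"
    proof (rule ccontr)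
      assume "Q \<noteq> 0"
      have "Suc E = card (complex_of_nat ` {..E})" by (subst card_image) (auto simp: inj_on_def)
      also have "\<dots> \<le> card {x. poly Q x = 0}" by (rule card_mono[OF poly_roots_finite[OF \<open>Q \<noteq> 0\<close>] sub])
      also have "\<dots> \<le> E" using card_poly_roots_bound[OF \<open>Q \<noteq> 0\<close>] Q(1) by simp
      finally show False by simp
    qed
    then have "p (?l (xs ! m)) = 0" using Q(2) by simp
    then show ?case unfolding l by simp
  qed
  from this[of xs N] show ?thesis using assms(3) by (simp add: not_less[symmetric])
qed

text \<open>Counting: a general combination of the \<open>k ^ d\<close> monomials with exponents below \<open>k\<close>
  in the \<open>f j\<close> has only \<open>O(k ^ N)\<close> linear conditions to satisfy in order to vanish on a large grid.
  The Kronecker substitution \<open>y\<^sub>j = t ^ (k ^ j)\<close> shows that the relation is nontrivial.\<close>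

lemma algebraically_dependent:
  assumes f: "\<And>j. j < d \<Longrightarrow> f j \<in> poly_fun N" and "N < d"
  shows "\<exists>p. nonvanishing d p \<and> (\<forall>xs \<in> affine_space N. p (map (\<lambda>j. f j xs) [0..<d]) = 0)"
proof -
  have "\<exists>D. \<forall>j<d. \<forall>a b. length a = N \<longrightarrow> length b = N \<longrightarrow>
    (\<exists>Q. degree Q \<le> D \<and> (\<forall>t. f j (map2 (\<lambda>x y. x + t * y) a b) = poly Q t))"
  proof -
    from poly_fun_on_line[OF f] obtain D where D: "\<And>j a b. j < d \<Longrightarrow> length a = N \<Longrightarrow> length b = N \<Longrightarrow>
      \<exists>Q. degree Q \<le> D j \<and> (\<forall>t. f j (map2 (\<lambda>x y. x + t * y) a b) = poly Q t)" by metis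
    have "D j \<le> (\<Sum>j<d. D j)" if "j < d" for j using that by (intro member_le_sum) auto
    then have "\<exists>Q. degree Q \<le> (\<Sum>j<d. D j) \<and> (\<forall>t. f j (map2 (\<lambda>x y. x + t * y) a b) = poly Q t)"
      if "j < d" "length a = N" "length b = N" for j a b
      using D[OF that] \<open>j < d\<close> order_trans by blast
    then show ?thesis by blast
  qed
  then obtain D where D: "\<And>j a b. j < d \<Longrightarrow> length a = N \<Longrightarrow> length b = N \<Longrightarrow>
    \<exists>Q. degree Q \<le> D \<and> (\<forall>t. f j (map2 (\<lambda>x y. x + t * y) a b) = poly Q t)" by blast
  \<comment> \<open>The combination has degree at most \<open>E\<close> on lines, so it is tested on
    \<open>(E + 1) ^ N\<close> grid points, at most \<open>k ^ N * (d * D + 1) ^ N\<close>. This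
    \<open>k\<close> exceeds the second factor, giving fewer than
    \<open>k ^ (N + 1) \<le> k ^ d\<close> conditions.\<close>
  define k where "k = (d * D + 1) ^ N + 1"
  define E where "E = d * k * D"
  define \<alpha> where "\<alpha> e j = e div k ^ j mod k" for e j :: nat
  define mono where "mono e ys = (\<Prod>j<d. ys ! j ^ \<alpha> e j)" for e and ys :: "complex list"
  define F where "F xs = map (\<lambda>j. f j xs) [0..<d]" for xs
  have "k > 0" by (simp add: k_def)
  then have \<alpha>: "\<alpha> e j \<le> k" for e j by (simp add: \<alpha>_def less_imp_le)
  let ?J = "{xs. set xs \<subseteq> complex_of_nat ` {..E} \<and> length xs = N}"
  have "card ?J = Suc E ^ N"
    by (subst card_lists_length_eq) (auto simp: card_image inj_on_def)
  also have "\<dots> \<le> (k * (d * D + 1)) ^ N"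
    using \<open>k > 0\<close> by (intro power_mono) (auto simp: E_def algebra_simps)
  also have "\<dots> = k ^ N * (d * D + 1) ^ N" by (rule power_mult_distrib)
  also have "\<dots> < k ^ N * k" using \<open>k > 0\<close> by (simp add: k_def)
  also have "\<dots> \<le> k ^ d" using \<open>k > 0\<close> \<open>N < d\<close> power_increasing[of "Suc N" d k] by (simp add: mult.commute)
  finally have "card ?J < k ^ d" .
  moreover have "finite ?J" by (intro finite_lists_length_eq) auto
  ultimately obtain c where c: "\<exists>e < k ^ d. c e \<noteq> 0"
    "\<And>xs. xs \<in> ?J \<Longrightarrow> (\<Sum>e < k ^ d. mono e (F xs) * c e) = 0"
    using homogeneous_system_nontrivial_solution[of ?J "k ^ d" "\<lambda>xs e. mono e (F xs)"] by blast
  define p where "p ys = (\<Sum>e < k ^ d. mono e ys * c e)" for ys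
  have p: "p \<in> poly_fun d" unfolding p_def mono_def by (auto intro!: poly_fun_intros)
  have "p (F xs) = 0" if "length xs = N" for xs
  proof (rule vanishing_on_grid[where p = "\<lambda>xs. p (F xs)" and E = E, OF _ _ that])
    fix a b :: "complex list" assume l: "length a = N" "length b = N"
    from D[OF _ l] obtain Q where Q: "\<And>j. j < d \<Longrightarrow> degree (Q j) \<le> D"
      "\<And>j t. j < d \<Longrightarrow> f j (map2 (\<lambda>x y. x + t * y) a b) = poly (Q j) t" by metis
    let ?R = "\<Sum>e < k ^ d. Polynomial.smult (c e) (\<Prod>j<d. Q j ^ \<alpha> e j)"
    have "degree (\<Prod>j<d. Q j ^ \<alpha> e j) \<le> E" for e
    proof -
      have "degree (\<Prod>j<d. Q j ^ \<alpha> e j) \<le> (\<Sum>j<d. degree (Q j ^ \<alpha> e j))"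
        using degree_prod_sum_le[of "{..<d}" "\<lambda>j. Q j ^ \<alpha> e j"] by (simp add: o_def)
      also have "\<dots> \<le> (\<Sum>j<d. k * D)"
      proof (rule sum_mono)
        fix j assume "j \<in> {..<d}"
        then have "degree (Q j) * \<alpha> e j \<le> D * k" using Q(1) \<alpha> by (intro mult_mono) auto
        then show "degree (Q j ^ \<alpha> e j) \<le> k * D"
          using degree_power_le[of "Q j" "\<alpha> e j"] by (simp add: mult.commute)
      qed
      finally show ?thesis by (simp add: E_def)
    qed
    then have "degree ?R \<le> E"
      by (intro degree_sum_le) (auto intro: order_trans[OF degree_smult_le])
    moreover have "p (F (map2 (\<lambda>x y. x + t * y) a b)) = poly ?R t" for t
      unfolding p_def mono_def F_def by (auto simp: poly_sum poly_prod Q(2) mult.commute[of "c _"] intro!: sum.cong prod.cong)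
    ultimately show "\<exists>Q. degree Q \<le> E \<and> (\<forall>t. p (F (map2 (\<lambda>x y. x + t * y) a b)) = poly Q t)" by blast
  qed (use c(2) p_def in auto)
  moreover have "nonvanishing d p"
  proof -
    define R where "R = (\<Sum>e < k ^ d. monom (c e) e)"
    have "coeff R e = c e" if "e < k ^ d" for e using that by (simp add: R_def coeff_sum)
    with c(1) have "R \<noteq> 0" by auto
    then obtain t where "poly R t \<noteq> 0" using poly_all_0_iff_0 by blast
    have "mono e (map (\<lambda>j. t ^ (k ^ j)) [0..<d]) = t ^ e" if "e < k ^ d" for e
    proof -
      have "mono e (map (\<lambda>j. t ^ (k ^ j)) [0..<d]) = (\<Prod>j<d. t ^ (\<alpha> e j * k ^ j))"
        by (simp add: mono_def power_mult[symmetric] mult.commute)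
      also have "\<dots> = t ^ (\<Sum>j<d. \<alpha> e j * k ^ j)" by (simp add: power_sum)
      finally show ?thesis using digits_sum[OF that] by (simp add: \<alpha>_def)
    qed
    then have "p (map (\<lambda>j. t ^ (k ^ j)) [0..<d]) = poly R t"
      by (auto simp: p_def R_def poly_sum poly_monom mult.commute intro!: sum.cong)
    with \<open>poly R t \<noteq> 0\<close> p show ?thesis
      by (auto simp: nonvanishing_def affine_space_def intro!: exI[of _ "map (\<lambda>j. t ^ (k ^ j)) [0..<d]"])
  qed
  ultimately show ?thesis unfolding F_def by (auto simp: affine_space_def)
qed

lemma image_contains_no_open:
  assumes f: "\<And>j. j < d \<Longrightarrow> f j \<in> poly_fun N" and "N < d"
    and V: "zariski_open d V" "V \<noteq> {}"
  shows "\<not> V \<subseteq> (\<lambda>xs. map (\<lambda>j. f j xs) [0..<d]) ` affine_space N"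
proof
  assume sub: "V \<subseteq> (\<lambda>xs. map (\<lambda>j. f j xs) [0..<d]) ` affine_space N"
  obtain p where p: "nonvanishing d p" "\<And>xs. xs \<in> affine_space N \<Longrightarrow> p (map (\<lambda>j. f j xs) [0..<d]) = 0"
    using algebraically_dependent[of d f N] f \<open>N < d\<close> by blast
  obtain q where q: "nonvanishing d q" "{xs \<in> affine_space d. q xs \<noteq> 0} \<subseteq> V"
    using zariski_open_contains_nonvanishing[OF V] by blast
  from nonvanishing_mult[OF p(1) q(1)] obtain ys where "ys \<in> affine_space d" "p ys \<noteq> 0" "q ys \<noteq> 0"
    by (auto simp: nonvanishing_def)
  then show False using q(2) sub p(2) by auto
qed

section \<open>Characteristic polynomials\<close>

lemma mult_mat_index_sum:
  assumes "P \<in> carrier_mat r m" "Q \<in> carrier_mat m c" "i < r" "j < c"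
  shows "(P * Q) $$ (i, j) = (\<Sum>k<m. P $$ (i, k) * Q $$ (k, j))"
  using assms by (auto simp: scalar_prod_def atLeast0LessThan intro!: sum.cong)

lemma pow_mat_add:
  assumes A: "A \<in> carrier_mat d d"
  shows "A ^\<^sub>m (r + j) = A ^\<^sub>m r * A ^\<^sub>m j"
proof (induction j)
  case (Suc j)
  have "A ^\<^sub>m (r + Suc j) = A ^\<^sub>m r * A ^\<^sub>m j * A" using Suc by simp
  also have "\<dots> = A ^\<^sub>m r * A ^\<^sub>m Suc j"
    using A by (simp add: assoc_mult_mat[of _ d d _ d _ d])
  finally show ?case .
qed (use A in simp)

lemma trace_mult_commute:
  fixes P Q :: "'a :: comm_semiring_0 mat"
  assumes "P \<in> carrier_mat r m" "Q \<in> carrier_mat m r"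
  shows "(\<Sum>i<r. (P * Q) $$ (i, i)) = (\<Sum>i<m. (Q * P) $$ (i, i))"
proof -
  have "(\<Sum>i<r. (P * Q) $$ (i, i)) = (\<Sum>i<r. \<Sum>k<m. P $$ (i, k) * Q $$ (k, i))"
    using mult_mat_index_sum[OF assms] by (intro sum.cong refl) auto
  also have "\<dots> = (\<Sum>k<m. \<Sum>i<r. Q $$ (k, i) * P $$ (i, k))"
    by (subst sum.swap) (simp add: mult.commute)
  also have "\<dots> = (\<Sum>i<m. (Q * P) $$ (i, i))"
    using mult_mat_index_sum[OF assms(2,1)] by (intro sum.cong refl) auto
  finally show ?thesis .
qed

section \<open>Matrices with polynomial entries\<close>

definition poly_mat :: "nat \<Rightarrow> nat \<Rightarrow> nat \<Rightarrow> (complex list \<Rightarrow> complex mat) \<Rightarrow> bool" where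
  "poly_mat N r c M \<longleftrightarrow> (\<forall>xs. M xs \<in> carrier_mat r c) \<and>
     (\<forall>i<r. \<forall>j<c. (\<lambda>xs. M xs $$ (i, j)) \<in> poly_fun N)"

lemma poly_mat_const: "M \<in> carrier_mat r c \<Longrightarrow> poly_mat N r c (\<lambda>xs. M)"
  by (auto simp: poly_mat_def intro: pf_const)

lemma poly_mat_add:
  assumes "poly_mat N r c P" "poly_mat N r c Q"
  shows "poly_mat N r c (\<lambda>xs. P xs + Q xs)"
  unfolding poly_mat_def
proof (intro conjI allI impI)
  fix i j assume ij: "i < r" "j < c"
  have "(\<lambda>xs. (P xs + Q xs) $$ (i, j)) = (\<lambda>xs. P xs $$ (i, j) + Q xs $$ (i, j))"
    using assms ij by (intro ext index_add_mat) (auto simp: poly_mat_def)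
  then show "(\<lambda>xs. (P xs + Q xs) $$ (i, j)) \<in> poly_fun N"
    using assms ij by (auto simp: poly_mat_def intro!: pf_add)
qed (use assms in \<open>auto simp: poly_mat_def\<close>)

lemma poly_mat_mult:
  assumes "poly_mat N r m P" "poly_mat N m c Q"
  shows "poly_mat N r c (\<lambda>xs. P xs * Q xs)"
  unfolding poly_mat_def
proof (intro conjI allI impI)
  fix i j assume ij: "i < r" "j < c"
  have "(\<lambda>xs. (P xs * Q xs) $$ (i, j)) = (\<lambda>xs. \<Sum>k<m. P xs $$ (i, k) * Q xs $$ (k, j))"
    using assms ij by (intro ext mult_mat_index_sum) (auto simp: poly_mat_def)
  then show "(\<lambda>xs. (P xs * Q xs) $$ (i, j)) \<in> poly_fun N"
    using assms ij by (auto simp: poly_mat_def intro!: poly_fun_intros)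
qed (use assms in \<open>auto simp: poly_mat_def intro: mult_carrier_mat\<close>)

lemma poly_mat_pow:
  assumes "poly_mat N r r P"
  shows "poly_mat N r r (\<lambda>xs. P xs ^\<^sub>m k)"
proof (induction k)
  case 0
  have "dim_row (P xs) = r" for xs using assms by (auto simp: poly_mat_def)
  then show ?case by (simp add: poly_mat_const)
qed (simp add: poly_mat_mult assms)

lemma poly_fun_det:
  assumes "\<And>xs. M xs \<in> carrier_mat m m"
    and "\<And>i j. i < m \<Longrightarrow> j < m \<Longrightarrow> (\<lambda>xs. M xs $$ (i, j)) \<in> poly_fun N"
  shows "(\<lambda>xs. det (M xs)) \<in> poly_fun N"
  unfolding det_def'[OF assms(1)]
  using permutes_in_image by (intro poly_fun_sum pf_mult pf_const poly_fun_prod assms(2)) fastforce+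

lemma poly_family_det:
  assumes "\<And>xs. M xs \<in> carrier_mat m m"
    and "\<And>i j. i < m \<Longrightarrow> j < m \<Longrightarrow> poly_family N (\<lambda>xs. M xs $$ (i, j))"
  shows "poly_family N (\<lambda>xs. det (M xs))"
  unfolding det_def'[OF assms(1)]
  using permutes_in_image
  by (intro poly_family_sum poly_family_mult poly_family_const poly_family_prod assms(2)) fastforce+

lemma char_poly_matrix_index:
  assumes "A \<in> carrier_mat d d" "i < d" "j < d"
  shows "char_poly_matrix A $$ (i, j) = [:- A $$ (i, j), if i = j then 1 else 0:]"
  using assms by (auto simp: char_poly_matrix_def)

lemma poly_fun_char_poly_coeff:
  assumes "poly_mat N d d M"
  shows "(\<lambda>xs. coeff (char_poly (M xs)) j) \<in> poly_fun N"
proof -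
  have M: "M xs \<in> carrier_mat d d" for xs using assms by (auto simp: poly_mat_def)
  have "poly_family N (\<lambda>xs. char_poly (M xs))" unfolding char_poly_def
  proof (rule poly_family_det)
    fix i j assume ij: "i < d" "j < d"
    have "(\<lambda>xs. char_poly_matrix (M xs) $$ (i, j)) =
        (\<lambda>xs. [:- M xs $$ (i, j):] + [:0, if i = j then 1 else 0:])"
      using char_poly_matrix_index[OF M ij] by auto
    moreover have "poly_family N (\<lambda>xs. [:- M xs $$ (i, j):] + [:0, if i = j then 1 else 0:])"
      using assms ij by (intro poly_family_intros poly_fun_uminus) (auto simp: poly_mat_def)
    ultimately show "poly_family N (\<lambda>xs. char_poly_matrix (M xs) $$ (i, j))" by simp
  qed (use M in auto)
  then show ?thesis by (rule poly_family_coeff)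
qed

section \<open>First-order variation of determinants and Cayley-Hamilton\<close>

lemma coeff_prod_linear:
  fixes a b :: "'b \<Rightarrow> 'a :: comm_ring_1"
  assumes "finite I"
  shows "coeff (\<Prod>i\<in>I. [:a i, b i:]) 0 = (\<Prod>i\<in>I. a i)"
    and "coeff (\<Prod>i\<in>I. [:a i, b i:]) 1 = (\<Sum>i\<in>I. \<Prod>k\<in>I. if k = i then b k else a k)"
  using assms
proof (induction I rule: finite_induct)
  case (insert x I)
  { case 1 then show ?case using insert by simp }
  { case 2
    have "(\<Prod>k\<in>I. if k = x then b k else a k) = (\<Prod>k\<in>I. a k)"
      using insert.hyps by (intro prod.cong) auto
    moreover have "(\<Sum>i\<in>I. (if x = i then b x else a x) * (\<Prod>k\<in>I. if k = i then b k else a k)) =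
        (\<Sum>i\<in>I. a x * (\<Prod>k\<in>I. if k = i then b k else a k))"
      using insert.hyps by (intro sum.cong) auto
    ultimately show ?case using insert
      by (simp add: coeff_mult sum_distrib_left add.commute) }
qed auto

text \<open>Jacobi's formula for the derivative of \<open>det (X + t Y)\<close> at
  \<open>t = 0\<close>. It is stated over a commutative ring because \<open>X\<close> will be
  \<open>s I - A\<close>, with entries in the polynomial ring in \<open>s\<close>.\<close>

lemma coeff_1_det_linear:
  fixes X Y :: "'a :: comm_ring_1 mat"
  assumes "X \<in> carrier_mat d d" "Y \<in> carrier_mat d d"
  shows "coeff (det (mat d d (\<lambda>(i, j). [:X $$ (i, j), Y $$ (i, j):]))) 1 =
    (\<Sum>i<d. \<Sum>j<d. Y $$ (i, j) * cofactor X i j)"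
proof -
  let ?P = "{\<pi>. \<pi> permutes {0..<d}}"
  \<comment> \<open>\<open>X\<close> with row \<open>i\<close> taken from \<open>Y\<close>: the
    determinant is linear in each row, so its derivative is the sum of the
    \<open>det (Z i)\<close>.\<close>
  define Z where "Z i = mat d d (\<lambda>(k, j). if k = i then Y $$ (k, j) else X $$ (k, j))" for i
  have sgn: "signof \<pi> = [:signof \<pi> :: 'a:]" for \<pi> :: "nat \<Rightarrow> nat"
    by (auto simp: sign_def one_pCons)
  have "coeff (det (mat d d (\<lambda>(i, j). [:X $$ (i, j), Y $$ (i, j):]))) 1 =
    (\<Sum>\<pi>\<in>?P. signof \<pi> * coeff (\<Prod>i = 0..<d. [:X $$ (i, \<pi> i), Y $$ (i, \<pi> i):]) 1)"
    unfolding det_def'[OF mat_carrier] coeff_sum sgn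
  proof (rule sum.cong[OF refl])
    fix \<pi> assume "\<pi> \<in> ?P"
    then have "\<pi> i < d" if "i < d" for i using that permutes_in_image[of \<pi> "{0..<d}" i] by auto
    then have "(\<Prod>i = 0..<d. mat d d (\<lambda>(i, j). [:X $$ (i, j), Y $$ (i, j):]) $$ (i, \<pi> i)) =
        (\<Prod>i = 0..<d. [:X $$ (i, \<pi> i), Y $$ (i, \<pi> i):])"
      by (intro prod.cong) auto
    then show "coeff ([:signof \<pi>:] *
        (\<Prod>i = 0..<d. mat d d (\<lambda>(i, j). [:X $$ (i, j), Y $$ (i, j):]) $$ (i, \<pi> i))) 1 =
        signof \<pi> * coeff (\<Prod>i = 0..<d. [:X $$ (i, \<pi> i), Y $$ (i, \<pi> i):]) 1"
      by simp
  qed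
  also have "\<dots> = (\<Sum>\<pi>\<in>?P. \<Sum>i = 0..<d. signof \<pi> *
      (\<Prod>k = 0..<d. if k = i then Y $$ (k, \<pi> k) else X $$ (k, \<pi> k)))"
    by (simp add: coeff_prod_linear(2)[simplified] sum_distrib_left)
  also have "\<dots> = (\<Sum>i = 0..<d. \<Sum>\<pi>\<in>?P. signof \<pi> *
      (\<Prod>k = 0..<d. if k = i then Y $$ (k, \<pi> k) else X $$ (k, \<pi> k)))"
    by (rule sum.swap)
  also have "\<dots> = (\<Sum>i = 0..<d. det (Z i))"
  proof (rule sum.cong[OF refl])
    fix i assume "i \<in> {0..<d}"
    have "Z i \<in> carrier_mat d d" by (simp add: Z_def)
    from det_def'[OF this]
    show "(\<Sum>\<pi>\<in>?P. signof \<pi> * (\<Prod>k = 0..<d. if k = i then Y $$ (k, \<pi> k) else X $$ (k, \<pi> k))) = det (Z i)"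
    proof (simp, intro sum.cong[OF refl] arg_cong2[where f = "(*)"] refl prod.cong)
      fix \<pi> k assume "\<pi> \<in> ?P" "k \<in> {0..<d}"
      then have "\<pi> k < d" using permutes_in_image[of \<pi> "{0..<d}" k] by auto
      with \<open>k \<in> {0..<d}\<close> show "(if k = i then Y $$ (k, \<pi> k) else X $$ (k, \<pi> k)) = Z i $$ (k, \<pi> k)"
        by (simp add: Z_def)
    qed
  qed
  also have "\<dots> = (\<Sum>i<d. \<Sum>j<d. Y $$ (i, j) * cofactor X i j)"
    unfolding atLeast0LessThan
  proof (rule sum.cong[OF refl])
    fix i assume i: "i \<in> {..<d}"
    have "det (Z i) = (\<Sum>j<d. Z i $$ (i, j) * cofactor (Z i) i j)"
      using i by (intro laplace_expansion_row) (auto simp: Z_def)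
    also have "\<dots> = (\<Sum>j<d. Y $$ (i, j) * cofactor X i j)"
    proof (rule sum.cong[OF refl])
      fix j assume j: "j \<in> {..<d}"
      have "mat_delete (Z i) i j = mat_delete X i j"
        using i j assms by (intro eq_matI) (auto simp: mat_delete_def Z_def)
      then show "Z i $$ (i, j) * cofactor (Z i) i j = Y $$ (i, j) * cofactor X i j"
        using i j by (simp add: cofactor_def Z_def)
    qed
    finally show "det (Z i) = (\<Sum>j<d. Y $$ (i, j) * cofactor X i j)" .
  qed
  finally show ?thesis .
qed

text \<open>Comparing coefficients in \<open>adj (sI - A) (sI - A) = \<chi>(s) I\<close> gives a downward recursion for the
  coefficients of the adjugate, whose last step is the Cayley--Hamilton theorem.\<close>

lemma adjugate_coeffs:
  fixes A :: "complex mat"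
  assumes A: "A \<in> carrier_mat d d"
  defines "\<chi> \<equiv> char_poly A"
  shows "i < d \<Longrightarrow> k < d \<Longrightarrow> coeff (cofactor (char_poly_matrix A) k i) j =
      (\<Sum>r\<in>{j<..d}. coeff \<chi> r * (A ^\<^sub>m (r - j - 1)) $$ (i, k))"
    and "i < d \<Longrightarrow> k < d \<Longrightarrow> (\<Sum>r\<le>d. coeff \<chi> r * (A ^\<^sub>m r) $$ (i, k)) = 0"
proof -
  let ?X = "char_poly_matrix A"
  define a where "a j i k = coeff (cofactor ?X k i) j" for j i k
  have X: "?X \<in> carrier_mat d d" using A by simp
  have deg: "degree \<chi> = d" using degree_monic_char_poly[OF A] by (simp add: \<chi>_def)
  have prod: "(\<Sum>l<d. cofactor ?X l i * [:- A $$ (l, k), if l = k then 1 else 0:]) =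
      (if i = k then \<chi> else 0)" if "i < d" "k < d" for i k
  proof -
    have "(\<Sum>l<d. cofactor ?X l i * [:- A $$ (l, k), if l = k then 1 else 0:]) =
        (\<Sum>l<d. adj_mat ?X $$ (i, l) * ?X $$ (l, k))"
      using that X char_poly_matrix_index[OF A _ that(2)]
      by (intro sum.cong refl) (auto simp: adj_mat_def)
    also have "\<dots> = (adj_mat ?X * ?X) $$ (i, k)"
      using mult_mat_index_sum[OF adj_mat(1)[OF X] X that] by simp
    finally show ?thesis using that by (simp add: adj_mat(3)[OF X] \<chi>_def char_poly_def)
  qed
  have rec: "a j i k = (\<Sum>l<d. a (Suc j) i l * A $$ (l, k)) + (if i = k then coeff \<chi> (Suc j) else 0)"
    if "i < d" "k < d" for j i k
  proof -
    have "coeff (cofactor ?X l i * [:- A $$ (l, k), if l = k then 1 else 0:]) (Suc j) =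
        (if l = k then a j i l else 0) - a (Suc j) i l * A $$ (l, k)" for l
      by (simp add: a_def mult_pCons_right)
    then have "(\<Sum>l<d. (if l = k then a j i l else 0) - a (Suc j) i l * A $$ (l, k)) =
        coeff (\<Sum>l<d. cofactor ?X l i * [:- A $$ (l, k), if l = k then 1 else 0:]) (Suc j)"
      by (simp only: coeff_sum)
    then have "(\<Sum>l<d. (if l = k then a j i l else 0)) - (\<Sum>l<d. a (Suc j) i l * A $$ (l, k)) =
        coeff (if i = k then \<chi> else 0) (Suc j)"
      by (simp only: prod[OF that] sum_subtractf)
    then show ?thesis using that by (simp add: algebra_simps split: if_splits)
  qed
  have rec0: "(\<Sum>l<d. a 0 i l * A $$ (l, k)) + (if i = k then coeff \<chi> 0 else 0) = 0"
    if "i < d" "k < d" for i k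
  proof -
    have "coeff (cofactor ?X l i * [:- A $$ (l, k), if l = k then 1 else 0:]) 0 =
        - (a 0 i l * A $$ (l, k))" for l
      by (simp add: a_def mult_pCons_right)
    then have "(\<Sum>l<d. - (a 0 i l * A $$ (l, k))) =
        coeff (\<Sum>l<d. cofactor ?X l i * [:- A $$ (l, k), if l = k then 1 else 0:]) 0"
      by (simp only: coeff_sum)
    then have "- (\<Sum>l<d. a 0 i l * A $$ (l, k)) = coeff (if i = k then \<chi> else 0) 0"
      by (simp only: prod[OF that] sum_negf)
    then show ?thesis by (auto simp: neg_eq_iff_add_eq_0 add.commute)
  qed
  \<comment> \<open>The recursion runs downward and needs a place to start: beyond both
    \<open>D\<close> and \<open>d\<close> the two sides of the formula are zero.\<close>
  obtain D where D: "\<And>j i k. i < d \<Longrightarrow> k < d \<Longrightarrow> D < j \<Longrightarrow> a j i k = 0"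
  proof
    let ?D = "\<Sum>i<d. \<Sum>k<d. degree (cofactor ?X k i)"
    fix j i k assume ik: "i < d" "k < d" and "?D < j"
    have "degree (cofactor ?X k i) \<le> (\<Sum>k<d. degree (cofactor ?X k i))"
      using ik by (intro member_le_sum) auto
    also have "\<dots> \<le> ?D" using ik by (intro member_le_sum[where f = "\<lambda>i. \<Sum>k<d. degree (cofactor ?X k i)"]) auto
    finally show "a j i k = 0" using \<open>?D < j\<close> unfolding a_def by (intro coeff_eq_0) simp
  qed
  have pow_step: "(\<Sum>l<d. (\<Sum>r\<in>R. c r * (A ^\<^sub>m e r) $$ (i, l)) * A $$ (l, k)) =
      (\<Sum>r\<in>R. c r * (A ^\<^sub>m Suc (e r)) $$ (i, k))" if "i < d" "k < d" for R c i k and e :: "nat \<Rightarrow> nat"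
  proof -
    have "(\<Sum>r\<in>R. c r * (A ^\<^sub>m Suc (e r)) $$ (i, k)) =
        (\<Sum>r\<in>R. \<Sum>l<d. c r * (A ^\<^sub>m e r) $$ (i, l) * A $$ (l, k))"
      using mult_mat_index_sum[OF pow_carrier_mat[OF A] A that]
      by (simp add: sum_distrib_left mult.assoc)
    also have "\<dots> = (\<Sum>l<d. \<Sum>r\<in>R. c r * (A ^\<^sub>m e r) $$ (i, l) * A $$ (l, k))" by (rule sum.swap)
    finally show ?thesis by (simp add: sum_distrib_right)
  qed
  have dim: "dim_row A = d" using A by simp
  have a: "a j i k = (\<Sum>r\<in>{j<..d}. coeff \<chi> r * (A ^\<^sub>m (r - j - 1)) $$ (i, k))"
    if "i < d" "k < d" for i j k
    using that
  proof (induction "Suc D + d - j" arbitrary: j i k)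
    case 0
    then show ?case using D[of i k j] by simp
  next
    case (Suc x)
    have IH: "a (Suc j) i l = (\<Sum>r\<in>{Suc j<..d}. coeff \<chi> r * (A ^\<^sub>m (r - Suc j - 1)) $$ (i, l))"
      if "l < d" for l using Suc that by (intro Suc.hyps) auto
    have "a j i k = (\<Sum>l<d. (\<Sum>r\<in>{Suc j<..d}. coeff \<chi> r * (A ^\<^sub>m (r - Suc j - 1)) $$ (i, l)) * A $$ (l, k)) +
        (if i = k then coeff \<chi> (Suc j) else 0)"
      unfolding rec[OF Suc.prems] using IH by simp
    also have "\<dots> = (\<Sum>r\<in>{Suc j<..d}. coeff \<chi> r * (A ^\<^sub>m (Suc (r - Suc j - 1))) $$ (i, k)) +
        (if i = k then coeff \<chi> (Suc j) else 0)"
      unfolding pow_step[OF Suc.prems] ..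
    also have "(\<Sum>r\<in>{Suc j<..d}. coeff \<chi> r * (A ^\<^sub>m (Suc (r - Suc j - 1))) $$ (i, k)) =
        (\<Sum>r\<in>{Suc j<..d}. coeff \<chi> r * (A ^\<^sub>m (r - j - 1)) $$ (i, k))"
      by (intro sum.cong refl arg_cong2[where f = "(*)"] arg_cong[where f = "\<lambda>e. (A ^\<^sub>m e) $$ (i, k)"]) auto
    also have "(\<Sum>r\<in>{Suc j<..d}. coeff \<chi> r * (A ^\<^sub>m (r - j - 1)) $$ (i, k)) +
        (if i = k then coeff \<chi> (Suc j) else 0) =
        (\<Sum>r\<in>{j<..d}. coeff \<chi> r * (A ^\<^sub>m (r - j - 1)) $$ (i, k))"
    proof (cases "Suc j \<le> d")
      case True
      then have "{j<..d} = insert (Suc j) {Suc j<..d}" by auto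
      then show ?thesis using Suc.prems dim by simp
    next
      case False
      then have "{j<..d} = {}" "{Suc j<..d} = {}" "coeff \<chi> (Suc j) = 0"
        using deg by (auto intro: coeff_eq_0)
      then show ?thesis by simp
    qed
    finally show ?case .
  qed
  then show "i < d \<Longrightarrow> k < d \<Longrightarrow> coeff (cofactor (char_poly_matrix A) k i) j =
      (\<Sum>r\<in>{j<..d}. coeff \<chi> r * (A ^\<^sub>m (r - j - 1)) $$ (i, k))" by (simp add: a_def)
  assume ik: "i < d" "k < d"
  have "0 = (\<Sum>l<d. (\<Sum>r\<in>{0<..d}. coeff \<chi> r * (A ^\<^sub>m (r - 0 - 1)) $$ (i, l)) * A $$ (l, k)) +
      (if i = k then coeff \<chi> 0 else 0)"
    using rec0[OF ik] a[OF ik(1), of _ 0] by simp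
  also have "\<dots> = (\<Sum>r\<in>{0<..d}. coeff \<chi> r * (A ^\<^sub>m (Suc (r - 0 - 1))) $$ (i, k)) +
      (if i = k then coeff \<chi> 0 else 0)"
    unfolding pow_step[OF ik] ..
  also have "(\<Sum>r\<in>{0<..d}. coeff \<chi> r * (A ^\<^sub>m (Suc (r - 0 - 1))) $$ (i, k)) =
      (\<Sum>r\<in>{0<..d}. coeff \<chi> r * (A ^\<^sub>m r) $$ (i, k))"
    by (intro sum.cong refl arg_cong2[where f = "(*)"] arg_cong[where f = "\<lambda>e. (A ^\<^sub>m e) $$ (i, k)"]) auto
  also have "\<dots> + (if i = k then coeff \<chi> 0 else 0) = (\<Sum>r\<le>d. coeff \<chi> r * (A ^\<^sub>m r) $$ (i, k))"
  proof -
    have "{..d} = insert 0 {0<..d}" by auto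
    then show ?thesis using ik dim by simp
  qed
  finally show "(\<Sum>r\<le>d. coeff \<chi> r * (A ^\<^sub>m r) $$ (i, k)) = 0" by simp
qed

text \<open>Jacobi's formula applied to \<open>s I - A - t M\<close>, with the adjugate expanded by
  \<open>adjugate_coeffs\<close>; this is where the traces of \<open>M\<close> against powers of
  \<open>A\<close> come from.\<close>

lemma char_poly_on_line:
  fixes A M :: "complex mat"
  assumes A: "A \<in> carrier_mat d d" and M: "M \<in> carrier_mat d d"
  shows "\<exists>Q. \<forall>j. (\<forall>t. coeff (char_poly (A + t \<cdot>\<^sub>m M)) j = poly (Q j) t) \<and>
    coeff (Q j) 1 = - (\<Sum>r\<in>{j<..d}. coeff (char_poly A) r * (\<Sum>i<d. (M * A ^\<^sub>m (r - j - 1)) $$ (i, i)))"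
proof -
  let ?X = "char_poly_matrix A"
  define Y where "Y = map_mat (\<lambda>m. [:- m:]) M"
  define D where "D = det (mat d d (\<lambda>(i, j). [:?X $$ (i, j), Y $$ (i, j):]))"
  have X: "?X \<in> carrier_mat d d" and Y: "Y \<in> carrier_mat d d" using A M by (auto simp: Y_def)
  \<comment> \<open>The outer variable of \<open>D\<close> is the scale \<open>t\<close>, the inner
    one is \<open>s\<close>. Evaluation at the constant polynomial \<open>[:t:]\<close> is a ring
    homomorphism and so commutes with \<open>det\<close>.\<close>
  have "char_poly (A + t \<cdot>\<^sub>m M) = poly D [:t:]" for t
  proof -
    have hom: "comm_ring_hom (\<lambda>p. poly p [:t:])" by unfold_locales auto
    have "char_poly_matrix (A + t \<cdot>\<^sub>m M) =
        map_mat (\<lambda>p. poly p [:t:]) (mat d d (\<lambda>(i, j). [:?X $$ (i, j), Y $$ (i, j):]))"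
    proof (rule eq_matI)
      fix i j
      assume "i < dim_row (map_mat (\<lambda>p. poly p [:t:]) (mat d d (\<lambda>(i, j). [:?X $$ (i, j), Y $$ (i, j):])))"
        "j < dim_col (map_mat (\<lambda>p. poly p [:t:]) (mat d d (\<lambda>(i, j). [:?X $$ (i, j), Y $$ (i, j):])))"
      then have "i < d" "j < d" by auto
      then show "char_poly_matrix (A + t \<cdot>\<^sub>m M) $$ (i, j) =
          map_mat (\<lambda>p. poly p [:t:]) (mat d d (\<lambda>(i, j). [:?X $$ (i, j), Y $$ (i, j):])) $$ (i, j)"
        using A M by (subst char_poly_matrix_index[of _ d]) (auto simp: char_poly_matrix_index Y_def)
    qed (use A M in \<open>auto simp: char_poly_matrix_def\<close>)
    then show ?thesis unfolding char_poly_def D_def comm_ring_hom.hom_det[OF hom, symmetric] by simp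
  qed
  moreover have "coeff (poly P [:t:]) j = poly (map_poly (\<lambda>q. coeff q j) P) t" for P j and t :: complex
    by (induction P) (auto simp: map_poly_pCons)
  moreover have "coeff (map_poly (\<lambda>q. coeff q j) D) 1 =
      - (\<Sum>r\<in>{j<..d}. coeff (char_poly A) r * (\<Sum>i<d. (M * A ^\<^sub>m (r - j - 1)) $$ (i, i)))" for j
  proof -
    have "coeff (map_poly (\<lambda>q. coeff q j) D) 1 = coeff (coeff D 1) j" by (simp add: coeff_map_poly)
    also have "\<dots> = (\<Sum>i<d. \<Sum>k<d. coeff (Y $$ (i, k) * cofactor ?X i k) j)"
      unfolding D_def coeff_1_det_linear[OF X Y] by (simp add: coeff_sum)
    also have "\<dots> = (\<Sum>i<d. \<Sum>k<d. - (M $$ (i, k) *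
        (\<Sum>r\<in>{j<..d}. coeff (char_poly A) r * (A ^\<^sub>m (r - j - 1)) $$ (k, i))))"
      using M by (intro sum.cong refl) (simp add: Y_def adjugate_coeffs(1)[OF A])
    also have "\<dots> = - (\<Sum>i<d. \<Sum>k<d. \<Sum>r\<in>{j<..d}. coeff (char_poly A) r *
        (M $$ (i, k) * (A ^\<^sub>m (r - j - 1)) $$ (k, i)))"
      by (simp add: sum_negf sum_distrib_left mult_ac)
    also have "\<dots> = - (\<Sum>i<d. \<Sum>r\<in>{j<..d}. \<Sum>k<d. coeff (char_poly A) r *
        (M $$ (i, k) * (A ^\<^sub>m (r - j - 1)) $$ (k, i)))"
      by (subst sum.swap) simp
    also have "\<dots> = - (\<Sum>r\<in>{j<..d}. \<Sum>i<d. \<Sum>k<d. coeff (char_poly A) r *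
        (M $$ (i, k) * (A ^\<^sub>m (r - j - 1)) $$ (k, i)))"
      by (subst sum.swap) simp
    also have "\<dots> = - (\<Sum>r\<in>{j<..d}. coeff (char_poly A) r * (\<Sum>i<d. (M * A ^\<^sub>m (r - j - 1)) $$ (i, i)))"
      using mult_mat_index_sum[OF M pow_carrier_mat[OF A]] by (simp add: sum_distrib_left)
    finally show ?thesis .
  qed
  ultimately show ?thesis by (intro exI[of _ "\<lambda>j. map_poly (\<lambda>q. coeff q j) D"]) auto
qed

text \<open>Cyclicity of the trace moves \<open>B\<close> to the right end, so that, besides
  \<open>char_poly A\<close>, the derivative in the direction \<open>F\<close> sees only the Markov
  parameters.\<close>

lemma closed_loop_char_poly_on_line:
  fixes A B C F :: "complex mat"
  assumes A: "A \<in> carrier_mat d d" and B: "B \<in> carrier_mat d n" and C: "C \<in> carrier_mat n d"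
    and F: "F \<in> carrier_mat n n"
  shows "\<exists>Q. \<forall>j. (\<forall>t. coeff (char_poly (A + B * (t \<cdot>\<^sub>m F) * C)) j = poly (Q j) t) \<and>
    coeff (Q j) 1 = - (\<Sum>r\<in>{j<..d}. coeff (char_poly A) r *
      (\<Sum>i<n. (F * (C * A ^\<^sub>m (r - j - 1) * B)) $$ (i, i)))"
proof -
  have "B * (t \<cdot>\<^sub>m F) * C = t \<cdot>\<^sub>m (B * F * C)" for t
    using B C F by (simp add: mult_smult_distrib mult_smult_assoc_mat[of _ d n])
  moreover have "(\<Sum>i<d. (B * F * C * A ^\<^sub>m k) $$ (i, i)) = (\<Sum>i<n. (F * (C * A ^\<^sub>m k * B)) $$ (i, i))" for k
  proof -
    have Ak: "A ^\<^sub>m k \<in> carrier_mat d d" using A by simp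
    have "B * F * C * A ^\<^sub>m k = B * (F * C * A ^\<^sub>m k)"
      using B F C Ak by (simp add: assoc_mult_mat[of _ d n _ n _ d] assoc_mult_mat[of _ d n _ d _ d] assoc_mult_mat[of _ n n _ d _ d])
    moreover have "F * C * A ^\<^sub>m k * B = F * (C * A ^\<^sub>m k * B)"
      using B F C Ak by (simp add: assoc_mult_mat[of _ n n _ d _ d] assoc_mult_mat[of _ n n _ d _ n])
    moreover have "F * C * A ^\<^sub>m k \<in> carrier_mat n d" using F C Ak by simp
    ultimately show ?thesis using trace_mult_commute[OF B, of "F * C * A ^\<^sub>m k"] by simp
  qed
  moreover have "B * F * C \<in> carrier_mat d d" using B F C by simp
  ultimately show ?thesis using char_poly_on_line[OF A, of "B * F * C"] by simp
qed

text \<open>Cayley-Hamilton between \<open>C\<close> and \<open>A ^\<^sub>m j * B\<close>. It turns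
  a realization of size \<open>d\<close> into a monic linear recurrence of order \<open>d\<close>
  for the Markov parameters.\<close>

lemma markov_recurrence:
  fixes A B C :: "complex mat"
  assumes A: "A \<in> carrier_mat d d" and B: "B \<in> carrier_mat d n" and C: "C \<in> carrier_mat n d"
    and pq: "p < n" "q < n"
  shows "(\<Sum>r\<le>d. coeff (char_poly A) r * (C * A ^\<^sub>m (r + j) * B) $$ (p, q)) = 0"
proof -
  have entry: "(C * A ^\<^sub>m (r + j) * B) $$ (p, q) =
      (\<Sum>i<d. \<Sum>k<d. C $$ (p, i) * (A ^\<^sub>m r) $$ (i, k) * (A ^\<^sub>m j * B) $$ (k, q))" for r
  proof -
    have pow: "A ^\<^sub>m r \<in> carrier_mat d d" "A ^\<^sub>m j \<in> carrier_mat d d" using A by auto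
    have "C * A ^\<^sub>m (r + j) * B = C * (A ^\<^sub>m r * (A ^\<^sub>m j * B))"
      using pow_mat_add[OF A] assoc_mult_mat[OF C mult_carrier_mat[OF pow] B] assoc_mult_mat[OF pow B]
      by simp
    also have "\<dots> $$ (p, q) = (\<Sum>i<d. C $$ (p, i) * (A ^\<^sub>m r * (A ^\<^sub>m j * B)) $$ (i, q))"
      using A B C pq by (intro mult_mat_index_sum) auto
    also have "\<dots> = (\<Sum>i<d. C $$ (p, i) * (\<Sum>k<d. (A ^\<^sub>m r) $$ (i, k) * (A ^\<^sub>m j * B) $$ (k, q)))"
      using A B pq by (intro sum.cong refl arg_cong2[where f = "(*)"] mult_mat_index_sum) auto
    finally show ?thesis by (simp add: sum_distrib_left mult.assoc)
  qed
  have "(\<Sum>r\<le>d. coeff (char_poly A) r * (C * A ^\<^sub>m (r + j) * B) $$ (p, q)) =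
      (\<Sum>r\<le>d. \<Sum>i<d. \<Sum>k<d. C $$ (p, i) * (A ^\<^sub>m j * B) $$ (k, q) *
        (coeff (char_poly A) r * (A ^\<^sub>m r) $$ (i, k)))"
    unfolding entry by (simp add: sum_distrib_left mult_ac)
  also have "\<dots> = (\<Sum>i<d. \<Sum>k<d. C $$ (p, i) * (A ^\<^sub>m j * B) $$ (k, q) *
        (\<Sum>r\<le>d. coeff (char_poly A) r * (A ^\<^sub>m r) $$ (i, k)))"
    by (subst sum.swap, subst sum.swap) (simp add: sum_distrib_left)
  also have "\<dots> = 0" by (simp add: adjugate_coeffs(2)[OF A])
  finally show ?thesis .
qed

section \<open>Symmetric feedback\<close>

definition sym_pairs :: "nat \<Rightarrow> (nat \<times> nat) list" where
  "sym_pairs n = concat (map (\<lambda>p. map (\<lambda>q. (p, q)) [0..<Suc p]) [0..<n])"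

lemma set_sym_pairs: "set (sym_pairs n) = {(p, q). q \<le> p \<and> p < n}"
  by (auto simp: sym_pairs_def image_iff simp del: upt_Suc)

lemma length_sym_pairs: "length (sym_pairs n) = (n + 1) choose 2"
  by (induction n) (auto simp: sym_pairs_def numeral_2_eq_2)

lemma distinct_sym_pairs: "distinct (sym_pairs n)"
proof (induction n)
  case (Suc n)
  have "sym_pairs (Suc n) = sym_pairs n @ map (\<lambda>q. (n, q)) [0..<Suc n]" by (simp add: sym_pairs_def)
  moreover have "distinct (map (\<lambda>q. (n, q)) [0..<Suc n])"
    by (simp add: distinct_map inj_on_def del: upt_Suc)
  moreover have "set (sym_pairs n) \<inter> set (map (\<lambda>q. (n, q)) [0..<Suc n]) = {}"
    by (auto simp: set_sym_pairs)
  ultimately show ?case using Suc by (simp only: distinct_append)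
qed (simp add: sym_pairs_def)

lemma nth_sym_pairs:
  assumes "l < (n + 1) choose 2"
  obtains p q where "sym_pairs n ! l = (p, q)" "q \<le> p" "p < n"
proof -
  have "sym_pairs n ! l \<in> set (sym_pairs n)" using assms by (intro nth_mem) (simp only: length_sym_pairs)
  then show ?thesis using that by (auto simp: set_sym_pairs)
qed

definition sym_index :: "nat \<Rightarrow> nat \<times> nat \<Rightarrow> nat" where
  "sym_index n x = (THE l. l < (n + 1) choose 2 \<and> sym_pairs n ! l = x)"

lemma sym_index:
  assumes "q \<le> p" "p < n"
  shows "sym_index n (p, q) < (n + 1) choose 2" "sym_pairs n ! sym_index n (p, q) = (p, q)"
proof -
  have "(p, q) \<in> set (sym_pairs n)" using assms by (simp add: set_sym_pairs)
  then have "\<exists>!l. l < (n + 1) choose 2 \<and> sym_pairs n ! l = (p, q)"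
    using distinct_Ex1[OF distinct_sym_pairs] by (simp only: length_sym_pairs)
  from theI'[OF this] show "sym_index n (p, q) < (n + 1) choose 2"
    "sym_pairs n ! sym_index n (p, q) = (p, q)" by (auto simp: sym_index_def)
qed

definition sym_mat :: "nat \<Rightarrow> complex list \<Rightarrow> complex mat" where
  "sym_mat n xs = mat n n (\<lambda>(i, j). xs ! sym_index n (max i j, min i j))"

lemma sym_mat_carrier: "sym_mat n xs \<in> carrier_mat n n"
  by (simp add: sym_mat_def)

lemma sym_mat_Sym: "sym_mat n xs \<in> Sym n"
  by (auto simp: Sym_def sym_mat_def max.commute min.commute intro!: eq_matI)

lemma poly_mat_sym_mat: "poly_mat ((n + 1) choose 2) n n (sym_mat n)"
  unfolding poly_mat_def sym_mat_def using sym_index(1)[of "min _ _" "max _ _" n]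
  by (auto intro!: pf_var)

lemma Sym_eq_sym_mat:
  assumes "F \<in> Sym n"
  obtains xs where "length xs = (n + 1) choose 2" "F = sym_mat n xs"
proof
  let ?xs = "map (\<lambda>l. F $$ (sym_pairs n ! l)) [0..<(n + 1) choose 2]"
  show "length ?xs = (n + 1) choose 2" by simp
  have F: "F \<in> carrier_mat n n" "F\<^sup>T = F" using assms by (auto simp: Sym_def)
  have F_sym: "F $$ (j, i) = F $$ (i, j)" if "i < n" "j < n" for i j
    using arg_cong[OF F(2), of "\<lambda>M. M $$ (i, j)"] F(1) that by simp
  show "F = sym_mat n ?xs"
  proof (rule eq_matI)
    fix i j assume "i < dim_row (sym_mat n ?xs)" "j < dim_col (sym_mat n ?xs)"
    then have ij: "i < n" "j < n" by (auto simp: sym_mat_def)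
    then have "sym_mat n ?xs $$ (i, j) = F $$ (max i j, min i j)"
      using sym_index[of "min i j" "max i j" n] by (simp add: sym_mat_def)
    also have "\<dots> = F $$ (i, j)" using F_sym[OF ij] by (auto simp: max_def min_def)
    finally show "F $$ (i, j) = sym_mat n ?xs $$ (i, j)" ..
  qed (use F in \<open>auto simp: sym_mat_def\<close>)
qed

lemma sym_mat_scale:
  assumes "length xs = (n + 1) choose 2"
  shows "sym_mat n (map (\<lambda>x. t * x) xs) = t \<cdot>\<^sub>m sym_mat n xs"
proof (rule eq_matI)
  fix i j assume "i < dim_row (t \<cdot>\<^sub>m sym_mat n xs)" "j < dim_col (t \<cdot>\<^sub>m sym_mat n xs)"
  then have ij: "i < n" "j < n" by (auto simp: sym_mat_def)
  then have "sym_index n (max i j, min i j) < length xs" unfolding assms by (intro sym_index) auto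
  with ij show "sym_mat n (map (\<lambda>x. t * x) xs) $$ (i, j) = (t \<cdot>\<^sub>m sym_mat n xs) $$ (i, j)"
    by (simp add: sym_mat_def)
qed (auto simp: sym_mat_def)

lemma poly_mat_closed_loop:
  assumes "A \<in> carrier_mat d d" "B \<in> carrier_mat d n" "C \<in> carrier_mat n d"
  shows "poly_mat ((n + 1) choose 2) d d (\<lambda>xs. A + B * sym_mat n xs * C)"
  using assms poly_mat_sym_mat by (intro poly_mat_add poly_mat_mult poly_mat_const)

lemma coeff_monic_of:
  "coeff (monic_of d xs) i = (if i < d then xs ! i else if i = d then 1 else 0)"
  by (simp add: monic_of_def coeff_sum)

lemma coeff_even_monic_of:
  "coeff (even_monic_of d xs) i =
     (if i = d then 1 else 0) + (if even i \<and> i div 2 < d div 2 then xs ! (i div 2) else 0)"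
proof -
  have "(\<Sum>k<d div 2. coeff (monom (xs ! k) (2 * k)) i) =
      (\<Sum>k<d div 2. if k = i div 2 then (if even i then xs ! k else 0) else 0)"
    by (intro sum.cong) auto
  then show ?thesis by (simp add: even_monic_of_def coeff_sum)
qed

lemma not_contains_open_monic:
  assumes abc: "A \<in> carrier_mat d d" "B \<in> carrier_mat d n" "C \<in> carrier_mat n d"
    and d: "(n + 1) choose 2 < d" and Fs: "Fs \<subseteq> Sym n"
  shows "\<not> contains_open_monic d (closed_loop_polys A B C Fs)"
proof
  let ?f = "\<lambda>j xs. coeff (char_poly (A + B * sym_mat n xs * C)) j"
  assume "contains_open_monic d (closed_loop_polys A B C Fs)"
  then obtain V where V: "zariski_open d V" "V \<noteq> {}" "monic_of d ` V \<subseteq> closed_loop_polys A B C Fs"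
    by (auto simp: contains_open_monic_def)
  have "V \<subseteq> (\<lambda>xs. map (\<lambda>j. ?f j xs) [0..<d]) ` affine_space ((n + 1) choose 2)"
  proof
    fix ys assume "ys \<in> V"
    then have "length ys = d" using V(1) by (auto simp: zariski_open_def affine_space_def)
    have "monic_of d ys \<in> closed_loop_polys A B C Fs" using V(3) \<open>ys \<in> V\<close> by blast
    then obtain F where F: "F \<in> Sym n" "monic_of d ys = char_poly (A + B * F * C)"
      using Fs by (auto simp: closed_loop_polys_def)
    obtain xs where xs: "length xs = (n + 1) choose 2" "F = sym_mat n xs" by (rule Sym_eq_sym_mat[OF F(1)])
    have "ys ! j = ?f j xs" if "j < d" for j
      using arg_cong[OF F(2), of "\<lambda>p. coeff p j"] that xs(2) by (simp add: coeff_monic_of)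
    then have "ys = map (\<lambda>j. ?f j xs) [0..<d]"
      using \<open>length ys = d\<close> by (intro nth_equalityI) auto
    then show "ys \<in> (\<lambda>xs. map (\<lambda>j. ?f j xs) [0..<d]) ` affine_space ((n + 1) choose 2)"
      using xs(1) by (auto simp: affine_space_def)
  qed
  moreover have "?f j \<in> poly_fun ((n + 1) choose 2)" for j
    by (rule poly_fun_char_poly_coeff[OF poly_mat_closed_loop[OF abc]])
  ultimately show False using image_contains_no_open[of d ?f, OF _ d V(1,2)] by blast
qed

text \<open>The even coefficients alone already recover the point of \<open>V\<close>, so
  \<open>d div 2\<close> coordinates depend on only \<open>(n + 1) choose 2\<close>
  parameters.\<close>

lemma not_contains_open_even_monic:
  assumes abc: "A \<in> carrier_mat d d" "B \<in> carrier_mat d n" "C \<in> carrier_mat n d"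
    and d: "(n + 1) choose 2 < d div 2" and Fs: "Fs \<subseteq> Sym n"
  shows "\<not> contains_open_even_monic d (closed_loop_polys A B C Fs)"
proof
  let ?f = "\<lambda>j xs. coeff (char_poly (A + B * sym_mat n xs * C)) (2 * j)"
  assume "contains_open_even_monic d (closed_loop_polys A B C Fs)"
  then obtain V where V: "zariski_open (d div 2) V" "V \<noteq> {}"
    "even_monic_of d ` V \<subseteq> closed_loop_polys A B C Fs"
    by (auto simp: contains_open_even_monic_def)
  have "V \<subseteq> (\<lambda>xs. map (\<lambda>j. ?f j xs) [0..<d div 2]) ` affine_space ((n + 1) choose 2)"
  proof
    fix ys assume "ys \<in> V"
    then have "length ys = d div 2" using V(1) by (auto simp: zariski_open_def affine_space_def)
    have "even_monic_of d ys \<in> closed_loop_polys A B C Fs" using V(3) \<open>ys \<in> V\<close> by blast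
    then obtain F where F: "F \<in> Sym n" "even_monic_of d ys = char_poly (A + B * F * C)"
      using Fs by (auto simp: closed_loop_polys_def)
    obtain xs where xs: "length xs = (n + 1) choose 2" "F = sym_mat n xs" by (rule Sym_eq_sym_mat[OF F(1)])
    have "ys ! j = ?f j xs" if "j < d div 2" for j
    proof -
      have "2 * j \<noteq> d" using that by auto
      then show ?thesis using arg_cong[OF F(2), of "\<lambda>p. coeff p (2 * j)"] that xs(2)
        by (simp add: coeff_even_monic_of)
    qed
    then have "ys = map (\<lambda>j. ?f j xs) [0..<d div 2]"
      using \<open>length ys = d div 2\<close> by (intro nth_equalityI) auto
    then show "ys \<in> (\<lambda>xs. map (\<lambda>j. ?f j xs) [0..<d div 2]) ` affine_space ((n + 1) choose 2)"
      using xs(1) by (auto simp: affine_space_def)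
  qed
  moreover have "?f j \<in> poly_fun ((n + 1) choose 2)" for j
    by (rule poly_fun_char_poly_coeff[OF poly_mat_closed_loop[OF abc]])
  ultimately show False using image_contains_no_open[of "d div 2" ?f, OF _ d V(1,2)] by blast
qed

section \<open>Symmetric matrices with prescribed traces\<close>

lemma det_neq_0_iff_rows_independent:
  fixes g :: "nat \<Rightarrow> nat \<Rightarrow> 'a :: field"
  shows "det (mat m m (\<lambda>(k, l). g k l)) \<noteq> 0 \<longleftrightarrow>
    (\<forall>c. (\<forall>l<m. (\<Sum>k<m. c k * g k l) = 0) \<longrightarrow> (\<forall>k<m. c k = 0))"
proof -
  let ?W = "mat m m (\<lambda>(k, l). g k l)" and ?V = "mat m m (\<lambda>(l, k). g k l)"
  have "?V = ?W\<^sup>T" by (intro eq_matI) auto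
  then have "det ?W = det ?V" using det_transpose[of ?W m] by simp
  have entry: "(?V *\<^sub>v v) $ l = (\<Sum>k<m. v $ k * g k l)" if "v \<in> carrier_vec m" "l < m" for v l
    using that by (auto simp: scalar_prod_def atLeast0LessThan mult.commute intro!: sum.cong)
  have "det ?V = 0 \<longleftrightarrow> (\<exists>v. v \<in> carrier_vec m \<and> v \<noteq> 0\<^sub>v m \<and> ?V *\<^sub>v v = 0\<^sub>v m)"
    by (rule det_0_iff_vec_prod_zero) simp
  also have "\<dots> \<longleftrightarrow> (\<exists>c. (\<forall>l<m. (\<Sum>k<m. c k * g k l) = 0) \<and> (\<exists>k<m. c k \<noteq> 0))"
  proof
    assume "\<exists>v. v \<in> carrier_vec m \<and> v \<noteq> 0\<^sub>v m \<and> ?V *\<^sub>v v = 0\<^sub>v m"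
    then obtain v where v: "v \<in> carrier_vec m" "v \<noteq> 0\<^sub>v m" "?V *\<^sub>v v = 0\<^sub>v m" by blast
    have "\<exists>k<m. v $ k \<noteq> 0" using v(1,2) by (auto simp: vec_eq_iff)
    moreover have "(\<Sum>k<m. v $ k * g k l) = 0" if "l < m" for l
      using entry[OF v(1) that] v(3) that by simp
    ultimately show "\<exists>c. (\<forall>l<m. (\<Sum>k<m. c k * g k l) = 0) \<and> (\<exists>k<m. c k \<noteq> 0)"
      by (intro exI[of _ "\<lambda>k. v $ k"]) auto
  next
    assume "\<exists>c. (\<forall>l<m. (\<Sum>k<m. c k * g k l) = 0) \<and> (\<exists>k<m. c k \<noteq> 0)"
    then obtain c k where c: "\<And>l. l < m \<Longrightarrow> (\<Sum>k<m. c k * g k l) = 0" "k < m" "c k \<noteq> 0" by blast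
    have "?V *\<^sub>v vec m c = 0\<^sub>v m"
    proof (rule eq_vecI)
      fix l assume "l < dim_vec (0\<^sub>v m)"
      then have "l < m" by simp
      from entry[OF vec_carrier this] c(1)[OF this] \<open>l < m\<close>
      show "(?V *\<^sub>v vec m c) $ l = 0\<^sub>v m $ l" by simp
    qed simp
    moreover have "vec m c \<noteq> 0\<^sub>v m" using c(2,3) by (metis index_vec index_zero_vec(1))
    ultimately show "\<exists>v. v \<in> carrier_vec m \<and> v \<noteq> 0\<^sub>v m \<and> ?V *\<^sub>v v = 0\<^sub>v m"
      by (intro exI[of _ "vec m c"]) auto
  qed
  finally show ?thesis unfolding \<open>det ?W = det ?V\<close> by blast
qed

text \<open>Cramer's rule in adjugate form.\<close>

lemma linear_system_solvable:
  fixes g :: "nat \<Rightarrow> nat \<Rightarrow> 'a :: field"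
  assumes "det (mat m m (\<lambda>(k, l). g k l)) \<noteq> 0"
  shows "\<exists>h. \<forall>k<m. (\<Sum>l<m. h l * g k l) = z k"
proof -
  let ?W = "mat m m (\<lambda>(k, l). g k l)"
  have W: "?W \<in> carrier_mat m m" by simp
  define h where "h l = (\<Sum>j<m. adj_mat ?W $$ (l, j) * z j) / det ?W" for l
  have "(\<Sum>l<m. h l * g k l) = z k" if k: "k < m" for k
  proof -
    have "(\<Sum>l<m. h l * g k l) = (\<Sum>l<m. \<Sum>j<m. ?W $$ (k, l) * adj_mat ?W $$ (l, j) * z j) / det ?W"
      using k by (simp add: h_def sum_divide_distrib sum_distrib_left sum_distrib_right mult_ac)
    also have "\<dots> = (\<Sum>j<m. (\<Sum>l<m. ?W $$ (k, l) * adj_mat ?W $$ (l, j)) * z j) / det ?W"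
      by (subst sum.swap) (simp add: sum_distrib_right)
    also have "(\<Sum>j<m. (\<Sum>l<m. ?W $$ (k, l) * adj_mat ?W $$ (l, j)) * z j) =
        (\<Sum>j<m. (if k = j then det ?W else 0) * z j)"
    proof (rule sum.cong[OF refl])
      fix j assume "j \<in> {..<m}"
      then have "(\<Sum>l<m. ?W $$ (k, l) * adj_mat ?W $$ (l, j)) = (?W * adj_mat ?W) $$ (k, j)"
        using mult_mat_index_sum[OF W adj_mat(1)[OF W] k, of j] by simp
      also have "\<dots> = (if k = j then det ?W else 0)"
        unfolding adj_mat(2)[OF W] using k \<open>j \<in> {..<m}\<close> by simp
      finally show "(\<Sum>l<m. ?W $$ (k, l) * adj_mat ?W $$ (l, j)) * z j =
          (if k = j then det ?W else 0) * z j" by simp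
    qed
    also have "\<dots> = (\<Sum>j<m. if k = j then det ?W * z j else 0)" by (intro sum.cong) auto
    also have "\<dots> / det ?W = z k" using k assms by simp
    finally show ?thesis .
  qed
  then show ?thesis by blast
qed

text \<open>Read from \<open>j = m - 1\<close> downward, equation \<open>j\<close> brings in one new
  unknown, \<open>z (m - j - 1)\<close>, with coefficient \<open>\<chi> m = 1\<close>; the induction
  parameter \<open>K\<close> counts the equations already solved.\<close>

lemma triangular_system_solvable:
  fixes \<chi> y :: "nat \<Rightarrow> 'a :: comm_ring_1"
  assumes "\<chi> m = 1"
  shows "\<exists>z. \<forall>j<m. (\<Sum>r\<in>{j<..m}. \<chi> r * z (r - j - 1)) = y j"
proof -
  have "\<exists>z. \<forall>j<m. m - 1 - j < K \<longrightarrow> (\<Sum>r\<in>{j<..m}. \<chi> r * z (r - j - 1)) = y j" for K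
  proof (induction K)
    case (Suc K)
    then obtain z where z: "\<And>j. j < m \<Longrightarrow> m - 1 - j < K \<Longrightarrow> (\<Sum>r\<in>{j<..m}. \<chi> r * z (r - j - 1)) = y j"
      by blast
    let ?j = "m - 1 - K"
    define z' where "z' = z(K := y ?j - (\<Sum>r\<in>{?j<..<m}. \<chi> r * z (r - ?j - 1)))"
    have "(\<Sum>r\<in>{j<..m}. \<chi> r * z' (r - j - 1)) = y j" if j: "j < m" "m - 1 - j < Suc K" for j
    proof (cases "m - 1 - j < K")
      case True
      then have "(\<Sum>r\<in>{j<..m}. \<chi> r * z' (r - j - 1)) = (\<Sum>r\<in>{j<..m}. \<chi> r * z (r - j - 1))"
        by (intro sum.cong) (auto simp: z'_def)
      then show ?thesis using z[OF j(1) True] by simp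
    next
      case False
      then have K: "K = m - 1 - j" and K': "?j = j" using j by auto
      have "{j<..m} = insert m {j<..<m}" using j by auto
      then have "(\<Sum>r\<in>{j<..m}. \<chi> r * z' (r - j - 1)) = z' K + (\<Sum>r\<in>{j<..<m}. \<chi> r * z' (r - j - 1))"
        using assms K by (simp add: diff_right_commute)
      also have "(\<Sum>r\<in>{j<..<m}. \<chi> r * z' (r - j - 1)) = (\<Sum>r\<in>{j<..<m}. \<chi> r * z (r - j - 1))"
        using K by (intro sum.cong) (auto simp: z'_def)
      also have "z' K = y j - (\<Sum>r\<in>{j<..<m}. \<chi> r * z (r - j - 1))" unfolding z'_def K' by simp
      finally show ?thesis by simp
    qed
    then show ?case by blast
  qed simp
  from this[of m] show ?thesis by auto
qed

lemma trace_mult_sum: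
  fixes F M :: "'a :: comm_semiring_0 mat"
  assumes "F \<in> carrier_mat n n" "M \<in> carrier_mat n n"
  shows "(\<Sum>i<n. (F * M) $$ (i, i)) = (\<Sum>i<n. \<Sum>j<n. F $$ (i, j) * M $$ (j, i))"
  using mult_mat_index_sum[OF assms] by simp

lemma sym_trace_solvable:
  fixes M :: "nat \<Rightarrow> complex mat"
  assumes m: "m \<le> (n + 1) choose 2"
    and M: "\<And>k. k < m \<Longrightarrow> M k \<in> carrier_mat n n \<and> (M k)\<^sup>T = M k"
    and det: "det (mat m m (\<lambda>(k, l). M k $$ (sym_pairs n ! l))) \<noteq> 0"
  shows "\<exists>F \<in> Sym n. \<forall>k<m. (\<Sum>i<n. (F * M k) $$ (i, i)) = z k"
proof -
  \<comment> \<open>Half of \<open>z\<close>, because \<open>F\<close> will be a matrix supported on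
    the lower triangle plus its transpose, and against the symmetric \<open>M k\<close> both
    summands contribute equally, on the diagonal as well.\<close>
  obtain h where h: "\<And>k. k < m \<Longrightarrow> (\<Sum>l<m. h l * M k $$ (sym_pairs n ! l)) = z k / 2"
    using linear_system_solvable[OF det, of "\<lambda>k. z k / 2"] by blast
  define e where "e l i j = (if (i, j) = sym_pairs n ! l then h l else 0)" for l i j
  define F where "F = mat n n (\<lambda>(i, j). \<Sum>l<m. e l i j + e l j i)"
  have F: "F \<in> carrier_mat n n" by (simp add: F_def)
  have "F \<in> Sym n" by (auto simp: Sym_def F_def add.commute intro!: eq_matI)
  moreover have "(\<Sum>i<n. (F * M k) $$ (i, i)) = z k" if k: "k < m" for k
  proof -
    have Mk: "M k \<in> carrier_mat n n" "(M k)\<^sup>T = M k" using M[OF k] by auto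
    have M_sym: "M k $$ (j, i) = M k $$ (i, j)" if "i < n" "j < n" for i j
      using arg_cong[OF Mk(2), of "\<lambda>M. M $$ (i, j)"] Mk(1) that by simp
    have e: "(\<Sum>i<n. \<Sum>j<n. e l i j * M k $$ (i, j)) = h l * M k $$ (sym_pairs n ! l)" if "l < m" for l
    proof -
      from that m have "l < (n + 1) choose 2" by simp
      then obtain p q where pq: "sym_pairs n ! l = (p, q)" "q \<le> p" "p < n" by (rule nth_sym_pairs)
      have "(\<Sum>i<n. \<Sum>j<n. e l i j * M k $$ (i, j)) =
          (\<Sum>i<n. if i = p then (\<Sum>j<n. if j = q then h l * M k $$ (i, j) else 0) else 0)"
        by (intro sum.cong refl) (auto simp: e_def pq if_distrib[of "\<lambda>x. x * _"] cong: if_cong)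
      then show ?thesis using pq by simp
    qed
    have "(\<Sum>i<n. (F * M k) $$ (i, i)) =
        (\<Sum>i<n. \<Sum>j<n. \<Sum>l<m. e l i j * M k $$ (i, j) + e l j i * M k $$ (j, i))"
      unfolding trace_mult_sum[OF F Mk(1)] using M_sym
      by (intro sum.cong refl) (simp add: F_def sum_distrib_right distrib_right)
    also have "\<dots> = (\<Sum>i<n. \<Sum>l<m. \<Sum>j<n. e l i j * M k $$ (i, j) + e l j i * M k $$ (j, i))"
      by (intro sum.cong refl sum.swap)
    also have "\<dots> = (\<Sum>l<m. \<Sum>i<n. \<Sum>j<n. e l i j * M k $$ (i, j) + e l j i * M k $$ (j, i))"
      by (rule sum.swap)
    also have "\<dots> = (\<Sum>l<m. h l * M k $$ (sym_pairs n ! l) + (\<Sum>i<n. \<Sum>j<n. e l j i * M k $$ (j, i)))"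
      by (intro sum.cong refl) (simp add: sum.distrib e)
    also have "\<dots> = (\<Sum>l<m. 2 * (h l * M k $$ (sym_pairs n ! l)))"
    proof (intro sum.cong refl)
      fix l assume "l \<in> {..<m}"
      moreover have "(\<Sum>i<n. \<Sum>j<n. e l j i * M k $$ (j, i)) = (\<Sum>i<n. \<Sum>j<n. e l i j * M k $$ (i, j))"
        by (rule sum.swap)
      ultimately show "h l * M k $$ (sym_pairs n ! l) + (\<Sum>i<n. \<Sum>j<n. e l j i * M k $$ (j, i)) =
          2 * (h l * M k $$ (sym_pairs n ! l))" using e by simp
    qed
    also have "\<dots> = z k" using h[OF k] by (simp add: sum_distrib_left[symmetric] mult.commute)
    finally show ?thesis .
  qed
  ultimately show ?thesis by blast
qed

text \<open>Transposition replaces the trace by its negative. In the Hamiltonian case this removes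
  the even-indexed Markov parameters, which are skew-symmetric.\<close>

lemma trace_sym_skew:
  fixes F M :: "complex mat"
  assumes F: "F \<in> Sym n" and M: "M \<in> carrier_mat n n" "M = - (M\<^sup>T)"
  shows "(\<Sum>i<n. (F * M) $$ (i, i)) = 0"
proof -
  have F': "F \<in> carrier_mat n n" "F\<^sup>T = F" using F by (auto simp: Sym_def)
  have F_sym: "F $$ (j, i) = F $$ (i, j)" if "i < n" "j < n" for i j
    using arg_cong[OF F'(2), of "\<lambda>M. M $$ (i, j)"] F'(1) that by simp
  have M_skew: "M $$ (j, i) = - M $$ (i, j)" if "i < n" "j < n" for i j
    using arg_cong[OF M(2), of "\<lambda>M. M $$ (j, i)"] M(1) that by simp
  have "(\<Sum>i<n. (F * M) $$ (i, i)) = (\<Sum>i<n. \<Sum>j<n. F $$ (j, i) * - M $$ (i, j))"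
    unfolding trace_mult_sum[OF F'(1) M(1)] by (intro sum.cong refl arg_cong2[where f = "(*)"] F_sym M_skew) auto
  also have "\<dots> = - (\<Sum>i<n. \<Sum>j<n. F $$ (j, i) * M $$ (i, j))" by (simp add: sum_negf)
  also have "(\<Sum>i<n. \<Sum>j<n. F $$ (j, i) * M $$ (i, j)) = (\<Sum>i<n. (F * M) $$ (i, i))"
    unfolding trace_mult_sum[OF F'(1) M(1)] by (rule sum.swap)
  finally show ?thesis by simp
qed

section \<open>Generic systems\<close>

lemma sym_pair_bounds:
  assumes "l < m" "m \<le> (n + 1) choose 2"
  shows "snd (sym_pairs n ! l) \<le> fst (sym_pairs n ! l)"
    "fst (sym_pairs n ! l) < n" "snd (sym_pairs n ! l) < n"
proof -
  have "l < (n + 1) choose 2" using assms by simp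
  then obtain p q where "sym_pairs n ! l = (p, q)" "q \<le> p" "p < n" by (rule nth_sym_pairs)
  then show "snd (sym_pairs n ! l) \<le> fst (sym_pairs n ! l)"
    "fst (sym_pairs n ! l) < n" "snd (sym_pairs n ! l) < n" by auto
qed

section \<open>Markov parameters as coordinates\<close>

lemma concat_map_uniform:
  assumes "\<And>k. k < m \<Longrightarrow> length (f k) = c"
  shows "length (concat (map f [0..<m])) = m * c"
    and "k < m \<Longrightarrow> r < c \<Longrightarrow> concat (map f [0..<m]) ! (k * c + r) = f k ! r"
  using assms
proof (induction m)
  case (Suc m)
  { case 1 then show ?case using Suc(1) by simp }
  { case 2
    have len: "length (concat (map f [0..<m])) = m * c" using 2 by (intro Suc(1)) simp
    show ?case
    proof (cases "k = m")
      case True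
      then show ?thesis using len by (simp add: nth_append)
    next
      case False
      with 2 have "k < m" by simp
      then have "k * c + r < m * c"
        using 2 mult_le_mono1[of "Suc k" m c] by (simp add: Suc_le_eq)
      with 2 \<open>k < m\<close> show ?thesis using len Suc(2) by (simp add: nth_append)
    qed }
qed simp_all

lemma length_markov_coords: "length (markov_coords d n G) = 2 * d * n * n"
proof -
  have "length (concat (map (\<lambda>i. map (\<lambda>j. G k $$ (i, j)) [0..<n]) [0..<n])) = n * n" for k
    by (rule concat_map_uniform(1)) simp
  then have "length (markov_coords d n G) = 2 * d * (n * n)"
    unfolding markov_coords_def by (rule concat_map_uniform(1))
  then show ?thesis by simp
qed

lemma nth_markov_coords:
  assumes "k < 2 * d" "i < n" "j < n"
  shows "markov_coords d n G ! (k * (n * n) + (i * n + j)) = G k $$ (i, j)"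
    and "k * (n * n) + (i * n + j) < 2 * d * n * n"
proof -
  have len: "length (concat (map (\<lambda>i. map (\<lambda>j. G k $$ (i, j)) [0..<n]) [0..<n])) = n * n" for k
    by (rule concat_map_uniform(1)) simp
  have ij: "i * n + j < n * n"
    using assms mult_le_mono1[of "Suc i" n n] by (simp add: Suc_le_eq)
  have "markov_coords d n G ! (k * (n * n) + (i * n + j)) =
      concat (map (\<lambda>i. map (\<lambda>j. G k $$ (i, j)) [0..<n]) [0..<n]) ! (i * n + j)"
    unfolding markov_coords_def by (rule concat_map_uniform(2)[OF len assms(1) ij])
  also have "\<dots> = map (\<lambda>j. G k $$ (i, j)) [0..<n] ! j"
    by (rule concat_map_uniform(2)) (use assms in auto)
  finally show "markov_coords d n G ! (k * (n * n) + (i * n + j)) = G k $$ (i, j)" using assms by simp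
  have "k * (n * n) + n * n \<le> 2 * d * (n * n)"
    using mult_le_mono1[of "Suc k" "2 * d" "n * n"] assms by (simp add: add.commute)
  with ij show "k * (n * n) + (i * n + j) < 2 * d * n * n" by (simp add: mult.assoc)
qed

text \<open>\<open>\<kappa>\<close> selects the Markov parameters forming the rows: the first
  \<open>d\<close> of them in the symmetric case, the odd-indexed ones below \<open>d\<close> in the
  Hamiltonian case. The bound \<open>2 * d\<close> places them among the coordinates of the
  embedding.\<close>

lemma rat_zariski_open_markov_minor:
  assumes \<kappa>: "\<And>k. k < m \<Longrightarrow> \<kappa> k < 2 * d" and m: "m \<le> (n + 1) choose 2"
  shows "rat_zariski_open d n X
    {G \<in> X. det (mat m m (\<lambda>(k, l). G (\<kappa> k) $$ (sym_pairs n ! l))) \<noteq> 0}"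
proof -
  let ?i = "\<lambda>k l. \<kappa> k * (n * n) + (fst (sym_pairs n ! l) * n + snd (sym_pairs n ! l))"
  let ?p = "\<lambda>xs :: complex list. det (mat m m (\<lambda>(k, l). xs ! ?i k l))"
  note pair = sym_pair_bounds(2,3)[OF _ m]
  have "?p \<in> poly_fun (2 * d * n * n)"
    using nth_markov_coords(2)[OF \<kappa> pair] by (intro poly_fun_det) (auto intro!: pf_var)
  then have "zariski_open (2 * d * n * n) {xs \<in> affine_space (2 * d * n * n). ?p xs \<noteq> 0}"
    by (rule zariski_open_nonvanishing)
  moreover have "?p (markov_coords d n G) = det (mat m m (\<lambda>(k, l). G (\<kappa> k) $$ (sym_pairs n ! l)))" for G
    using nth_markov_coords(1)[OF \<kappa> pair] by (intro arg_cong[where f = det] eq_matI) auto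
  ultimately show ?thesis unfolding rat_zariski_open_def
    by (intro exI[of _ "{xs \<in> affine_space (2 * d * n * n). ?p xs \<noteq> 0}"])
      (auto simp: affine_space_def length_markov_coords)
qed

section \<open>Explicit systems in the open sets\<close>

definition rank1_row :: "nat \<Rightarrow> nat \<Rightarrow> nat \<Rightarrow> complex" where
  "rank1_row n i p = (if p = fst (sym_pairs n ! i) \<or> p = snd (sym_pairs n ! i) then 1 else 0)"

definition rank1_entry :: "nat \<Rightarrow> nat \<Rightarrow> nat \<times> nat \<Rightarrow> complex" where
  "rank1_entry n i = (\<lambda>(p, q). rank1_row n i p * rank1_row n i q)"

text \<open>With \<open>b\<^sub>i\<close> the indicator vector of the \<open>i\<close>-th pair, the off-diagonal entries of the
  matrices \<open>b\<^sub>i b\<^sub>i\<^sup>T\<close> separate the off-diagonal pairs, and then the diagonal entries the rest.\<close>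

lemma rank1_independent:
  assumes m: "m \<le> (n + 1) choose 2"
    and zero: "\<And>l. l < m \<Longrightarrow> (\<Sum>i<m. c i * rank1_entry n i (sym_pairs n ! l)) = 0"
    and "l < m"
  shows "c l = 0"
proof -
  have pair: "\<exists>p q. sym_pairs n ! i = (p, q) \<and> q \<le> p" if "i < m" for i
    using sym_pair_bounds(1)[OF that m] by (metis prod.collapse)
  have inj: "sym_pairs n ! i = sym_pairs n ! j \<longleftrightarrow> i = j" if "i < m" "j < m" for i j
    using that m distinct_sym_pairs[of n] length_sym_pairs[of n] by (simp add: nth_eq_iff_index_eq)
  have off: "c l = 0" if l: "l < m" "fst (sym_pairs n ! l) \<noteq> snd (sym_pairs n ! l)" for l
  proof -
    have "(\<Sum>i<m. c i * rank1_entry n i (sym_pairs n ! l)) = (\<Sum>i<m. if i = l then c i else 0)"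
    proof (rule sum.cong[OF refl])
      fix i assume "i \<in> {..<m}"
      then have "i < m" by simp
      from pair[OF this] pair[OF l(1)] inj[OF \<open>i < m\<close> l(1)] l(2)
      show "c i * rank1_entry n i (sym_pairs n ! l) = (if i = l then c i else 0)"
        by (auto simp: rank1_entry_def rank1_row_def split: if_splits)
    qed
    then show ?thesis using zero[OF l(1)] l(1) by simp
  qed
  show ?thesis
  proof (cases "fst (sym_pairs n ! l) = snd (sym_pairs n ! l)")
    case False
    with off \<open>l < m\<close> show ?thesis by blast
  next
    case True
    have "(\<Sum>i<m. c i * rank1_entry n i (sym_pairs n ! l)) = (\<Sum>i<m. if i = l then c i else 0)"
    proof (rule sum.cong[OF refl])
      fix i assume "i \<in> {..<m}"
      then have "i < m" by simp
      from pair[OF this] pair[OF \<open>l < m\<close>] inj[OF \<open>i < m\<close> \<open>l < m\<close>] True off[OF \<open>i < m\<close>]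
      show "c i * rank1_entry n i (sym_pairs n ! l) = (if i = l then c i else 0)"
        by (cases "fst (sym_pairs n ! i) = snd (sym_pairs n ! i)")
          (auto simp: rank1_entry_def rank1_row_def split: if_splits)
    qed
    then show ?thesis using zero[OF \<open>l < m\<close>] \<open>l < m\<close> by simp
  qed
qed

text \<open>The matrix factors into a Vandermonde matrix in \<open>\<mu>\<close>, the diagonal
  matrix of \<open>w\<close> and the matrix of \<open>rank1_independent\<close>. In terms of rows: a
  relation gives a polynomial of degree below \<open>m\<close> that vanishes at all \<open>m\<close>
  points \<open>\<mu> i\<close>.\<close>

lemma rank1_sum_minor_neq_0:
  assumes m: "m \<le> (n + 1) choose 2" and inj: "inj_on \<mu> {..<m}" and w: "\<And>i. i < m \<Longrightarrow> w i \<noteq> 0"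
  shows "det (mat m m (\<lambda>(k, l). \<Sum>i<m. w i * \<mu> i ^ k * rank1_entry n i (sym_pairs n ! l))) \<noteq> 0"
  unfolding det_neq_0_iff_rows_independent
proof (intro allI impI)
  fix c k assume c: "\<forall>l<m. (\<Sum>k<m. c k * (\<Sum>i<m. w i * \<mu> i ^ k * rank1_entry n i (sym_pairs n ! l))) = 0"
    and "k < m"
  define a where "a = (\<Sum>k<m. monom (c k) k)"
  have a: "poly a x = (\<Sum>k<m. c k * x ^ k)" for x by (simp add: a_def poly_sum poly_monom)
  have "poly a (\<mu> i) = 0" if i: "i < m" for i
  proof -
    have "poly a (\<mu> i) * w i = 0"
    proof (rule rank1_independent[OF m _ i, where c = "\<lambda>i. poly a (\<mu> i) * w i"])
      fix l assume "l < m"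
      have "(\<Sum>i<m. poly a (\<mu> i) * w i * rank1_entry n i (sym_pairs n ! l)) =
          (\<Sum>i<m. \<Sum>k<m. c k * (w i * \<mu> i ^ k * rank1_entry n i (sym_pairs n ! l)))"
        by (simp add: a sum_distrib_right sum_distrib_left mult_ac)
      also have "\<dots> = (\<Sum>k<m. c k * (\<Sum>i<m. w i * \<mu> i ^ k * rank1_entry n i (sym_pairs n ! l)))"
        by (subst sum.swap) (simp add: sum_distrib_left)
      finally show "(\<Sum>i<m. poly a (\<mu> i) * w i * rank1_entry n i (sym_pairs n ! l)) = 0"
        using c \<open>l < m\<close> by simp
    qed
    then show ?thesis using w[OF i] by simp
  qed
  then have roots: "\<mu> ` {..<m} \<subseteq> {x. poly a x = 0}" by auto
  have coeff: "coeff a k = (if k < m then c k else 0)" for k by (simp add: a_def coeff_sum)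
  have "a = 0"
  proof (rule ccontr)
    assume "a \<noteq> 0"
    have "m = card (\<mu> ` {..<m})" using inj by (simp add: card_image)
    also have "\<dots> \<le> card {x. poly a x = 0}" by (rule card_mono[OF poly_roots_finite[OF \<open>a \<noteq> 0\<close>] roots])
    also have "\<dots> \<le> degree a" by (rule card_poly_roots_bound[OF \<open>a \<noteq> 0\<close>])
    also have "\<dots> < m" using coeff \<open>k < m\<close> \<open>a \<noteq> 0\<close> leading_coeff_0_iff[of a] by (metis (no_types))
    finally show False by simp
  qed
  then show "c k = 0" using coeff[of k] \<open>k < m\<close> by simp
qed

text \<open>These are the Markov parameters of the sum of the terms
  \<open>u i (v i)^T / (s - \<alpha> i)\<close>, a system given by its poles and rank-one
  residues.\<close>

lemma diagonal_markov:
  fixes d n :: nat and \<alpha> :: "nat \<Rightarrow> complex" and u v :: "nat \<Rightarrow> nat \<Rightarrow> complex"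
  defines "A \<equiv> mat d d (\<lambda>(i, j). if i = j then \<alpha> i else 0)"
    and "B \<equiv> mat d n (\<lambda>(i, q). v i q)" and "C \<equiv> mat n d (\<lambda>(p, i). u i p)"
  assumes pq: "p < n" "q < n"
  shows "(C * A ^\<^sub>m k * B) $$ (p, q) = (\<Sum>i<d. \<alpha> i ^ k * (u i p * v i q))"
proof -
  have A: "A \<in> carrier_mat d d" and B: "B \<in> carrier_mat d n" and C: "C \<in> carrier_mat n d"
    by (auto simp: A_def B_def C_def)
  have pow: "(A ^\<^sub>m k) $$ (i, j) = (if i = j then \<alpha> i ^ k else 0)" if "i < d" "j < d" for i j
    using that
  proof (induction k arbitrary: j)
    case 0
    then show ?case using A by simp
  next
    case (Suc k)
    have "(A ^\<^sub>m Suc k) $$ (i, j) = (\<Sum>l<d. (A ^\<^sub>m k) $$ (i, l) * A $$ (l, j))"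
      using mult_mat_index_sum[OF pow_carrier_mat[OF A] A Suc.prems] by simp
    also have "\<dots> = (\<Sum>l<d. if l = i then (if i = j then \<alpha> i ^ k * \<alpha> i else 0) else 0)"
      using Suc by (intro sum.cong refl) (auto simp: A_def)
    finally show ?case using Suc.prems by simp
  qed
  have CA: "(C * A ^\<^sub>m k) $$ (p, i) = u i p * \<alpha> i ^ k" if "i < d" for i
  proof -
    have "(C * A ^\<^sub>m k) $$ (p, i) = (\<Sum>l<d. C $$ (p, l) * (A ^\<^sub>m k) $$ (l, i))"
      by (rule mult_mat_index_sum[OF C pow_carrier_mat[OF A] pq(1) that])
    also have "\<dots> = (\<Sum>l<d. if l = i then u i p * \<alpha> i ^ k else 0)"
      using that pq by (intro sum.cong refl) (auto simp: pow C_def)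
    finally show ?thesis using that by simp
  qed
  have "(C * A ^\<^sub>m k * B) $$ (p, q) = (\<Sum>i<d. (C * A ^\<^sub>m k) $$ (p, i) * B $$ (i, q))"
    using A B C pq by (intro mult_mat_index_sum) auto
  also have "\<dots> = (\<Sum>i<d. \<alpha> i ^ k * (u i p * v i q))"
    using pq by (intro sum.cong refl) (simp add: CA B_def)
  finally show ?thesis .
qed

text \<open>The witness is the sum of \<open>b_i b_i^T / (s - i)\<close> over \<open>i < d\<close>,
  with \<open>b_i\<close> the vector \<open>rank1_row n i\<close>. The nonzero minor also bounds the
  degree from below: a realization of size \<open>d' < d\<close> would give, through
  \<open>markov_recurrence\<close>, a nontrivial relation among the first \<open>d\<close> Markov
  parameters.\<close>

lemma SRat_witness:
  assumes d: "d \<le> (n + 1) choose 2"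
  shows "\<exists>G \<in> SRat d n. det (mat d d (\<lambda>(k, l). G k $$ (sym_pairs n ! l))) \<noteq> 0"
proof -
  let ?A = "mat d d (\<lambda>(i, j). if i = j then of_nat i else 0) :: complex mat"
  let ?B = "mat d n (\<lambda>(i, q). rank1_row n i q)" and ?C = "mat n d (\<lambda>(p, i). rank1_row n i p)"
  define G where "G k = ?C * ?A ^\<^sub>m k * ?B" for k
  have G: "G k $$ (p, q) = (\<Sum>i<d. of_nat i ^ k * rank1_entry n i (p, q))" if "p < n" "q < n" for k p q
    unfolding G_def rank1_entry_def using diagonal_markov[OF that] by simp
  have pair: "\<exists>p q. sym_pairs n ! l = (p, q) \<and> p < n \<and> q < n" if "l < d" for l
    using sym_pair_bounds(2,3)[OF that d] by (metis prod.collapse)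
  have "mat d d (\<lambda>(k, l). G k $$ (sym_pairs n ! l)) =
      mat d d (\<lambda>(k, l). \<Sum>i<d. 1 * of_nat i ^ k * rank1_entry n i (sym_pairs n ! l))"
  proof (rule eq_matI)
    fix k l assume "k < dim_row (mat d d (\<lambda>(k, l). \<Sum>i<d. 1 * of_nat i ^ k * rank1_entry n i (sym_pairs n ! l)))"
      "l < dim_col (mat d d (\<lambda>(k, l). \<Sum>i<d. 1 * of_nat i ^ k * rank1_entry n i (sym_pairs n ! l)))"
    then have "k < d" "l < d" by auto
    with pair[OF \<open>l < d\<close>] G show "mat d d (\<lambda>(k, l). G k $$ (sym_pairs n ! l)) $$ (k, l) =
      mat d d (\<lambda>(k, l). \<Sum>i<d. 1 * of_nat i ^ k * rank1_entry n i (sym_pairs n ! l)) $$ (k, l)" by auto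
  qed auto
  then have det: "det (mat d d (\<lambda>(k, l). G k $$ (sym_pairs n ! l))) \<noteq> 0"
    using rank1_sum_minor_neq_0[OF d, of of_nat "\<lambda>_. 1"] by (simp add: inj_on_def)
  have "is_realization n d G ?A ?B ?C" by (simp add: is_realization_def G_def)
  moreover have "d \<le> d'" if real: "is_realization n d' G A B C" for d' A B C
  proof (rule ccontr)
    assume "\<not> d \<le> d'"
    then have "d' < d" by simp
    let ?c = "\<lambda>k. if k \<le> d' then coeff (char_poly A) k else 0"
    have ABC: "A \<in> carrier_mat d' d'" "B \<in> carrier_mat d' n" "C \<in> carrier_mat n d'"
      "\<And>k. G k = C * A ^\<^sub>m k * B" using real by (auto simp: is_realization_def)
    have "(\<Sum>k<d. ?c k * G k $$ (sym_pairs n ! l)) = 0" if l: "l < d" for l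
    proof -
      obtain p q where pq: "sym_pairs n ! l = (p, q)" "p < n" "q < n" using pair[OF l] by blast
      have "(\<Sum>k<d. ?c k * G k $$ (p, q)) = (\<Sum>k\<le>d'. ?c k * G k $$ (p, q))"
        using \<open>d' < d\<close> by (intro sum.mono_neutral_right) auto
      also have "\<dots> = (\<Sum>k\<le>d'. coeff (char_poly A) k * (C * A ^\<^sub>m (k + 0) * B) $$ (p, q))"
        by (intro sum.cong refl) (simp add: ABC(4))
      also have "\<dots> = 0" by (rule markov_recurrence[OF ABC(1-3) pq(2,3)])
      finally show ?thesis unfolding pq(1) .
    qed
    then have "\<forall>k<d. ?c k = 0"
      using spec[OF det[unfolded det_neq_0_iff_rows_independent], of ?c] by blast
    then have "?c d' = 0" using \<open>d' < d\<close> by blast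
    then show False using degree_monic_char_poly[OF ABC(1)] by simp
  qed
  moreover have "(G k)\<^sup>T = G k" for k
  proof (rule eq_matI)
    fix i j assume "i < dim_row (G k)" "j < dim_col (G k)"
    then have "i < n" "j < n" by (auto simp: G_def)
    then show "(G k)\<^sup>T $$ (i, j) = G k $$ (i, j)"
      using G[of i j k] G[of j i k] by (simp add: G_def rank1_entry_def mult.commute)
  qed (auto simp: G_def)
  ultimately have "G \<in> SRat d n" by (auto simp: SRat_def has_mcmillan_degree_def)
  with det show ?thesis by blast
qed

lemma sum_lessThan_double:
  fixes h :: "nat \<Rightarrow> 'a :: comm_monoid_add"
  shows "(\<Sum>s<2 * m. h s) = (\<Sum>k<m. h (2 * k) + h (2 * k + 1))"
  by (induction m) (auto simp: add.assoc)

text \<open>The witness is the sum of \<open>2 \<theta>_i b_i b_i^T / (s^2 - \<theta>_i^2)\<close>,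
  symmetric and even in \<open>s\<close>, hence Hamiltonian. It is realized with the poles
  \<open>\<theta>_i\<close> and \<open>- \<theta>_i\<close> and opposite residues.\<close>

lemma Ham_witness:
  assumes m: "m \<le> (n + 1) choose 2"
  shows "\<exists>G \<in> Ham (2 * m) n. det (mat m m (\<lambda>(k, l). G (2 * k + 1) $$ (sym_pairs n ! l))) \<noteq> 0"
proof -
  \<comment> \<open>Shifted by one, since a pole at 0 would coincide with its negative; the weights
    \<open>2 * \<theta> i\<close> are then nonzero and the squares distinct.\<close>
  define \<theta> :: "nat \<Rightarrow> complex" where "\<theta> i = of_nat (Suc i)" for i
  define \<alpha> where "\<alpha> i = (if i < m then \<theta> i else - \<theta> (i - m))" for i
  define v where "v i = (if i < m then rank1_row n i else rank1_row n (i - m))" for i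
  define u where "u i p = (if i < m then rank1_row n i p else - rank1_row n (i - m) p)" for i p
  let ?d = "m + m"
  let ?A = "mat ?d ?d (\<lambda>(i, j). if i = j then \<alpha> i else 0) :: complex mat"
  let ?B = "mat ?d n (\<lambda>(i, q). v i q)" and ?C = "mat n ?d (\<lambda>(p, i). u i p)"
  define G where "G k = ?C * ?A ^\<^sub>m k * ?B" for k
  have G: "G k $$ (p, q) = (\<Sum>i<m. (\<theta> i ^ k - (- \<theta> i) ^ k) * rank1_entry n i (p, q))"
    if "p < n" "q < n" for k p q
  proof -
    have "(\<Sum>i<m + k. h i) = (\<Sum>i<m. h i) + (\<Sum>i<k. h (i + m))" for h :: "nat \<Rightarrow> complex" and k
      by (induction k) (auto simp: add_ac)
    then have "G k $$ (p, q) = (\<Sum>i<m. \<alpha> i ^ k * (u i p * v i q)) +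
        (\<Sum>i<m. \<alpha> (i + m) ^ k * (u (i + m) p * v (i + m) q))"
      unfolding G_def diagonal_markov[OF that] by blast
    also have "\<dots> = (\<Sum>i<m. (\<theta> i ^ k - (- \<theta> i) ^ k) * rank1_entry n i (p, q))"
      unfolding sum.distrib[symmetric]
      by (intro sum.cong refl) (simp add: \<alpha>_def u_def v_def rank1_entry_def algebra_simps)
    finally show ?thesis .
  qed
  have G_even: "G k $$ (p, q) = 0" if "even k" "p < n" "q < n" for k p q
    unfolding G[OF that(2,3)] using that(1) by simp
  have pair: "\<exists>p q. sym_pairs n ! l = (p, q) \<and> p < n \<and> q < n" if "l < m" for l
    using sym_pair_bounds(2,3)[OF that m] by (metis prod.collapse)
  let ?W = "mat m m (\<lambda>(k, l). \<Sum>i<m. 2 * \<theta> i * (\<theta> i ^ 2) ^ k * rank1_entry n i (sym_pairs n ! l))"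
  have "mat m m (\<lambda>(k, l). G (2 * k + 1) $$ (sym_pairs n ! l)) = ?W"
  proof (rule eq_matI)
    fix k l assume "k < dim_row ?W" "l < dim_col ?W"
    then have kl: "k < m" "l < m" by auto
    obtain p q where pq: "sym_pairs n ! l = (p, q)" "p < n" "q < n" using pair[OF kl(2)] by blast
    show "mat m m (\<lambda>(k, l). G (2 * k + 1) $$ (sym_pairs n ! l)) $$ (k, l) = ?W $$ (k, l)"
      using kl pq G[OF pq(2,3)] by (simp add: power_mult mult.assoc)
  qed auto
  moreover have "inj_on (\<lambda>i. \<theta> i ^ 2) {..<m}"
  proof (rule inj_onI)
    fix i j assume "\<theta> i ^ 2 = \<theta> j ^ 2"
    then have "of_nat (Suc i ^ 2) = (of_nat (Suc j ^ 2) :: complex)" by (simp only: \<theta>_def of_nat_power)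
    then have "Suc i ^ 2 = Suc j ^ 2" by (simp only: of_nat_eq_iff)
    then show "i = j" by (simp only: power2_eq_iff_nonneg nat.inject zero_le)
  qed
  moreover have "2 * \<theta> i \<noteq> 0" for i by (simp add: \<theta>_def del: of_nat_Suc)
  ultimately have det: "det (mat m m (\<lambda>(k, l). G (2 * k + 1) $$ (sym_pairs n ! l))) \<noteq> 0"
    using rank1_sum_minor_neq_0[OF m, of "\<lambda>i. \<theta> i ^ 2" "\<lambda>i. 2 * \<theta> i"] by simp
  have "is_realization n (2 * m) G ?A ?B ?C" by (simp add: is_realization_def G_def mult_2)
  moreover have "2 * m \<le> d'" if real: "is_realization n d' G A B C" for d' A B C
  proof (rule ccontr)
    assume "\<not> 2 * m \<le> d'"
    then have d': "d' < 2 * m" by simp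
    \<comment> \<open>The recurrence is shifted so that its leading term, with coefficient 1, falls
      on the odd index \<open>2 * m - 1\<close>. The even-indexed Markov parameters of
      \<open>G\<close> vanish, so a leading term there would be lost.\<close>
    define j where "j = 2 * m - 1 - d'"
    let ?h = "\<lambda>s. if j \<le> s then coeff (char_poly A) (s - j) else 0"
    have ABC: "A \<in> carrier_mat d' d'" "B \<in> carrier_mat d' n" "C \<in> carrier_mat n d'"
      "\<And>k. G k = C * A ^\<^sub>m k * B" using real by (auto simp: is_realization_def)
    have "(\<Sum>k<m. ?h (2 * k + 1) * G (2 * k + 1) $$ (sym_pairs n ! l)) = 0" if l: "l < m" for l
    proof -
      obtain p q where pq: "sym_pairs n ! l = (p, q)" "p < n" "q < n" using pair[OF l] by blast
      have "(\<Sum>k<m. ?h (2 * k + 1) * G (2 * k + 1) $$ (p, q)) = (\<Sum>s<2 * m. ?h s * G s $$ (p, q))"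
        unfolding sum_lessThan_double using G_even[OF _ pq(2,3)] by simp
      also have "\<dots> = (\<Sum>s\<in>{j..<2 * m}. ?h s * G s $$ (p, q))"
        by (intro sum.mono_neutral_right) auto
      also have "\<dots> = (\<Sum>r\<le>d'. coeff (char_poly A) r * (C * A ^\<^sub>m (r + j) * B) $$ (p, q))"
        by (rule sum.reindex_bij_witness[of _ "\<lambda>r. r + j" "\<lambda>s. s - j"])
          (use d' in \<open>auto simp: j_def ABC(4)\<close>)
      also have "\<dots> = 0" by (rule markov_recurrence[OF ABC(1-3) pq(2,3)])
      finally show ?thesis unfolding pq(1) .
    qed
    then have "\<forall>k<m. ?h (2 * k + 1) = 0"
      using spec[OF det[unfolded det_neq_0_iff_rows_independent], of "\<lambda>k. ?h (2 * k + 1)"] by blast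
    moreover have "m - 1 < m" using d' by simp
    ultimately have "?h (2 * (m - 1) + 1) = 0" by blast
    moreover have "2 * (m - 1) + 1 = j + d'" using d' by (simp add: j_def)
    ultimately show False using degree_monic_char_poly[OF ABC(1)] by simp
  qed
  moreover have "G k = (-1) ^ (k + 1) \<cdot>\<^sub>m (G k)\<^sup>T" for k
  proof (rule eq_matI)
    fix i j assume "i < dim_row ((-1) ^ (k + 1) \<cdot>\<^sub>m (G k)\<^sup>T)" "j < dim_col ((-1) ^ (k + 1) \<cdot>\<^sub>m (G k)\<^sup>T)"
    then have ij: "i < n" "j < n" by (auto simp: G_def)
    have Gk: "G k \<in> carrier_mat n n" by (auto simp: G_def)
    have "G k $$ (i, j) = G k $$ (j, i)"
      unfolding G[OF ij] G[OF ij(2,1)] by (simp add: rank1_entry_def mult.commute)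
    then show "G k $$ (i, j) = ((-1) ^ (k + 1) \<cdot>\<^sub>m (G k)\<^sup>T) $$ (i, j)"
      using ij Gk G_even[OF _ ij] by (cases "even k") auto
  qed (auto simp: G_def)
  ultimately have "G \<in> Ham (2 * m) n" by (auto simp: Ham_def has_mcmillan_degree_def)
  with det show ?thesis by blast
qed

section \<open>Pole assignment for generic systems\<close>

lemma smult_mat_smult_mat: "a \<cdot>\<^sub>m (b \<cdot>\<^sub>m M) = (a * b) \<cdot>\<^sub>m (M :: 'a :: semigroup_mult mat)"
  by (intro eq_matI) (auto simp: mult.assoc)

lemma one_smult_mat: "1 \<cdot>\<^sub>m M = (M :: 'a :: monoid_mult mat)"
  by (intro eq_matI) auto

lemma sign_smult_sign_smult_mat: "(-1) ^ k \<cdot>\<^sub>m ((-1) ^ k \<cdot>\<^sub>m M) = (M :: 'a :: comm_ring_1 mat)"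
  by (simp add: smult_mat_smult_mat one_smult_mat power_mult_distrib[symmetric])

lemma markov_carrier:
  "A \<in> carrier_mat d d \<Longrightarrow> B \<in> carrier_mat d n \<Longrightarrow> C \<in> carrier_mat n d \<Longrightarrow> C * A ^\<^sub>m k * B \<in> carrier_mat n n"
  by (auto intro!: mult_carrier_mat[of _ _ d])

lemma contains_open_monic_of_minor:
  fixes A B C :: "complex mat"
  assumes A: "A \<in> carrier_mat d d" and B: "B \<in> carrier_mat d n" and C: "C \<in> carrier_mat n d"
    and d: "d \<le> (n + 1) choose 2"
    and sym: "\<And>k. (C * A ^\<^sub>m k * B)\<^sup>T = C * A ^\<^sub>m k * B"
    and det: "det (mat d d (\<lambda>(k, l). (C * A ^\<^sub>m k * B) $$ (sym_pairs n ! l))) \<noteq> 0"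
  shows "contains_open_monic d (closed_loop_polys A B C (Sym n))"
proof -
  let ?N = "(n + 1) choose 2"
  let ?f = "\<lambda>j xs. coeff (char_poly (A + B * sym_mat n xs * C)) j"
  have f: "?f j \<in> poly_fun ?N" for j
    by (rule poly_fun_char_poly_coeff[OF poly_mat_closed_loop[OF A B C]])
  have monic: "coeff (char_poly A) d = 1" using degree_monic_char_poly[OF A] by simp
  have "\<exists>xs Q. length xs = ?N \<and>
      (\<forall>j<d. (\<forall>t. ?f j (map (\<lambda>x. t * x) xs) = poly (Q j) t) \<and> coeff (Q j) 1 = ys ! j)"
    if "length ys = d" for ys
  proof -
    \<comment> \<open>The differential at \<open>F = 0\<close> is a composite: \<open>F\<close>
      determines traces, and these enter the coefficients unitriangularly. The two maps are inverted
      in reverse order; the minus sign is that of the derivative.\<close>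
    obtain z where z: "\<And>j. j < d \<Longrightarrow> (\<Sum>r\<in>{j<..d}. coeff (char_poly A) r * z (r - j - 1)) = - ys ! j"
      using triangular_system_solvable[of "coeff (char_poly A)" d "\<lambda>j. - ys ! j"] monic by blast
    obtain F where F: "F \<in> Sym n"
      and trace: "\<And>k. k < d \<Longrightarrow> (\<Sum>i<n. (F * (C * A ^\<^sub>m k * B)) $$ (i, i)) = z k"
      using sym_trace_solvable[OF d _ det, of z] markov_carrier[OF A B C] sym by auto
    obtain xs where xs: "length xs = ?N" "F = sym_mat n xs" by (rule Sym_eq_sym_mat[OF F])
    have Fc: "F \<in> carrier_mat n n" using F by (simp add: Sym_def)
    obtain Q where Q: "\<And>j t. coeff (char_poly (A + B * (t \<cdot>\<^sub>m F) * C)) j = poly (Q j) t"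
      "\<And>j. coeff (Q j) 1 = - (\<Sum>r\<in>{j<..d}. coeff (char_poly A) r *
        (\<Sum>i<n. (F * (C * A ^\<^sub>m (r - j - 1) * B)) $$ (i, i)))"
      using closed_loop_char_poly_on_line[OF A B C Fc] by blast
    have "coeff (Q j) 1 = ys ! j" if j: "j < d" for j
    proof -
      have "coeff (Q j) 1 = - (\<Sum>r\<in>{j<..d}. coeff (char_poly A) r * z (r - j - 1))"
        unfolding Q(2) by (intro arg_cong[where f = uminus] sum.cong refl arg_cong2[where f = "(*)"] trace) auto
      then show ?thesis using z[OF j] by simp
    qed
    moreover have "?f j (map (\<lambda>x. t * x) xs) = poly (Q j) t" for j t
      unfolding sym_mat_scale[OF xs(1)] xs(2)[symmetric] by (rule Q(1))
    ultimately show ?thesis using xs(1) by blast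
  qed
  from image_contains_open[of d ?f, OF f this] obtain V where V: "zariski_open d V" "V \<noteq> {}"
    "V \<subseteq> (\<lambda>xs. map (\<lambda>j. ?f j xs) [0..<d]) ` affine_space ?N" by blast
  have "monic_of d ` V \<subseteq> closed_loop_polys A B C (Sym n)"
  proof
    fix p assume "p \<in> monic_of d ` V"
    then obtain xs where p: "p = monic_of d (map (\<lambda>j. ?f j xs) [0..<d])" using V(3) by auto
    have car: "A + B * sym_mat n xs * C \<in> carrier_mat d d" using A B C sym_mat_carrier by auto
    have "p = char_poly (A + B * sym_mat n xs * C)"
    proof (rule poly_eqI)
      fix i show "coeff p i = coeff (char_poly (A + B * sym_mat n xs * C)) i"
        using degree_monic_char_poly[OF car] by (auto simp: p coeff_monic_of coeff_eq_0)
    qed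
    then show "p \<in> closed_loop_polys A B C (Sym n)"
      using sym_mat_Sym by (auto simp: closed_loop_polys_def)
  qed
  with V(1,2) show ?thesis by (auto simp: contains_open_monic_def)
qed

section \<open>Hamiltonian symmetry of the closed loop\<close>

lemma feedback_expansion:
  fixes A B C F P S :: "complex mat"
  assumes "A \<in> carrier_mat d d" "B \<in> carrier_mat d n" "C \<in> carrier_mat n d"
    "F \<in> carrier_mat n n" "P \<in> carrier_mat n d" "S \<in> carrier_mat d n"
  shows "P * ((A + B * F * C) * S) = P * (A * S) + (P * B) * (F * (C * S))"
proof -
  have "(A + B * F * C) * S = A * S + B * F * C * S"
    using assms by (intro add_mult_distrib_mat[of _ d d]) auto
  also have "B * F * C * S = B * (F * (C * S))"
    using assms assoc_mult_mat[of "B * F" d n C d S n] assoc_mult_mat[of B d n F n "C * S" n] by auto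
  finally have "P * ((A + B * F * C) * S) = P * (A * S) + P * (B * (F * (C * S)))"
    using assms mult_add_distrib_mat[of P n d "A * S" n "B * (F * (C * S))"] by auto
  also have "P * (B * (F * (C * S))) = (P * B) * (F * (C * S))"
    using assms assoc_mult_mat[of P n d B n "F * (C * S)" n] by auto
  finally show ?thesis .
qed

text \<open>Symmetric feedback preserves the symmetry \<open>G(s) = G(-s)^t\<close>. With no
  Hamiltonian structure given on the state space, factors \<open>A'\<close> are traded for
  \<open>A\<close> one at a time in the mixed products \<open>K i j\<close> and
  \<open>L j i\<close>; each exchange adds a term through \<open>F\<close>, and the two added terms
  are transposes of each other up to sign.\<close>

lemma closed_loop_markov_parity:
  fixes A B C F :: "complex mat"
  assumes A: "A \<in> carrier_mat d d" and B: "B \<in> carrier_mat d n" and C: "C \<in> carrier_mat n d"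
    and F: "F \<in> Sym n"
    and parity: "\<And>k. C * A ^\<^sub>m k * B = (-1) ^ (k + 1) \<cdot>\<^sub>m (C * A ^\<^sub>m k * B)\<^sup>T"
  defines "A' \<equiv> A + B * F * C"
  shows "C * A' ^\<^sub>m k * B = (-1) ^ (k + 1) \<cdot>\<^sub>m (C * A' ^\<^sub>m k * B)\<^sup>T"
proof -
  have F': "F \<in> carrier_mat n n" "F\<^sup>T = F" using F by (auto simp: Sym_def)
  have A': "A' \<in> carrier_mat d d" using A B C F' by (auto simp: A'_def)
  define G where "G i = C * A ^\<^sub>m i * B" for i
  define H where "H j = C * A' ^\<^sub>m j * B" for j
  define K where "K i j = (C * A ^\<^sub>m i) * (A' ^\<^sub>m j * B)" for i j
  define L where "L j i = (C * A' ^\<^sub>m j) * (A ^\<^sub>m i * B)" for j i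
  have pow: "A ^\<^sub>m i \<in> carrier_mat d d" "A' ^\<^sub>m i \<in> carrier_mat d d" for i using A A' by auto
  have CA: "C * A ^\<^sub>m i \<in> carrier_mat n d" "C * A' ^\<^sub>m i \<in> carrier_mat n d"
    and AB: "A ^\<^sub>m i * B \<in> carrier_mat d n" "A' ^\<^sub>m i * B \<in> carrier_mat d n" for i
    using C B pow mult_carrier_mat by blast+
  have car: "G i \<in> carrier_mat n n" "H i \<in> carrier_mat n n" "K i j \<in> carrier_mat n n" "L j i \<in> carrier_mat n n" for i j
    unfolding G_def H_def K_def L_def using CA AB B mult_carrier_mat by blast+
  have G': "C * (A ^\<^sub>m i * B) = G i" and H': "C * (A' ^\<^sub>m i * B) = H i" for i
    using assoc_mult_mat[OF C pow(1) B] assoc_mult_mat[OF C pow(2) B] by (auto simp: G_def H_def)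
  have Suc_l: "X ^\<^sub>m Suc i = X * X ^\<^sub>m i" if "X \<in> carrier_mat d d" for X :: "complex mat" and i
    using pow_mat_add[OF that, of 1 i] that by simp
  have K_step: "K i (Suc j) = K (Suc i) j + G i * (F * H j)" for i j
  proof -
    have "K i (Suc j) = C * A ^\<^sub>m i * ((A + B * F * C) * (A' ^\<^sub>m j * B))"
      unfolding K_def Suc_l[OF A'] using assoc_mult_mat[OF A' pow(2) B] by (simp add: A'_def)
    also have "\<dots> = C * A ^\<^sub>m i * (A * (A' ^\<^sub>m j * B)) + (C * A ^\<^sub>m i * B) * (F * (C * (A' ^\<^sub>m j * B)))"
      by (rule feedback_expansion[OF A B C F'(1) CA(1) AB(2)])
    also have "C * A ^\<^sub>m i * (A * (A' ^\<^sub>m j * B)) = K (Suc i) j"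
      unfolding K_def using assoc_mult_mat[OF CA(1) A AB(2)] assoc_mult_mat[OF C pow(1) A] by simp
    finally show ?thesis unfolding H' G_def .
  qed
  have L_step: "L (Suc j) i = L j (Suc i) + H j * (F * G i)" for i j
  proof -
    have "L (Suc j) i = C * A' ^\<^sub>m j * ((A + B * F * C) * (A ^\<^sub>m i * B))"
      unfolding L_def using assoc_mult_mat[OF C pow(2) A'] assoc_mult_mat[OF CA(2) A' AB(1)]
      by (simp add: A'_def)
    also have "\<dots> = C * A' ^\<^sub>m j * (A * (A ^\<^sub>m i * B)) + (C * A' ^\<^sub>m j * B) * (F * (C * (A ^\<^sub>m i * B)))"
      by (rule feedback_expansion[OF A B C F'(1) CA(2) AB(1)])
    also have "C * A' ^\<^sub>m j * (A * (A ^\<^sub>m i * B)) = L j (Suc i)"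
      unfolding L_def Suc_l[OF A] using assoc_mult_mat[OF A pow(1) B] by simp
    finally show ?thesis unfolding G' H_def .
  qed
  have K0: "K 0 j = H j" for j unfolding K_def using A C H' by simp
  have L0: "L j 0 = H j" for j unfolding L_def H_def using A B by simp
  have Gt: "(G i)\<^sup>T = (-1) ^ (i + 1) \<cdot>\<^sub>m G i" for i
    using arg_cong[OF parity[of i], of "\<lambda>M. (-1) ^ (i + 1) \<cdot>\<^sub>m M"]
    unfolding sign_smult_sign_smult_mat by (simp add: G_def)
  have main: "(K i j)\<^sup>T = (-1) ^ (i + j + 1) \<cdot>\<^sub>m L j i" for i j
  proof (induction j arbitrary: i)
    case 0
    have "K i 0 = G i" unfolding K_def G_def using A' B by simp
    moreover have "L 0 i = G i" unfolding L_def using A' C G' by simp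
    ultimately show ?case using Gt by simp
  next
    case (Suc j)
    \<comment> \<open>The induction keeps \<open>i\<close> arbitrary for two uses: at
      \<open>0\<close> it gives the parity of \<open>H j\<close> itself, and at \<open>Suc i\<close>
      the main term.\<close>
    have Ht: "(H j)\<^sup>T = (-1) ^ (j + 1) \<cdot>\<^sub>m H j" using Suc[of 0] K0 L0 by simp
    have FH: "F * H j \<in> carrier_mat n n" using F' car by auto
    have "(G i * (F * H j))\<^sup>T = (H j)\<^sup>T * F * (G i)\<^sup>T"
      using transpose_mult[OF car(1) FH] transpose_mult[OF F'(1) car(2)] F'(2) by simp
    also have "\<dots> = (-1) ^ (j + 1) \<cdot>\<^sub>m ((-1) ^ (i + 1) \<cdot>\<^sub>m (H j * F * G i))"
    proof -
      have HF: "H j * F \<in> carrier_mat n n" by (rule mult_carrier_mat[OF car(2) F'(1)])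
      show ?thesis unfolding Ht Gt mult_smult_assoc_mat[OF car(2) F'(1)]
          mult_smult_assoc_mat[OF HF smult_carrier_mat[OF car(1)]] mult_smult_distrib[OF HF car(1)] ..
    qed
    also have "\<dots> = (-1) ^ (i + Suc j + 1) \<cdot>\<^sub>m (H j * (F * G i))"
      using assoc_mult_mat[OF car(2) F'(1) car(1)] by (simp add: smult_mat_smult_mat power_add mult.commute)
    finally have t: "(G i * (F * H j))\<^sup>T = (-1) ^ (i + Suc j + 1) \<cdot>\<^sub>m (H j * (F * G i))" .
    have "(K i (Suc j))\<^sup>T = (K (Suc i) j)\<^sup>T + (G i * (F * H j))\<^sup>T"
      unfolding K_step by (rule transpose_add[OF car(3) mult_carrier_mat[OF car(1) FH]])
    also have "\<dots> = (-1) ^ (i + Suc j + 1) \<cdot>\<^sub>m L j (Suc i) + (-1) ^ (i + Suc j + 1) \<cdot>\<^sub>m (H j * (F * G i))"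
      unfolding Suc t by simp
    also have "\<dots> = (-1) ^ (i + Suc j + 1) \<cdot>\<^sub>m L (Suc j) i"
      unfolding L_step
      by (rule add_smult_distrib_left_mat[OF car(4) mult_carrier_mat[OF car(2) mult_carrier_mat[OF F'(1) car(1)]], symmetric])
    finally show ?case .
  qed
  have "(H k)\<^sup>T = (-1) ^ (k + 1) \<cdot>\<^sub>m H k" using main[of 0 k] K0 L0 by simp
  then have "(-1) ^ (k + 1) \<cdot>\<^sub>m (H k)\<^sup>T = H k" by (simp only: sign_smult_sign_smult_mat)
  then show ?thesis by (simp add: H_def)
qed

lemma markov_parity_entries:
  fixes M :: "complex mat"
  assumes "M \<in> carrier_mat n n" "M = (-1) ^ (k + 1) \<cdot>\<^sub>m M\<^sup>T" "p < n" "q < n"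
  shows "M $$ (p, q) + M $$ (q, p) = (if even k then 0 else 2 * M $$ (p, q))"
proof -
  have "M $$ (p, q) = (-1) ^ (k + 1) * M $$ (q, p)"
    using arg_cong[OF assms(2), of "\<lambda>M. M $$ (p, q)"] assms by simp
  then show ?thesis by (cases "even k") auto
qed

text \<open>Adding the recurrence at \<open>(p, q)\<close> to the one at \<open>(q, p)\<close>
  cancels the even-indexed, skew-symmetric Markov parameters. What remains is a relation among the
  odd-indexed ones whose coefficients are the odd coefficients of \<open>char_poly A\<close>, and
  the minor excludes a nontrivial one.\<close>

lemma char_poly_odd_coeff_eq_0:
  fixes A B C :: "complex mat"
  assumes A: "A \<in> carrier_mat (2 * m) (2 * m)" and B: "B \<in> carrier_mat (2 * m) n"
    and C: "C \<in> carrier_mat n (2 * m)" and m: "m \<le> (n + 1) choose 2"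
    and parity: "\<And>k. C * A ^\<^sub>m k * B = (-1) ^ (k + 1) \<cdot>\<^sub>m (C * A ^\<^sub>m k * B)\<^sup>T"
    and det: "det (mat m m (\<lambda>(k, l). (C * A ^\<^sub>m (2 * k + 1) * B) $$ (sym_pairs n ! l))) \<noteq> 0"
    and "k < m"
  shows "coeff (char_poly A) (2 * k + 1) = 0"
proof -
  let ?G = "\<lambda>k. C * A ^\<^sub>m k * B"
  let ?c = "\<lambda>k. coeff (char_poly A) (2 * k + 1)"
  have G: "?G k \<in> carrier_mat n n" for k by (rule markov_carrier[OF A B C])
  have "(\<Sum>k<m. ?c k * ?G (2 * k + 1) $$ (sym_pairs n ! l)) = 0" if l: "l < m" for l
  proof -
    obtain p q where pq: "sym_pairs n ! l = (p, q)" "p < n" "q < n"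
      using sym_pair_bounds(2,3)[OF l m] by (metis prod.collapse)
    let ?h = "\<lambda>r. coeff (char_poly A) r * (?G r $$ (p, q) + ?G r $$ (q, p))"
    have "(\<Sum>r\<le>2 * m. ?h r) = (\<Sum>r\<le>2 * m. coeff (char_poly A) r * (C * A ^\<^sub>m (r + 0) * B) $$ (p, q)) +
        (\<Sum>r\<le>2 * m. coeff (char_poly A) r * (C * A ^\<^sub>m (r + 0) * B) $$ (q, p))"
      by (simp add: sum.distrib distrib_left)
    also have "\<dots> = 0" using markov_recurrence[OF A B C pq(2,3), of 0] markov_recurrence[OF A B C pq(3,2), of 0] by simp
    finally have "0 = (\<Sum>r\<le>2 * m. ?h r)" by simp
    also have "\<dots> = (\<Sum>r<2 * m. ?h r) + ?h (2 * m)"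
      by (simp add: lessThan_Suc_atMost[symmetric])
    also have "\<dots> = (\<Sum>k<m. 2 * (?c k * ?G (2 * k + 1) $$ (p, q)))"
      unfolding sum_lessThan_double markov_parity_entries[OF G parity pq(2,3)] by (simp add: mult_ac)
    finally show ?thesis unfolding pq(1) by (simp add: sum_distrib_left[symmetric])
  qed
  then show ?thesis using spec[OF det[unfolded det_neq_0_iff_rows_independent], of ?c] \<open>k < m\<close> by blast
qed

text \<open>The minor condition survives almost all feedbacks, so the odd coefficients of the closed-loop
  polynomial vanish on a nonempty Zariski open set of feedbacks, hence identically.\<close>

lemma closed_loop_odd_coeff_eq_0:
  fixes A B C :: "complex mat"
  assumes A: "A \<in> carrier_mat (2 * m) (2 * m)" and B: "B \<in> carrier_mat (2 * m) n"
    and C: "C \<in> carrier_mat n (2 * m)" and m: "m \<le> (n + 1) choose 2"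
    and parity: "\<And>k. C * A ^\<^sub>m k * B = (-1) ^ (k + 1) \<cdot>\<^sub>m (C * A ^\<^sub>m k * B)\<^sup>T"
    and det: "det (mat m m (\<lambda>(k, l). (C * A ^\<^sub>m (2 * k + 1) * B) $$ (sym_pairs n ! l))) \<noteq> 0"
    and "k < m" and xs: "length xs = (n + 1) choose 2"
  shows "coeff (char_poly (A + B * sym_mat n xs * C)) (2 * k + 1) = 0"
proof (rule ccontr)
  assume neq: "coeff (char_poly (A + B * sym_mat n xs * C)) (2 * k + 1) \<noteq> 0"
  let ?N = "(n + 1) choose 2"
  let ?A = "\<lambda>xs. A + B * sym_mat n xs * C"
  let ?h = "\<lambda>xs. coeff (char_poly (?A xs)) (2 * k + 1)"
  let ?w = "\<lambda>xs. det (mat m m (\<lambda>(k, l). (C * ?A xs ^\<^sub>m (2 * k + 1) * B) $$ (sym_pairs n ! l)))"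
  note pA = poly_mat_closed_loop[OF A B C]
  have "nonvanishing ?N ?h" unfolding nonvanishing_def
    using poly_fun_char_poly_coeff[OF pA] neq xs by (auto simp: affine_space_def)
  moreover have "nonvanishing ?N ?w" unfolding nonvanishing_def
  proof
    show "?w \<in> poly_fun ?N"
    proof (rule poly_fun_det)
      fix i j assume ij: "i < m" "j < m"
      have "poly_mat ?N n n (\<lambda>xs. C * ?A xs ^\<^sub>m (2 * i + 1) * B)"
        using B C poly_mat_pow[OF pA] by (intro poly_mat_mult poly_mat_const)
      moreover obtain p q where "sym_pairs n ! j = (p, q)" "p < n" "q < n"
        using sym_pair_bounds(2,3)[OF ij(2) m] by (metis prod.collapse)
      ultimately show "(\<lambda>xs. mat m m (\<lambda>(k, l). (C * ?A xs ^\<^sub>m (2 * k + 1) * B) $$ (sym_pairs n ! l)) $$ (i, j))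
          \<in> poly_fun ?N" using ij by (auto simp: poly_mat_def)
    qed simp
    have "sym_mat n (replicate ?N 0) = 0\<^sub>m n n"
    proof (rule eq_matI)
      fix i j assume "i < dim_row (0\<^sub>m n n)" "j < dim_col (0\<^sub>m n n)"
      then have ij: "i < n" "j < n" by auto
      then have "sym_index n (max i j, min i j) < ?N" by (intro sym_index) auto
      with ij show "sym_mat n (replicate ?N 0) $$ (i, j) = 0\<^sub>m n n $$ (i, j)" by (simp add: sym_mat_def)
    qed (auto simp: sym_mat_def)
    then have "?A (replicate ?N 0) = A" using A B C by simp
    then have "?w (replicate ?N 0) \<noteq> 0" using det by simp
    then show "\<exists>xs\<in>affine_space ?N. ?w xs \<noteq> 0"
      by (intro bexI[of _ "replicate ?N 0"]) (auto simp: affine_space_def)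
  qed
  ultimately obtain xs where "?h xs \<noteq> 0" "?w xs \<noteq> 0"
    using nonvanishing_mult[of ?N ?h ?w] by (auto simp: nonvanishing_def)
  moreover have "?A xs \<in> carrier_mat (2 * m) (2 * m)" using A B C sym_mat_carrier by auto
  ultimately show False
    using char_poly_odd_coeff_eq_0[OF _ B C m closed_loop_markov_parity[OF A B C sym_mat_Sym parity] _ \<open>k < m\<close>]
    by blast
qed

lemma contains_open_even_monic_of_minor:
  fixes A B C :: "complex mat"
  assumes A: "A \<in> carrier_mat (2 * m) (2 * m)" and B: "B \<in> carrier_mat (2 * m) n"
    and C: "C \<in> carrier_mat n (2 * m)" and m: "m \<le> (n + 1) choose 2"
    and parity: "\<And>k. C * A ^\<^sub>m k * B = (-1) ^ (k + 1) \<cdot>\<^sub>m (C * A ^\<^sub>m k * B)\<^sup>T"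
    and det: "det (mat m m (\<lambda>(k, l). (C * A ^\<^sub>m (2 * k + 1) * B) $$ (sym_pairs n ! l))) \<noteq> 0"
  shows "contains_open_even_monic (2 * m) (closed_loop_polys A B C (Sym n))"
proof -
  let ?N = "(n + 1) choose 2"
  let ?f = "\<lambda>j xs. coeff (char_poly (A + B * sym_mat n xs * C)) (2 * j)"
  let ?G = "\<lambda>k. C * A ^\<^sub>m k * B"
  have f: "?f j \<in> poly_fun ?N" for j
    by (rule poly_fun_char_poly_coeff[OF poly_mat_closed_loop[OF A B C]])
  have monic: "coeff (char_poly A) (2 * m) = 1" using degree_monic_char_poly[OF A] by simp
  have G: "?G k \<in> carrier_mat n n" for k by (rule markov_carrier[OF A B C])
  have "\<exists>xs Q. length xs = ?N \<and>
      (\<forall>j<m. (\<forall>t. ?f j (map (\<lambda>x. t * x) xs) = poly (Q j) t) \<and> coeff (Q j) 1 = ys ! j)"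
    if "length ys = m" for ys
  proof -
    \<comment> \<open>Only even coefficients of \<open>char_poly A\<close> enter: for the
      coefficient \<open>2 * j\<close> the index \<open>r - 2 * j - 1\<close> is odd exactly if
      \<open>r\<close> is even, and \<open>r = 2 * s\<close> corresponds to the trace number
      \<open>s - j - 1\<close>.\<close>
    obtain z where z: "\<And>j. j < m \<Longrightarrow> (\<Sum>r\<in>{j<..m}. coeff (char_poly A) (2 * r) * z (r - j - 1)) = - ys ! j"
      using triangular_system_solvable[of "\<lambda>r. coeff (char_poly A) (2 * r)" m "\<lambda>j. - ys ! j"] monic by blast
    have "?G (2 * k + 1) \<in> carrier_mat n n \<and> (?G (2 * k + 1))\<^sup>T = ?G (2 * k + 1)" for k
    proof
      have "(- 1 :: complex) ^ (2 * k + 1 + 1) = 1" by simp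
      then show "(?G (2 * k + 1))\<^sup>T = ?G (2 * k + 1)"
        using parity[of "2 * k + 1"] by (simp only: one_smult_mat)
    qed (rule G)
    then obtain F where F: "F \<in> Sym n"
      and trace: "\<And>k. k < m \<Longrightarrow> (\<Sum>i<n. (F * ?G (2 * k + 1)) $$ (i, i)) = z k"
      using sym_trace_solvable[OF m _ det, of z] by auto
    obtain xs where xs: "length xs = ?N" "F = sym_mat n xs" by (rule Sym_eq_sym_mat[OF F])
    have Fc: "F \<in> carrier_mat n n" using F by (simp add: Sym_def)
    obtain Q where Q: "\<And>j t. coeff (char_poly (A + B * (t \<cdot>\<^sub>m F) * C)) j = poly (Q j) t"
      "\<And>j. coeff (Q j) 1 = - (\<Sum>r\<in>{j<..2 * m}. coeff (char_poly A) r *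
        (\<Sum>i<n. (F * ?G (r - j - 1)) $$ (i, i)))"
      using closed_loop_char_poly_on_line[OF A B C Fc] by blast
    have "coeff (Q (2 * j)) 1 = ys ! j" if j: "j < m" for j
    proof -
      let ?h = "\<lambda>r. coeff (char_poly A) r * (\<Sum>i<n. (F * ?G (r - 2 * j - 1)) $$ (i, i))"
      have odd: "?h r = 0" if "odd r" "2 * j < r" for r
      proof -
        have "even (r - 2 * j - 1)" using that by auto
        then have sign: "(- 1 :: complex) ^ (r - 2 * j - 1 + 1) = - 1" by simp
        have "(- 1) \<cdot>\<^sub>m M = - M" for M :: "complex mat" by (intro eq_matI) auto
        then have "?G (r - 2 * j - 1) = - (?G (r - 2 * j - 1))\<^sup>T"
          using parity[of "r - 2 * j - 1", unfolded sign] by simp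
        from trace_sym_skew[OF F G this] show ?thesis by simp
      qed
      have "(\<Sum>r\<in>{2 * j<..2 * m}. ?h r) = (\<Sum>r\<in>(\<lambda>s. 2 * s) ` {j<..m}. ?h r)"
      proof (rule sum.mono_neutral_right)
        show "\<forall>r\<in>{2 * j<..2 * m} - (\<lambda>s. 2 * s) ` {j<..m}. ?h r = 0"
        proof
          fix r assume r: "r \<in> {2 * j<..2 * m} - (\<lambda>s. 2 * s) ` {j<..m}"
          have "odd r"
          proof
            assume "even r"
            then obtain s where "r = 2 * s" by blast
            with r show False by auto
          qed
          then show "?h r = 0" using odd r by simp
        qed
      qed auto
      also have "\<dots> = (\<Sum>s\<in>{j<..m}. ?h (2 * s))" by (subst sum.reindex) (auto simp: inj_on_def)
      also have "\<dots> = (\<Sum>s\<in>{j<..m}. coeff (char_poly A) (2 * s) * z (s - j - 1))"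
      proof (rule sum.cong[OF refl])
        fix s assume "s \<in> {j<..m}"
        then have "2 * s - 2 * j - 1 = 2 * (s - j - 1) + 1" "s - j - 1 < m" by auto
        then show "?h (2 * s) = coeff (char_poly A) (2 * s) * z (s - j - 1)"
          using trace[of "s - j - 1"] by (simp only:)
      qed
      finally show ?thesis using Q(2)[of "2 * j"] z[OF j] by simp
    qed
    moreover have "?f j (map (\<lambda>x. t * x) xs) = poly (Q (2 * j)) t" for j t
      unfolding sym_mat_scale[OF xs(1)] xs(2)[symmetric] by (rule Q(1))
    ultimately show ?thesis using xs(1) by (intro exI[of _ xs] exI[of _ "\<lambda>j. Q (2 * j)"]) auto
  qed
  from image_contains_open[of m ?f, OF f this] obtain V where V: "zariski_open m V" "V \<noteq> {}"
    "V \<subseteq> (\<lambda>xs. map (\<lambda>j. ?f j xs) [0..<m]) ` affine_space ?N" by blast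
  have "even_monic_of (2 * m) ` V \<subseteq> closed_loop_polys A B C (Sym n)"
  proof
    fix p assume "p \<in> even_monic_of (2 * m) ` V"
    then obtain xs where xs: "length xs = ?N" and p: "p = even_monic_of (2 * m) (map (\<lambda>j. ?f j xs) [0..<m])"
      using V(3) by (auto simp: affine_space_def)
    have car: "A + B * sym_mat n xs * C \<in> carrier_mat (2 * m) (2 * m)" using A B C sym_mat_carrier by auto
    have "p = char_poly (A + B * sym_mat n xs * C)"
    proof (rule poly_eqI)
      fix i
      consider "2 * m < i" | "i = 2 * m" | k where "i = 2 * k" "k < m" | k where "i = 2 * k + 1" "k < m"
        by (metis even_two_times_div_two linorder_neqE_nat mult_less_cancel1 odd_two_times_div_two_succ
            zero_less_numeral Suc_eq_plus1 Suc_lessD nat_mult_less_cancel_disj)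
      then show "coeff p i = coeff (char_poly (A + B * sym_mat n xs * C)) i"
      proof cases
        \<comment> \<open>The odd coefficients are not among those assigned; they vanish for every
          symmetric feedback.\<close>
        case 4
        then show ?thesis using closed_loop_odd_coeff_eq_0[OF A B C m parity det _ xs]
          by (auto simp: p coeff_even_monic_of)
      qed (use degree_monic_char_poly[OF car] in \<open>auto simp: p coeff_even_monic_of coeff_eq_0\<close>)
    qed
    then show "p \<in> closed_loop_polys A B C (Sym n)"
      using sym_mat_Sym by (auto simp: closed_loop_polys_def)
  qed
  with V(1,2) show ?thesis by (auto simp: contains_open_even_monic_def)
qed

section \<open>Parity of the degree of Hamiltonian systems\<close>

text \<open>The projection is along a single vector \<open>v\<close> instead of the whole
  unobservable subspace: every row of \<open>C * A ^\<^sub>m k\<close> annihilates \<open>v\<close>,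
  so the projection can be inserted after each factor \<open>A\<close> without changing
  \<open>C * A ^\<^sub>m k\<close>.\<close>

lemma reduce_unobservable:
  fixes A B C :: "complex mat"
  assumes A: "A \<in> carrier_mat (Suc e) (Suc e)" and B: "B \<in> carrier_mat (Suc e) n"
    and C: "C \<in> carrier_mat n (Suc e)"
    and i: "i < Suc e" "v i \<noteq> 0"
    and unobs: "\<And>k p. p < n \<Longrightarrow> (\<Sum>a<Suc e. (C * A ^\<^sub>m k) $$ (p, a) * v a) = 0"
  shows "\<exists>A' B' C'. A' \<in> carrier_mat e e \<and> B' \<in> carrier_mat e n \<and> C' \<in> carrier_mat n e \<and>
    (\<forall>k. C' * A' ^\<^sub>m k * B' = C * A ^\<^sub>m k * B)"
proof -
  let ?d = "Suc e"
  \<comment> \<open>\<open>E' * E\<close> is the projection along \<open>v\<close> onto the hyperplane where the \<open>i\<close>-th coordinate vanishes.\<close>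
  define \<sigma> where "\<sigma> b = (if b < i then b else Suc b)" for b
  define E' where "E' = mat ?d e (\<lambda>(a, b). if a = \<sigma> b then 1 else 0 :: complex)"
  define E where "E = mat e ?d (\<lambda>(b, a). (if \<sigma> b = a then 1 else 0) - (if a = i then v (\<sigma> b) / v i else 0))"
  have E: "E \<in> carrier_mat e ?d" and E': "E' \<in> carrier_mat ?d e" by (auto simp: E_def E'_def)
  have EA: "E * A \<in> carrier_mat e ?d" and EAE: "E * A * E' \<in> carrier_mat e e"
    and CE: "C * E' \<in> carrier_mat n e" and EB: "E * B \<in> carrier_mat e n"
    and EE: "E' * E \<in> carrier_mat ?d ?d"
    using A B C E E' by auto
  have proj: "(E' * E) $$ (a, a') = (if a = a' then 1 else 0) - (if a' = i then v a / v i else 0)"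
    if aa: "a < ?d" "a' < ?d" for a a'
  proof -
    have sum: "(E' * E) $$ (a, a') = (\<Sum>b<e. (if a = \<sigma> b then 1 else 0) *
        ((if \<sigma> b = a' then 1 else 0) - (if a' = i then v (\<sigma> b) / v i else 0)))"
      using aa by (subst mult_mat_index_sum[OF E' E aa]) (auto simp: E_def E'_def)
    show ?thesis
    proof (cases "a = i")
      case True
      then have "a \<noteq> \<sigma> b" for b by (auto simp: \<sigma>_def)
      then show ?thesis unfolding sum using True i by simp
    next
      case False
      define b0 where "b0 = (if a < i then a else a - 1)"
      have b0: "b0 < e" "\<sigma> b0 = a" using False aa i by (auto simp: b0_def \<sigma>_def)
      have "a = \<sigma> b \<longleftrightarrow> b = b0" for b using b0(2) by (auto simp: \<sigma>_def split: if_splits)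
      then have "(E' * E) $$ (a, a') = (\<Sum>b<e. if b = b0 then
          ((if \<sigma> b = a' then 1 else 0) - (if a' = i then v (\<sigma> b) / v i else 0)) else 0)"
        unfolding sum by (intro sum.cong) auto
      then show ?thesis using b0 by simp
    qed
  qed
  have fixed: "C * A ^\<^sub>m k * (E' * E) = C * A ^\<^sub>m k" for k
  proof (rule eq_matI)
    have CA: "C * A ^\<^sub>m k \<in> carrier_mat n ?d" by (rule mult_carrier_mat[OF C pow_carrier_mat[OF A]])
    have CAE: "C * A ^\<^sub>m k * (E' * E) \<in> carrier_mat n ?d" by (rule mult_carrier_mat[OF CA EE])
    show "dim_row (C * A ^\<^sub>m k * (E' * E)) = dim_row (C * A ^\<^sub>m k)"
      "dim_col (C * A ^\<^sub>m k * (E' * E)) = dim_col (C * A ^\<^sub>m k)"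
      by (simp_all only: carrier_matD[OF CAE] carrier_matD[OF CA])
    fix p a' assume "p < dim_row (C * A ^\<^sub>m k)" "a' < dim_col (C * A ^\<^sub>m k)"
    then have pa: "p < n" "a' < ?d" by (simp_all only: carrier_matD[OF CA])
    have "(C * A ^\<^sub>m k * (E' * E)) $$ (p, a') = (\<Sum>a<?d. (C * A ^\<^sub>m k) $$ (p, a) * (E' * E) $$ (a, a'))"
      by (rule mult_mat_index_sum[OF CA EE pa])
    also have "\<dots> = (\<Sum>a<?d. (if a = a' then (C * A ^\<^sub>m k) $$ (p, a) else 0) -
        (if a' = i then 1 / v i else 0) * ((C * A ^\<^sub>m k) $$ (p, a) * v a))"
      using pa by (intro sum.cong refl) (auto simp: proj algebra_simps)
    also have "\<dots> = (C * A ^\<^sub>m k) $$ (p, a')"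
      using unobs[OF pa(1), of k] pa by (simp add: sum_subtractf sum_distrib_left[symmetric] del: sum.lessThan_Suc)
    finally show "(C * A ^\<^sub>m k * (E' * E)) $$ (p, a') = (C * A ^\<^sub>m k) $$ (p, a')" .
  qed
  have pow: "C * E' * (E * A * E') ^\<^sub>m k * E = C * A ^\<^sub>m k" for k
  proof (induction k)
    case 0
    have "C * E' * (E * A * E') ^\<^sub>m 0 * E = C * (E' * E)"
      using right_mult_one_mat[OF CE] E assoc_mult_mat[OF C E' E] by simp
    then show ?case using fixed[of 0] A C by simp
  next
    case (Suc k)
    let ?P = "C * E' * (E * A * E') ^\<^sub>m k"
    have P: "?P \<in> carrier_mat n e" by (rule mult_carrier_mat[OF CE pow_carrier_mat[OF EAE]])
    have AEE: "A * (E' * E) \<in> carrier_mat ?d ?d" using A EE by auto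
    have CA: "C * A ^\<^sub>m k \<in> carrier_mat n ?d" by (rule mult_carrier_mat[OF C pow_carrier_mat[OF A]])
    have "C * E' * (E * A * E') ^\<^sub>m Suc k * E = ?P * (E * A * E') * E"
      using assoc_mult_mat[OF CE pow_carrier_mat[OF EAE] EAE] by simp
    also have "\<dots> = ?P * (E * A * E' * E)" by (rule assoc_mult_mat[OF P EAE E])
    also have "E * A * E' * E = E * (A * (E' * E))"
      using assoc_mult_mat[OF EA E' E] assoc_mult_mat[OF E A EE] by simp
    also have "?P * (E * (A * (E' * E))) = ?P * E * (A * (E' * E))"
      by (rule assoc_mult_mat[OF P E AEE, symmetric])
    also have "\<dots> = C * A ^\<^sub>m k * A * (E' * E)"
      unfolding Suc by (rule assoc_mult_mat[OF CA A EE, symmetric])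
    also have "C * A ^\<^sub>m k * A = C * A ^\<^sub>m Suc k"
      using assoc_mult_mat[OF C pow_carrier_mat[OF A] A] by simp
    finally show ?case unfolding fixed .
  qed
  have "C * E' * (E * A * E') ^\<^sub>m k * (E * B) = C * A ^\<^sub>m k * B" for k
    unfolding assoc_mult_mat[OF mult_carrier_mat[OF CE pow_carrier_mat[OF EAE]] E B, symmetric] pow ..
  then show ?thesis using EAE EB CE by blast
qed

lemma transpose_pow_mat:
  fixes A :: "'a :: comm_semiring_1 mat"
  assumes A: "A \<in> carrier_mat d d"
  shows "(A ^\<^sub>m k)\<^sup>T = A\<^sup>T ^\<^sub>m k"
proof (induction k)
  case (Suc k)
  have AT: "A\<^sup>T \<in> carrier_mat d d" using A by simp
  have "(A ^\<^sub>m Suc k)\<^sup>T = A\<^sup>T * (A ^\<^sub>m k)\<^sup>T" using transpose_mult[OF pow_carrier_mat[OF A] A] by simp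
  also have "\<dots> = A\<^sup>T ^\<^sub>m (1 + k)" unfolding pow_mat_add[OF AT] Suc using AT by simp
  finally show ?case by simp
qed (use A in simp)

lemma transpose_markov:
  fixes A B C :: "'a :: comm_semiring_1 mat"
  assumes A: "A \<in> carrier_mat d d" and B: "B \<in> carrier_mat d n" and C: "C \<in> carrier_mat n d"
  shows "(C * A ^\<^sub>m k * B)\<^sup>T = B\<^sup>T * A\<^sup>T ^\<^sub>m k * C\<^sup>T"
proof -
  have T: "A\<^sup>T ^\<^sub>m k \<in> carrier_mat d d" "B\<^sup>T \<in> carrier_mat n d" "C\<^sup>T \<in> carrier_mat d n" using A B C by auto
  have "(C * A ^\<^sub>m k * B)\<^sup>T = B\<^sup>T * (C * A ^\<^sub>m k)\<^sup>T"
    by (rule transpose_mult[OF mult_carrier_mat[OF C pow_carrier_mat[OF A]] B])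
  also have "(C * A ^\<^sub>m k)\<^sup>T = A\<^sup>T ^\<^sub>m k * C\<^sup>T"
    unfolding transpose_mult[OF C pow_carrier_mat[OF A]] transpose_pow_mat[OF A] ..
  also have "B\<^sup>T * (A\<^sup>T ^\<^sub>m k * C\<^sup>T) = B\<^sup>T * A\<^sup>T ^\<^sub>m k * C\<^sup>T" by (rule assoc_mult_mat[OF T(2,1,3), symmetric])
  finally show ?thesis .
qed

lemma minimal_realization_observable:
  assumes real: "is_realization n d G A B C" and min: "has_mcmillan_degree n G d"
    and unobs: "\<And>k p. p < n \<Longrightarrow> (\<Sum>a<d. (C * A ^\<^sub>m k) $$ (p, a) * v a) = 0"
    and "i < d"
  shows "v i = 0"
proof (rule ccontr)
  assume "v i \<noteq> 0"
  obtain e where e: "d = Suc e" using \<open>i < d\<close> by (cases d) auto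
  obtain A' B' C' where "A' \<in> carrier_mat e e" "B' \<in> carrier_mat e n" "C' \<in> carrier_mat n e"
    "\<And>k. C' * A' ^\<^sub>m k * B' = C * A ^\<^sub>m k * B"
    using reduce_unobservable[of A e B n C i v] real unobs \<open>i < d\<close> \<open>v i \<noteq> 0\<close>
    unfolding is_realization_def e by blast
  then have "is_realization n e G A' B' C'" using real by (auto simp: is_realization_def)
  then have "d \<le> e" using min unfolding has_mcmillan_degree_def by blast
  then show False using e by simp
qed

text \<open>Dual to observability: transposing exchanges the roles of \<open>B\<close> and
  \<open>C\<close> and preserves minimality.\<close>

lemma minimal_realization_controllable:
  assumes real: "is_realization n d G A B C" and min: "has_mcmillan_degree n G d"
    and unctr: "\<And>k q. q < n \<Longrightarrow> (\<Sum>a<d. (A ^\<^sub>m k * B) $$ (a, q) * w a) = 0"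
    and "i < d"
  shows "w i = 0"
proof -
  have ABC: "A \<in> carrier_mat d d" "B \<in> carrier_mat d n" "C \<in> carrier_mat n d"
    "\<And>k. G k = C * A ^\<^sub>m k * B" using real by (auto simp: is_realization_def)
  have T: "is_realization n d' (\<lambda>k. (H k)\<^sup>T) (A'\<^sup>T) (C'\<^sup>T) (B'\<^sup>T)"
    if "is_realization n d' H A' B' C'" for d' H A' B' C'
    using that transpose_markov[of A' d' B' n C'] by (auto simp: is_realization_def)
  have minT: "has_mcmillan_degree n (\<lambda>k. (G k)\<^sup>T) d"
    unfolding has_mcmillan_degree_def
  proof (intro conjI allI impI)
    show "\<exists>A B C. is_realization n d (\<lambda>k. (G k)\<^sup>T) A B C" using T[OF real] by blast
    fix d' A' B' C' assume "is_realization n d' (\<lambda>k. (G k)\<^sup>T) A' B' C'"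
    from T[OF this] have "is_realization n d' G (A'\<^sup>T) (C'\<^sup>T) (B'\<^sup>T)" by simp
    then show "d \<le> d'" using min unfolding has_mcmillan_degree_def by blast
  qed
  show ?thesis
  proof (rule minimal_realization_observable[OF T[OF real] minT _ \<open>i < d\<close>])
    fix k p assume p: "p < n"
    have "B\<^sup>T * A\<^sup>T ^\<^sub>m k = (A ^\<^sub>m k * B)\<^sup>T"
      unfolding transpose_mult[OF pow_carrier_mat[OF ABC(1)] ABC(2)] transpose_pow_mat[OF ABC(1)] ..
    then have "(\<Sum>a<d. (B\<^sup>T * A\<^sup>T ^\<^sub>m k) $$ (p, a) * w a) = (\<Sum>a<d. (A ^\<^sub>m k * B) $$ (a, p) * w a)"
      using ABC(1,2) p by (intro sum.cong refl) auto
    then show "(\<Sum>a<d. (B\<^sup>T * A\<^sup>T ^\<^sub>m k) $$ (p, a) * w a) = 0" using unctr[OF p] by simp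
  qed
qed

text \<open>By Cayley-Hamilton the first \<open>d\<close> powers of \<open>A\<close> decide, which
  lets the skew form be built from a finite index set. The functional \<open>w\<close> is disguised
  as an output matrix so that \<open>markov_recurrence\<close> applies.\<close>

lemma uncontrollable_of_initial_segment:
  fixes A B :: "complex mat"
  assumes A: "A \<in> carrier_mat d d" and B: "B \<in> carrier_mat d n" and q: "q < n"
    and init: "\<And>k. k < d \<Longrightarrow> (\<Sum>a<d. (A ^\<^sub>m k * B) $$ (a, q) * w a) = 0"
  shows "(\<Sum>a<d. (A ^\<^sub>m k * B) $$ (a, q) * w a) = 0"
proof -
  define C where "C = mat n d (\<lambda>(p, a). w a)"
  have C: "C \<in> carrier_mat n d" by (simp add: C_def)
  have s: "(C * A ^\<^sub>m k * B) $$ (q, q) = (\<Sum>a<d. (A ^\<^sub>m k * B) $$ (a, q) * w a)" for k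
  proof -
    have AB: "A ^\<^sub>m k * B \<in> carrier_mat d n" using A B by auto
    have "C * A ^\<^sub>m k * B = C * (A ^\<^sub>m k * B)" by (rule assoc_mult_mat[OF C pow_carrier_mat[OF A] B])
    then show ?thesis using mult_mat_index_sum[OF C AB q q] q by (simp add: C_def mult.commute)
  qed
  have "(C * A ^\<^sub>m k * B) $$ (q, q) = 0"
  proof (induction k rule: less_induct)
    case (less k)
    show ?case
    proof (cases "k < d")
      case True
      then show ?thesis using init s by simp
    next
      case False
      define j where "j = k - d"
      have k: "k = d + j" using False by (simp add: j_def)
      have "0 = (\<Sum>r\<le>d. coeff (char_poly A) r * (C * A ^\<^sub>m (r + j) * B) $$ (q, q))"
        using markov_recurrence[OF A B C q q] by simp
      also have "\<dots> = (\<Sum>r<d. coeff (char_poly A) r * (C * A ^\<^sub>m (r + j) * B) $$ (q, q)) +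
          coeff (char_poly A) d * (C * A ^\<^sub>m k * B) $$ (q, q)"
        by (simp add: lessThan_Suc_atMost[symmetric] k)
      also have "(\<Sum>r<d. coeff (char_poly A) r * (C * A ^\<^sub>m (r + j) * B) $$ (q, q)) = 0"
        by (rule sum.neutral) (simp add: less.IH k)
      finally show ?thesis using degree_monic_char_poly[OF A] by simp
    qed
  qed
  then show ?thesis using s by simp
qed

text \<open>A Hamiltonian transfer function induces a nondegenerate skew-symmetric form on the state space
  of a minimal realization, through \<open>(A\<^sup>k B e\<^sub>j, A\<^sup>l B e\<^sub>i) \<mapsto> (-1)\<^sup>k e\<^sub>j\<^sup>T C A\<^sup>k A\<^sup>l B e\<^sub>i\<close>. The matrix \<open>K\<close>
  below is its Gram matrix for the generators \<open>x\<^sub>b\<close> obtained by averaging the reachable vectors against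
  their complex conjugates, which makes \<open>X\<close> positive definite.\<close>

lemma Ham_degree_even:
  assumes "G \<in> Ham d n"
  shows "even d"
proof -
  have min: "has_mcmillan_degree n G d" and parity: "\<And>k. G k = (-1) ^ (k + 1) \<cdot>\<^sub>m (G k)\<^sup>T"
    using assms unfolding Ham_def by blast+
  obtain A B C where real: "is_realization n d G A B C" using min by (auto simp: has_mcmillan_degree_def)
  then have A: "A \<in> carrier_mat d d" and B: "B \<in> carrier_mat d n" and C: "C \<in> carrier_mat n d"
    and G: "\<And>k. G k = C * A ^\<^sub>m k * B" by (auto simp: is_realization_def)
  define x where "x = (\<lambda>(k, j) a. (A ^\<^sub>m k * B) $$ (a, j))"
  define y where "y = (\<lambda>(k, j) a. (-1) ^ k * (C * A ^\<^sub>m k) $$ (j, a))"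
  define I where "I = {..<d} \<times> {..<n}"
  define T where "T b \<kappa> = cnj (x \<kappa> b)" for b \<kappa>
  define X where "X = mat d d (\<lambda>(a, b). \<Sum>\<kappa>\<in>I. T b \<kappa> * x \<kappa> a)"
  define Y where "Y = mat d d (\<lambda>(b, a). \<Sum>\<kappa>\<in>I. T b \<kappa> * y \<kappa> a)"
  have X: "X \<in> carrier_mat d d" and Y: "Y \<in> carrier_mat d d" by (auto simp: X_def Y_def)
  have pair: "(\<Sum>a<d. y (k, j) a * x (k', j') a) = (-1) ^ k * G (k + k') $$ (j, j')"
    if "j < n" "j' < n" for k j k' j'
  proof -
    have pow: "A ^\<^sub>m k \<in> carrier_mat d d" "A ^\<^sub>m k' \<in> carrier_mat d d" using A by auto
    have CA: "C * A ^\<^sub>m k \<in> carrier_mat n d" and AB: "A ^\<^sub>m k' * B \<in> carrier_mat d n"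
      using mult_carrier_mat[OF C pow(1)] mult_carrier_mat[OF pow(2) B] by auto
    have "G (k + k') = (C * A ^\<^sub>m k) * (A ^\<^sub>m k' * B)"
      unfolding G pow_mat_add[OF A]
      using assoc_mult_mat[OF C pow] assoc_mult_mat[OF CA pow(2) B] by simp
    then show ?thesis using mult_mat_index_sum[OF CA AB that]
      by (simp add: x_def y_def sum_distrib_left mult.assoc)
  qed
  have skew: "(\<Sum>a<d. y \<kappa> a * x \<kappa>' a) = - (\<Sum>a<d. y \<kappa>' a * x \<kappa> a)"
    if "snd \<kappa> < n" "snd \<kappa>' < n" for \<kappa> \<kappa>'
  proof -
    obtain k j k' j' where \<kappa>: "\<kappa> = (k, j)" "\<kappa>' = (k', j')" by (metis surj_pair)
    then have j: "j < n" "j' < n" using that by auto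
    have Gc: "G (k + k') \<in> carrier_mat n n" unfolding G by (rule markov_carrier[OF A B C])
    have "G (k + k') $$ (j, j') = (-1) ^ (k + k' + 1) * G (k + k') $$ (j', j)"
      using arg_cong[OF parity[of "k + k'"], of "\<lambda>M. M $$ (j, j')"] Gc j by simp
    then show ?thesis unfolding \<kappa> pair[OF j] pair[OF j(2,1)]
      by (cases "even k") (auto simp: power_add add.commute[of k' k])
  qed
  have detX: "det X \<noteq> 0" unfolding X_def det_neq_0_iff_rows_independent
  proof (intro allI impI)
    fix c i assume c: "\<forall>b<d. (\<Sum>a<d. c a * (\<Sum>\<kappa>\<in>I. T b \<kappa> * x \<kappa> a)) = 0" and "i < d"
    define s where "s \<kappa> = (\<Sum>a<d. x \<kappa> a * c a)" for \<kappa>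
    have s: "(\<Sum>\<kappa>\<in>I. T b \<kappa> * s \<kappa>) = 0" if "b < d" for b
    proof -
      have "(\<Sum>\<kappa>\<in>I. T b \<kappa> * s \<kappa>) = (\<Sum>\<kappa>\<in>I. \<Sum>a<d. c a * (T b \<kappa> * x \<kappa> a))"
        by (simp add: s_def sum_distrib_left mult_ac)
      also have "\<dots> = (\<Sum>a<d. c a * (\<Sum>\<kappa>\<in>I. T b \<kappa> * x \<kappa> a))"
        by (subst sum.swap) (simp add: sum_distrib_left)
      finally show ?thesis using c that by simp
    qed
    \<comment> \<open>The Hermitian form of \<open>X\<close> at \<open>c\<close>, a sum of squared
      absolute values. Its vanishing makes every \<open>s \<kappa>\<close> zero, and controllability
      then forces \<open>c\<close> to vanish.\<close>
    have "(\<Sum>\<kappa>\<in>I. cnj (s \<kappa>) * s \<kappa>) = (\<Sum>\<kappa>\<in>I. \<Sum>b<d. cnj (c b) * (T b \<kappa> * s \<kappa>))"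
      by (intro sum.cong refl) (simp add: s_def[of "_ :: nat \<times> nat"] T_def sum_distrib_right sum_distrib_left mult_ac)
    also have "\<dots> = (\<Sum>b<d. cnj (c b) * (\<Sum>\<kappa>\<in>I. T b \<kappa> * s \<kappa>))"
      by (subst sum.swap) (simp add: sum_distrib_left)
    also have "\<dots> = 0" using s by simp
    finally have "complex_of_real (\<Sum>\<kappa>\<in>I. (cmod (s \<kappa>))\<^sup>2) = 0"
      by (simp add: complex_norm_square[symmetric] mult.commute[of "cnj _"] del: complex_mult_cnj)
    then have "(\<Sum>\<kappa>\<in>I. (cmod (s \<kappa>))\<^sup>2) = 0" by (simp only: of_real_eq_0_iff)
    then have s0: "s \<kappa> = 0" if "\<kappa> \<in> I" for \<kappa>
      using that by (subst (asm) sum_nonneg_eq_0_iff) (auto simp: I_def)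
    have "(\<Sum>a<d. (A ^\<^sub>m k * B) $$ (a, q) * c a) = 0" if q: "q < n" for k q
      by (rule uncontrollable_of_initial_segment[OF A B q])
        (use s0[of "(_, q)"] q in \<open>simp add: I_def s_def x_def\<close>)
    then show "c i = 0" by (rule minimal_realization_controllable[OF real min _ \<open>i < d\<close>])
  qed
  have detY: "det Y \<noteq> 0" unfolding Y_def det_neq_0_iff_rows_independent
  proof (intro allI impI)
    fix c i assume c: "\<forall>a<d. (\<Sum>b<d. c b * (\<Sum>\<kappa>\<in>I. T b \<kappa> * y \<kappa> a)) = 0" and "i < d"
    define p where "p \<kappa> = (\<Sum>b<d. c b * T b \<kappa>)" for \<kappa>
    have swap: "(\<Sum>b<d. c b * (\<Sum>\<kappa>\<in>I. T b \<kappa> * f \<kappa>)) = (\<Sum>\<kappa>\<in>I. p \<kappa> * f \<kappa>)" for f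
    proof -
      have "(\<Sum>b<d. c b * (\<Sum>\<kappa>\<in>I. T b \<kappa> * f \<kappa>)) = (\<Sum>b<d. \<Sum>\<kappa>\<in>I. c b * T b \<kappa> * f \<kappa>)"
        by (simp add: sum_distrib_left mult.assoc)
      also have "\<dots> = (\<Sum>\<kappa>\<in>I. p \<kappa> * f \<kappa>)"
        by (subst sum.swap) (simp add: p_def sum_distrib_right)
      finally show ?thesis .
    qed
    have py: "(\<Sum>\<kappa>\<in>I. p \<kappa> * y \<kappa> a) = 0" if "a < d" for a using c that swap by simp
    \<comment> \<open>\<open>v\<close> is \<open>X\<close> applied to \<open>c\<close>. By
      skew-symmetry the relation \<open>py\<close> makes \<open>v\<close> orthogonal to every
      \<open>y (k, j)\<close>, that is, unobservable; so \<open>v\<close> is zero and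
      \<open>detX\<close> gives the vanishing of \<open>c\<close>.\<close>
    define v where "v a = (\<Sum>\<kappa>\<in>I. p \<kappa> * x \<kappa> a)" for a
    have "(\<Sum>a<d. y (k, j) a * v a) = 0" if "j < n" for k j
    proof -
      have "(\<Sum>a<d. y (k, j) a * v a) = (\<Sum>a<d. \<Sum>\<kappa>\<in>I. p \<kappa> * (y (k, j) a * x \<kappa> a))"
        by (simp add: v_def sum_distrib_left mult_ac)
      also have "\<dots> = (\<Sum>\<kappa>\<in>I. p \<kappa> * (\<Sum>a<d. y (k, j) a * x \<kappa> a))"
        by (subst sum.swap) (simp add: sum_distrib_left)
      also have "\<dots> = (\<Sum>\<kappa>\<in>I. p \<kappa> * - (\<Sum>a<d. y \<kappa> a * x (k, j) a))"
        using that by (intro sum.cong refl arg_cong2[where f = "(*)"] skew) (auto simp: I_def)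
      also have "\<dots> = - (\<Sum>\<kappa>\<in>I. \<Sum>a<d. p \<kappa> * y \<kappa> a * x (k, j) a)"
        by (simp add: sum_negf sum_distrib_left mult.assoc)
      also have "\<dots> = - (\<Sum>a<d. (\<Sum>\<kappa>\<in>I. p \<kappa> * y \<kappa> a) * x (k, j) a)"
        by (subst sum.swap) (simp add: sum_distrib_right)
      finally show ?thesis using py by simp
    qed
    then have "(\<Sum>a<d. (C * A ^\<^sub>m k) $$ (j, a) * v a) = 0" if "j < n" for j k
      using that by (simp add: y_def mult.assoc sum_distrib_left[symmetric])
    then have v0: "v a = 0" if "a < d" for a
      using minimal_realization_observable[OF real min] that by blast
    have "X *\<^sub>v vec d c = 0\<^sub>v d"
    proof (rule eq_vecI)
      fix a assume "a < dim_vec (0\<^sub>v d :: complex vec)"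
      then have a: "a < d" by simp
      have "(X *\<^sub>v vec d c) $ a = (\<Sum>b<d. c b * (\<Sum>\<kappa>\<in>I. T b \<kappa> * x \<kappa> a))"
        using a by (auto simp: X_def scalar_prod_def atLeast0LessThan mult.commute intro!: sum.cong)
      then show "(X *\<^sub>v vec d c) $ a = 0\<^sub>v d $ a" using v0[OF a] a swap by (simp add: v_def)
    qed (simp add: X_def)
    then have "vec d c = 0\<^sub>v d" using detX det_0_iff_vec_prod_zero[OF X] vec_carrier by blast
    then show "c i = 0" using \<open>i < d\<close> by (metis index_vec index_zero_vec(1))
  qed
  define K where "K = Y * X"
  have K: "K \<in> carrier_mat d d" using X Y by (simp add: K_def)
  have detK: "det K \<noteq> 0" unfolding K_def det_mult[OF Y X] using detX detY by simp
  have K_entry: "K $$ (b, c) = (\<Sum>\<kappa>\<in>I. \<Sum>\<kappa>'\<in>I. T b \<kappa> * T c \<kappa>' * (\<Sum>a<d. y \<kappa> a * x \<kappa>' a))"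
    if "b < d" "c < d" for b c
  proof -
    have "K $$ (b, c) = (\<Sum>a<d. (\<Sum>\<kappa>\<in>I. T b \<kappa> * y \<kappa> a) * (\<Sum>\<kappa>'\<in>I. T c \<kappa>' * x \<kappa>' a))"
      unfolding K_def mult_mat_index_sum[OF Y X that] using that by (simp add: X_def Y_def)
    also have "\<dots> = (\<Sum>a<d. \<Sum>\<kappa>\<in>I. \<Sum>\<kappa>'\<in>I. T b \<kappa> * T c \<kappa>' * (y \<kappa> a * x \<kappa>' a))"
      by (simp add: sum_product mult_ac)
    also have "\<dots> = (\<Sum>\<kappa>\<in>I. \<Sum>a<d. \<Sum>\<kappa>'\<in>I. T b \<kappa> * T c \<kappa>' * (y \<kappa> a * x \<kappa>' a))"
      by (rule sum.swap)
    also have "\<dots> = (\<Sum>\<kappa>\<in>I. \<Sum>\<kappa>'\<in>I. \<Sum>a<d. T b \<kappa> * T c \<kappa>' * (y \<kappa> a * x \<kappa>' a))"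
      by (intro sum.cong refl sum.swap)
    finally show ?thesis by (simp add: sum_distrib_left)
  qed
  have "K\<^sup>T = (- 1) \<cdot>\<^sub>m K"
  proof (rule eq_matI)
    fix b c assume "b < dim_row ((- 1) \<cdot>\<^sub>m K)" "c < dim_col ((- 1) \<cdot>\<^sub>m K)"
    then have bc: "b < d" "c < d" using K by auto
    have "K $$ (c, b) = (\<Sum>\<kappa>\<in>I. \<Sum>\<kappa>'\<in>I. T b \<kappa> * T c \<kappa>' * (\<Sum>a<d. y \<kappa>' a * x \<kappa> a))"
      unfolding K_entry[OF bc(2,1)] by (subst sum.swap) (simp add: mult.commute[of "T c _"])
    also have "\<dots> = (\<Sum>\<kappa>\<in>I. \<Sum>\<kappa>'\<in>I. T b \<kappa> * T c \<kappa>' * - (\<Sum>a<d. y \<kappa> a * x \<kappa>' a))"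
      by (intro sum.cong refl arg_cong2[where f = "(*)"] skew) (auto simp: I_def)
    also have "\<dots> = - K $$ (b, c)" unfolding K_entry[OF bc] by (simp add: sum_negf)
    finally show "K\<^sup>T $$ (b, c) = ((- 1) \<cdot>\<^sub>m K) $$ (b, c)" using K bc by simp
  qed (use K in auto)
  then have "det K = (-1) ^ d * det K" using det_transpose[OF K] K by (metis carrier_matD(2) det_smult)
  then show "even d" using detK by (cases "even d") auto
qed

theorem mainTheorem5:
  shows
  \<comment> \<open>(a), symmetric case\<close>
  "(\<forall>n d G A B C. d > (n + 1) choose 2 \<longrightarrow> G \<in> SRat d n \<longrightarrow> is_realization n d G A B C \<longrightarrow>
      \<not> contains_open_monic d (closed_loop_polys A B C (Sym n)) \<and>
      \<not> contains_open_monic d (closed_loop_polys A B C (real_Sym n)))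
   \<and>
  \<comment> \<open>(a), Hamiltonian case\<close>
   (\<forall>n d G A B C. d > n * (n + 1) \<longrightarrow> G \<in> Ham d n \<longrightarrow> is_realization n d G A B C \<longrightarrow>
      \<not> contains_open_even_monic d (closed_loop_polys A B C (Sym n)) \<and>
      \<not> contains_open_even_monic d (closed_loop_polys A B C (real_Sym n)))
   \<and>
  \<comment> \<open>(b), symmetric case\<close>
   (\<forall>n d. d \<le> (n + 1) choose 2 \<longrightarrow>
      (\<exists>U. rat_zariski_open d n (SRat d n) U \<and> U \<noteq> {} \<and>
         (\<forall>G\<in>U. \<forall>A B C. is_realization n d G A B C \<longrightarrow>
            contains_open_monic d (closed_loop_polys A B C (Sym n)))))
   \<and>
  \<comment> \<open>(b), Hamiltonian case (McMillan degree of a Hamiltonian system is even)\<close>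
   (\<forall>n d. d \<le> n * (n + 1) \<longrightarrow> even d \<longrightarrow>
      (\<exists>U. rat_zariski_open d n (Ham d n) U \<and> U \<noteq> {} \<and>
         (\<forall>G\<in>U. \<forall>A B C. is_realization n d G A B C \<longrightarrow>
            contains_open_even_monic d (closed_loop_polys A B C (Sym n)))))"
proof (intro conjI allI impI)
  have real_sub: "real_Sym n \<subseteq> Sym n" for n by (auto simp: real_Sym_def)
  have choose: "2 * ((n + 1) choose 2) = n * (n + 1)" for n
    by (induction n) (auto simp: numeral_2_eq_2)
  {
    fix n d G A B C
    assume "(n + 1) choose 2 < d" "is_realization n d G A B C"
    then show "\<not> contains_open_monic d (closed_loop_polys A B C (Sym n))"
      "\<not> contains_open_monic d (closed_loop_polys A B C (real_Sym n))"
      using real_sub by (auto simp: is_realization_def intro!: not_contains_open_monic del: notI)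
  next
    fix n d G A B C
    assume d: "n * (n + 1) < d" and "G \<in> Ham d n" and real: "is_realization n d G A B C"
    then have "even d" using Ham_degree_even by blast
    \<comment> \<open>An odd \<open>d = n * (n + 1) + 1\<close> would give
      \<open>d div 2 = (n + 1) choose 2\<close>, without the strict inequality that the count
      needs.\<close>
    then have "(n + 1) choose 2 < d div 2" using d choose[of n] by auto
    with real show "\<not> contains_open_even_monic d (closed_loop_polys A B C (Sym n))"
      "\<not> contains_open_even_monic d (closed_loop_polys A B C (real_Sym n))"
      using real_sub by (auto simp: is_realization_def intro!: not_contains_open_even_monic del: notI)
  next
    fix n d :: nat
    assume d: "d \<le> (n + 1) choose 2"
    let ?U = "{G \<in> SRat d n. det (mat d d (\<lambda>(k, l). G k $$ (sym_pairs n ! l))) \<noteq> 0}"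
    have "rat_zariski_open d n (SRat d n) ?U"
      using rat_zariski_open_markov_minor[of d "\<lambda>k. k" d n] d by simp
    moreover have "?U \<noteq> {}" using SRat_witness[OF d] by blast
    moreover have "contains_open_monic d (closed_loop_polys A B C (Sym n))"
      if "G \<in> ?U" "is_realization n d G A B C" for G A B C
    proof -
      have G: "G = (\<lambda>k. C * A ^\<^sub>m k * B)" using that(2) by (auto simp: is_realization_def)
      have "A \<in> carrier_mat d d" "B \<in> carrier_mat d n" "C \<in> carrier_mat n d"
        using that(2) by (auto simp: is_realization_def)
      then show ?thesis using that(1) unfolding G SRat_def
        by (intro contains_open_monic_of_minor[OF _ _ _ d]) auto
    qed
    ultimately show "\<exists>U. rat_zariski_open d n (SRat d n) U \<and> U \<noteq> {} \<and>
         (\<forall>G\<in>U. \<forall>A B C. is_realization n d G A B C \<longrightarrow>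
            contains_open_monic d (closed_loop_polys A B C (Sym n)))" by blast
  next
    fix n d :: nat
    assume d: "d \<le> n * (n + 1)" "even d"
    then obtain m where m: "d = 2 * m" by blast
    have m_le: "m \<le> (n + 1) choose 2" using d(1) choose[of n] m by simp
    let ?U = "{G \<in> Ham d n. det (mat m m (\<lambda>(k, l). G (2 * k + 1) $$ (sym_pairs n ! l))) \<noteq> 0}"
    have "rat_zariski_open d n (Ham d n) ?U"
      by (rule rat_zariski_open_markov_minor[OF _ m_le]) (simp add: m)
    moreover have "?U \<noteq> {}" using Ham_witness[OF m_le] m by blast
    moreover have "contains_open_even_monic d (closed_loop_polys A B C (Sym n))"
      if "G \<in> ?U" "is_realization n d G A B C" for G A B C
    proof -
      have G: "G = (\<lambda>k. C * A ^\<^sub>m k * B)" using that(2) by (auto simp: is_realization_def)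
      have ABC: "A \<in> carrier_mat (2 * m) (2 * m)" "B \<in> carrier_mat (2 * m) n" "C \<in> carrier_mat n (2 * m)"
        using that(2) m by (auto simp: is_realization_def)
      have "C * A ^\<^sub>m k * B = (-1) ^ (k + 1) \<cdot>\<^sub>m (C * A ^\<^sub>m k * B)\<^sup>T" for k
        using that(1) unfolding G Ham_def by blast
      moreover have "det (mat m m (\<lambda>(k, l). (C * A ^\<^sub>m (2 * k + 1) * B) $$ (sym_pairs n ! l))) \<noteq> 0"
        using that(1) unfolding G by blast
      ultimately show ?thesis unfolding m by (rule contains_open_even_monic_of_minor[OF ABC m_le])
    qed
    ultimately show "\<exists>U. rat_zariski_open d n (Ham d n) U \<and> U \<noteq> {} \<and>
         (\<forall>G\<in>U. \<forall>A B C. is_realization n d G A B C \<longrightarrow>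
            contains_open_even_monic d (closed_loop_polys A B C (Sym n)))" by blast
  }
qed

end
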